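(* Let $d\ge 1$, $H\in(\tfrac12,1)$, $0<t_0<T$, and assume $\beta\in\big(2H-1,\ d\wedge(2H+1)\big)$. Let $u$ be the mild solution of the linear stochastic wave equation with zero initial conditions driven by the fractional-colored noise $W$ with Hurst index $H$ and Riesz spatial covariance of parameter $\beta$ (as defined in the context). Fix $M>0$ and $t\in[t_0,T]$. Then there exist positive constants $c_3,c_4$ such that for any $x,y\in[-M,M]^d$ $$c_3|x-y|^{2H+1-\beta}\ \le\ \mathbf{E}\,|u(t,x)-u(t,y)|^2\ \le\ c_4|x-y|^{2H+1-\beta}.$$
   Context: Fourier transform convention: $\mathcal F\varphi(\xi)=\int_{\mathbb R^d}e^{-i\xi\cdot x}\varphi(x)\,dx$. Let $\mu(d\xi)=|\xi|^{-d+\beta}d\xi$ on $\mathbb R^d$, $0<\beta<d$, and let $f$ be the Fourier transform of $\mu$ in $\mathcal S'(\mathbb R^d)$, i.e. $\int f\varphi\,dx=\int\mathcal F\varphi\,d\mu$ for $\varphi\in\mathcal S(\mathbb R^d)$ (the Riesz kernel, a constant multiple of $|x|^{-\beta}$). Let $R_H(t,s)=\frac12(t^{2H}+s^{2H}-|t-s|^{2H})$ and $\alpha_H=H(2H-1)$. The noise $W=\{W_t(A):t\ge0,\ A\subset\mathbb R^d \text{ bounded Borel}\}$ is a centered Gaussian family with covariance $\mathbf E(W_t(A)W_s(B))=R_H(t,s)\int_A\int_B f(x-y)\,dx\,dy$. The Hilbert space $\mathcal{HP}$ is the completion of the linear span of the functions $1_{[0,t]\times A}$ for the inner product $\langle\varphi,\psi\rangle_{\mathcal{HP}}=\alpha_H\int_{\mathbb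 R^d}\int_0^\infty\int_0^\infty\mathcal F\varphi(r,\cdot)(\xi)\overline{\mathcal F\psi(v,\cdot)(\xi)}|r-v|^{2H-2}\,dr\,dv\,\mu(d\xi)$, and $1_{[0,t]\times A}\mapsto W_t(A)$ extends to an isometry $\varphi\mapsto W(\varphi)=\int_0^\infty\int_{\mathbb R^d}\varphi\,dW$ from $\mathcal{HP}$ into $L^2(\Omega)$. The stochastic wave equation is $\partial_t^2u=\Delta u+\dot W$ on $(0,\infty)\times\mathbb R^d$, $u(0,\cdot)=0$, $\partial_tu(0,\cdot)=0$. Let $G_1$ be the fundamental solution of $u_{tt}-\Delta u=0$, with $\mathcal FG_1(t,\cdot)(\xi)=\sin(t|\xi|)/|\xi|$. The (mild) solution is the centered Gaussian process $u(t,x)=\int_0^t\int_{\mathbb R^d}G_1(t-s,x-y)\,W(ds,dy)$, i.e. $u(t,x)=W(g_{t,x})$ with $g_{t,x}=G_1(t-\cdot,x-\cdot)1_{[0,t]}$; it is well defined for $\beta\in(0,d\wedge(2H+1))$. Equivalently, $u$ is centered Gaussian with $$\mathbf E[u(t,x)u(s,y)]=\alpha_H\int_{\mathbb R^d}\mu(d\xi)\,e^{-i\xi\cdot(x-y)}\int_0^t\int_0^s\frac{\sin((t-r)|\xi|)\,\sin((s-v)|\xi|)}{|\xi|^2}\,|r-v|^{2H-2}\,dv\,dr .$$ *)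

theory Defs
  imports "HOL-Probability.Probability"
begin

definition fourier :: "('a::euclidean_space \<Rightarrow> complex) \<Rightarrow> 'a \<Rightarrow> complex" where
  "fourier \<phi> \<xi> = (LINT x|lborel. exp (- \<i> * complex_of_real (\<xi> \<bullet> x)) * \<phi> x)"

text \<open>The iterated partial derivative \<open>\<partial>\<^sub>b\<^sub>1 \<dots> \<partial>\<^sub>b\<^sub>k \<phi>\<close> for a list \<open>[b\<^sub>1, \<dots>, b\<^sub>k]\<close> of basis vectors.\<close>

primrec iter_partial :: "'a::euclidean_space list \<Rightarrow> ('a \<Rightarrow> complex) \<Rightarrow> 'a \<Rightarrow> complex" where
  "iter_partial [] \<phi> = \<phi>"
| "iter_partial (b # bs) \<phi> = (\<lambda>x. frechet_derivative (iter_partial bs \<phi>) (at x) b)"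

definition schwartz :: "('a::euclidean_space \<Rightarrow> complex) \<Rightarrow> bool" where
  "schwartz \<phi> \<longleftrightarrow> (\<forall>bs. set bs \<subseteq> Basis \<longrightarrow>
     (\<forall>x. iter_partial bs \<phi> differentiable (at x)) \<and>
     (\<forall>k::nat. bounded (range (\<lambda>x. norm x ^ k * norm (iter_partial bs \<phi> x)))))"

definition riesz_measure :: "real \<Rightarrow> 'a::euclidean_space measure" where
  "riesz_measure \<beta> =
     density lborel (\<lambda>\<xi>. ennreal (norm \<xi> powr (- real DIM('a) + \<beta>)))"

text \<open>\<open>f\<close> is a function representing the Fourier transform of \<open>riesz_measure \<beta>\<close> as a tempered
  distribution. This determines \<open>f\<close> up to a Lebesgue null set.\<close>

definition riesz_kernel :: "real \<Rightarrow> ('a::euclidean_space \<Rightarrow> real) \<Rightarrow> bool" where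
  "riesz_kernel \<beta> f \<longleftrightarrow> f \<in> borel_measurable borel \<and>
     (\<forall>\<phi>. schwartz \<phi> \<longrightarrow>
        integrable lborel (\<lambda>x. complex_of_real (f x) * \<phi> x) \<and>
        (LINT x|lborel. complex_of_real (f x) * \<phi> x) = (LINT \<xi>|riesz_measure \<beta>. fourier \<phi> \<xi>))"

definition fbm_cov :: "real \<Rightarrow> real \<Rightarrow> real \<Rightarrow> real" where
  "fbm_cov H t s = (t powr (2 * H) + s powr (2 * H) - \<bar>t - s\<bar> powr (2 * H)) / 2"

text \<open>The degenerate law (unit mass at 0) counts as centered Gaussian.\<close>

definition centered_gaussian :: "'w measure \<Rightarrow> ('w \<Rightarrow> real) \<Rightarrow> bool" where
  "centered_gaussian P X \<longleftrightarrow> X \<in> borel_measurable P \<and>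
     (distr P borel X = return borel 0 \<or>
      (\<exists>\<sigma>>0. distr P borel X = density lborel (\<lambda>x. ennreal (normal_density 0 \<sigma> x))))"

definition centered_gaussian_family :: "'w measure \<Rightarrow> 'i set \<Rightarrow> ('i \<Rightarrow> 'w \<Rightarrow> real) \<Rightarrow> bool" where
  "centered_gaussian_family P I X \<longleftrightarrow>
     (\<forall>F c. finite F \<longrightarrow> F \<subseteq> I \<longrightarrow> centered_gaussian P (\<lambda>\<omega>. \<Sum>i\<in>F. c i * X i \<omega>))"

definition noise_index :: "(real \<times> 'a::euclidean_space set) set" where
  "noise_index = {0..} \<times> {A. A \<in> sets borel \<and> bounded A}"

definition fractional_colored_noise ::
    "'w measure \<Rightarrow> real \<Rightarrow> ('a::euclidean_space \<Rightarrow> real) \<Rightarrow> (real \<Rightarrow> 'a set \<Rightarrow> 'w \<Rightarrow> real) \<Rightarrow> bool" where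
  "fractional_colored_noise P H f W \<longleftrightarrow>
     centered_gaussian_family P noise_index (\<lambda>(t, A). W t A) \<and>
     (\<forall>(t, A)\<in>noise_index. \<forall>(s, B)\<in>noise_index.
        (LINT \<omega>|P. W t A \<omega> * W s B \<omega>) =
          fbm_cov H t s * (LINT x:A|lborel. LINT y:B|lborel. f (x - y)))"

text \<open>Below, an integrand is given by its Fourier transform in the space variable,
  a function \<open>\<Phi> r \<xi>\<close> of time \<open>r\<close> and frequency \<open>\<xi>\<close>. This also covers integrands
  whose spatial sections are genuine distributions, such as the wave kernel in high dimension.\<close>

definition hp_time_form ::
    "real \<Rightarrow> (real \<Rightarrow> 'a \<Rightarrow> complex) \<Rightarrow> (real \<Rightarrow> 'a \<Rightarrow> complex) \<Rightarrow> 'a \<Rightarrow> complex" where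
  "hp_time_form H \<Phi> \<Psi> \<xi> =
     (LINT r:{0..}|lborel. LINT v:{0..}|lborel.
        \<Phi> r \<xi> * cnj (\<Psi> v \<xi>) * complex_of_real (\<bar>r - v\<bar> powr (2 * H - 2)))"

definition hp_inner ::
    "real \<Rightarrow> real \<Rightarrow> (real \<Rightarrow> 'a::euclidean_space \<Rightarrow> complex) \<Rightarrow> (real \<Rightarrow> 'a \<Rightarrow> complex) \<Rightarrow> complex" where
  "hp_inner H \<beta> \<Phi> \<Psi> =
     complex_of_real (H * (2 * H - 1)) * (LINT \<xi>|riesz_measure \<beta>. hp_time_form H \<Phi> \<Psi> \<xi>)"

text \<open>All integrals in \<open>hp_inner H \<beta> \<Phi> \<Phi>\<close> exist. Absolute convergence is required of the double
  time integral for almost every frequency and then of the frequency integral, but not of the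
  triple integral: for the wave kernel the latter would force \<open>\<beta> < 2\<close>.\<close>

definition hp_admissible :: "real \<Rightarrow> real \<Rightarrow> (real \<Rightarrow> 'a::euclidean_space \<Rightarrow> complex) \<Rightarrow> bool" where
  "hp_admissible H \<beta> \<Phi> \<longleftrightarrow>
     case_prod \<Phi> \<in> borel_measurable (borel \<Otimes>\<^sub>M borel) \<and>
     (AE \<xi> in riesz_measure \<beta>.
        set_integrable (lborel \<Otimes>\<^sub>M lborel) ({0..} \<times> {0..})
          (\<lambda>(r, v). \<Phi> r \<xi> * cnj (\<Phi> v \<xi>) * complex_of_real (\<bar>r - v\<bar> powr (2 * H - 2)))) \<and>
     integrable (riesz_measure \<beta>) (hp_time_form H \<Phi> \<Phi>)"

definition hp_norm :: "real \<Rightarrow> real \<Rightarrow> (real \<Rightarrow> 'a::euclidean_space \<Rightarrow> complex) \<Rightarrow> real" where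
  "hp_norm H \<beta> \<Phi> = sqrt (Re (hp_inner H \<beta> \<Phi> \<Phi>))"

text \<open>A list of triples \<open>(c, s, A)\<close> encodes the element \<open>\<Sum> c 1\<^bsub>[0,s] \<times> A\<^esub>\<close> of the linear span
  of the indicators.\<close>

type_synonym 'a step = "(real \<times> real \<times> 'a set) list"

definition step_ok :: "'a::euclidean_space step \<Rightarrow> bool" where
  "step_ok L \<longleftrightarrow> (\<forall>(c, s, A)\<in>set L. (s, A) \<in> noise_index)"

definition step_fun :: "'a step \<Rightarrow> real \<Rightarrow> 'a \<Rightarrow> real" where
  "step_fun L r x = (\<Sum>(c, s, A)\<leftarrow>L. c * indicator ({0..s} \<times> A) (r, x))"

definition step_integral :: "(real \<Rightarrow> 'a set \<Rightarrow> 'w \<Rightarrow> real) \<Rightarrow> 'a step \<Rightarrow> 'w \<Rightarrow> real" where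
  "step_integral W L \<omega> = (\<Sum>(c, s, A)\<leftarrow>L. c * W s A \<omega>)"

definition step_fourier :: "'a::euclidean_space step \<Rightarrow> real \<Rightarrow> 'a \<Rightarrow> complex" where
  "step_fourier L r = fourier (\<lambda>x. complex_of_real (step_fun L r x))"

text \<open>\<open>\<Phi>\<close> represents an element of the completion of the linear span, and \<open>X\<close> is (a version of) its
  image under the isometric extension of \<open>1\<^bsub>[0,t] \<times> A\<^esub> \<mapsto> W t A\<close> to that completion: some
  sequence in the span converges to \<open>\<Phi>\<close> in the Hilbert norm while its images converge to \<open>X\<close>
  in mean square. By the isometry property \<open>X\<close> is unique up to almost sure equality.\<close>

definition wiener_integral ::
    "'w measure \<Rightarrow> real \<Rightarrow> real \<Rightarrow> (real \<Rightarrow> 'a::euclidean_space set \<Rightarrow> 'w \<Rightarrow> real) \<Rightarrow>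
     (real \<Rightarrow> 'a \<Rightarrow> complex) \<Rightarrow> ('w \<Rightarrow> real) \<Rightarrow> bool" where
  "wiener_integral P H \<beta> W \<Phi> X \<longleftrightarrow>
     X \<in> borel_measurable P \<and> integrable P (\<lambda>\<omega>. (X \<omega>)\<^sup>2) \<and>
     (\<exists>L. (\<forall>n::nat. step_ok (L n) \<and> hp_admissible H \<beta> (\<lambda>r \<xi>. step_fourier (L n) r \<xi> - \<Phi> r \<xi>)) \<and>
          (\<lambda>n. hp_norm H \<beta> (\<lambda>r \<xi>. step_fourier (L n) r \<xi> - \<Phi> r \<xi>)) \<longlonglongrightarrow> 0 \<and>
          (\<lambda>n. LINT \<omega>|P. (step_integral W (L n) \<omega> - X \<omega>)\<^sup>2) \<longlonglongrightarrow> 0)"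

text \<open>The Fourier transform in space of the fundamental solution \<open>G\<^sub>1(t, \<cdot>)\<close> of the wave equation.
  The value at \<open>\<xi> = 0\<close> is immaterial.\<close>

definition wave_fourier :: "real \<Rightarrow> 'a::euclidean_space \<Rightarrow> complex" where
  "wave_fourier t \<xi> = complex_of_real (sin (t * norm \<xi>) / norm \<xi>)"

text \<open>The Fourier transform in \<open>y\<close> of \<open>g\<^sub>t\<^sub>,\<^sub>x(r, y) = G\<^sub>1(t - r, x - y) 1\<^bsub>[0,t]\<^esub>(r)\<close>: the
  substitution \<open>y \<mapsto> x - y\<close> yields the phase factor and the argument \<open>-\<xi>\<close>.\<close>

definition wave_integrand_fourier ::
    "real \<Rightarrow> 'a::euclidean_space \<Rightarrow> real \<Rightarrow> 'a \<Rightarrow> complex" where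
  "wave_integrand_fourier t x r \<xi> =
     indicator {0..t} r * exp (- \<i> * complex_of_real (\<xi> \<bullet> x)) * wave_fourier (t - r) (- \<xi>)"

definition mild_wave_solution ::
    "'w measure \<Rightarrow> real \<Rightarrow> real \<Rightarrow> (real \<Rightarrow> 'a::euclidean_space set \<Rightarrow> 'w \<Rightarrow> real) \<Rightarrow>
     (real \<Rightarrow> 'a \<Rightarrow> 'w \<Rightarrow> real) \<Rightarrow> bool" where
  "mild_wave_solution P H \<beta> W u \<longleftrightarrow>
     (\<forall>t\<ge>0. \<forall>x. wiener_integral P H \<beta> W (wave_integrand_fourier t x) (u t x))"

end

theory Submission
  imports Defs
begin

text \<open>
  Write \<open>z = x - y\<close>. The isometry turns the mean square increment into a frequency integral,
  \<open>E |u(t,x) - u(t,y)|\<^sup>2 = \<alpha> \<integral> |e\<^bsup>-i\<xi>x\<^esup> - e\<^bsup>-i\<xi>y\<^esup>|\<^sup>2 N(|\<xi>|) |\<xi>|\<^bsup>\<beta>-d\<^esup> d\<xi>\<close> with \<open>\<alpha> = H(2H-1)\<close>, where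
  \<open>N(k)\<close> is the energy of the time profile \<open>r \<mapsto> sin((t-r)k)/k\<close> on \<open>[0,t]\<close> with respect to the
  kernel \<open>|r-v|\<^bsup>2H-2\<^esup>\<close>. The whole estimate rests on \<open>N(k)\<close> being of the order \<open>k\<^bsup>-1-2H\<^esup>\<close>: the upper
  bound (\<open>wave_energy_upper\<close>) holds for all \<open>k > 0\<close>, the lower one (\<open>wave_energy_lower\<close>) from
  \<open>k = 8/t\<close> on.

  Given this, the phase factor is at most \<open>min(4, |\<xi>|\<^sup>2|z|\<^sup>2)\<close>, and integrating over the two regions
  \<open>|\<xi>| \<le> 1/|z|\<close> and \<open>|\<xi>| \<ge> 1/|z|\<close> yields \<open>|z|\<^bsup>2H+1-\<beta>\<^esup>\<close> each time: the first integral converges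
  because of \<open>\<beta> > 2H-1\<close>, the second because of \<open>\<beta> < 2H+1\<close> (\<open>increment_integral_upper\<close>). For the
  lower bound it suffices to integrate over one ball of radius \<open>1/(2|z|)\<close> whose centre is parallel
  to \<open>z\<close> and chosen such that \<open>\<xi>\<bullet>z\<close> stays within \<open>1/2\<close> of a large odd multiple of \<open>\<pi>\<close>
  (\<open>increment_integral_lower\<close>); the bound \<open>M\<close> on the coordinates keeps such frequencies above \<open>8/t\<close>.

  The order of \<open>N(k)\<close> comes from writing the kernel \<open>|r-v|\<^bsup>2H-2\<^esup>\<close> as a superposition of products
  \<open>a(r) a(v)\<close> of one-sided exponentials \<open>a(r) = e\<^bsup>-l(r-w)\<^esup>\<close>, \<open>r > w\<close> (\<open>time_atom_integral\<close>). Energies become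
  integrals of squares (\<open>time_energy_representation\<close>), which shows at once that the form is positive
  and reduces \<open>N(k)\<close> to the response of exponentials to a sine, an elementary function. The rates
  \<open>l\<close> of the order \<open>k\<close> carry the energy.

  For the isometry, the form is a seminorm, so that both sides pass to the limit along the
  approximating step functions (\<open>wiener_integral_diff_isometry\<close>). On step functions the claim is the
  identity \<open>\<integral>\<^sub>A\<integral>\<^sub>B f(p-q) dq dp = \<integral> \<F>1\<^sub>A cnj(\<F>1\<^sub>B) d\<mu>\<close> for bounded Borel sets (\<open>covariance_spectral\<close>),
  together with the double integral of \<open>|r-v|\<^bsup>2H-2\<^esup>\<close> over a rectangle. As \<open>f\<close> is only known through
  its action on Schwartz functions, it is tested against Gaussians centred at \<open>p-q\<close>; integrating over
  \<open>(p,q)\<close> in \<open>A \<times> B\<close> gives a damped version of the identity, and the Gaussians are then shrunk to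
  points.
\<close>

section \<open>The time kernel as a superposition of exponentials\<close>

text \<open>The exponential \<open>e\<^bsup>-l(r-w)\<^esup>\<close>, started at time \<open>w\<close>, for \<open>p = (l, w)\<close>. The weight \<open>l\<^bsup>1-H\<^esup>\<close> is the one for
  which the superposition over \<open>l\<close> is homogeneous of degree \<open>2H-2\<close> in \<open>r-v\<close>.\<close>

definition time_atom :: "real \<Rightarrow> real \<times> real \<Rightarrow> real \<Rightarrow> real" where
  "time_atom H p r =
     (if 0 < fst p \<and> snd p < r then fst p powr (1 - H) * exp (- (fst p * (r - snd p))) else 0)"

lemma time_atom_nonneg [simp]: "0 \<le> time_atom H p r"
  by (simp add: time_atom_def)

lemma time_atom_measurable [measurable]:
  "(\<lambda>x. time_atom H (fst x) (snd x)) \<in> borel_measurable (borel \<Otimes>\<^sub>M borel)"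
  unfolding time_atom_def borel_prod[symmetric] by measurable

lemma time_atom_measurable2 [measurable (raw)]:
  assumes "f \<in> M \<rightarrow>\<^sub>M borel" "g \<in> borel_measurable M"
  shows "(\<lambda>x. time_atom H (f x) (g x)) \<in> borel_measurable M"
proof -
  have "(\<lambda>x. time_atom H (fst (f x, g x)) (snd (f x, g x))) \<in> borel_measurable M"
    by (rule measurable_compose[OF _ time_atom_measurable]) (use assms in measurable)
  thus ?thesis by simp
qed

lemma borel_measurable_cnj [measurable]: "cnj \<in> borel_measurable borel"
  by (intro borel_measurable_continuous_onI continuous_intros)

text \<open>Integrating \<open>e\<^bsup>-l(r-w)\<^esup> e\<^bsup>-l(v-w)\<^esup>\<close> over \<open>w < min r v\<close> leaves \<open>e\<^bsup>-l|r-v|\<^esup>/(2l)\<close>, and the remaining integral over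
  \<open>l\<close> is a Gamma integral scaled by \<open>|r-v|\<close>. On the diagonal the left-hand side is infinite, while
  the power is \<open>0\<close> there by convention.\<close>

lemma time_atom_integral:
  fixes r v H :: real
  assumes H: "1/2 < H" "H < 1" and rv: "r \<noteq> v"
  shows "(\<integral>\<^sup>+p. ennreal (time_atom H p r) * ennreal (time_atom H p v) \<partial>lborel) =
           ennreal (Gamma (2 - 2 * H) / 2 * \<bar>r - v\<bar> powr (2 * H - 2))"
proof -
  define m where "m = min r v"
  define \<delta> where "\<delta> = \<bar>r - v\<bar>"
  have d: "\<delta> > 0" using rv by (simp add: \<delta>_def)
  have sum: "r + v = \<delta> + 2 * m" by (auto simp: \<delta>_def m_def)
  have inner: "(\<integral>\<^sup>+w. ennreal (time_atom H (l, w) r) * ennreal (time_atom H (l, w) v) \<partial>lborel)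
      = indicator {0<..} l * ennreal (l powr (1 - 2 * H) / 2 * exp (- (l * \<delta>)))" for l
  proof (cases "l > 0")
    case False
    then show ?thesis by (simp add: time_atom_def)
  next
    case l: True
    have "(\<integral>\<^sup>+w. ennreal (time_atom H (l, w) r) * ennreal (time_atom H (l, w) v) \<partial>lborel)
       = (\<integral>\<^sup>+w. ennreal (indicator {..<m} w * l powr (2 - 2 * H) * exp (- (l * (\<delta> + 2 * (m - w))))) \<partial>lborel)"
    proof (intro nn_integral_cong)
      fix w
      have "l powr (1 - H) * l powr (1 - H) = l powr (2 - 2 * H)"
        by (simp add: powr_add[symmetric])
      moreover have "exp (- (l * (r - w))) * exp (- (l * (v - w))) = exp (- (l * (\<delta> + 2 * (m - w))))"
      proof -
        have "(r - w) + (v - w) = \<delta> + 2 * (m - w)" using sum by simp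
        then have "l * (r - w) + l * (v - w) = l * (\<delta> + 2 * (m - w))" by (metis distrib_left)
        then have "- (l * (r - w)) + - (l * (v - w)) = - (l * (\<delta> + 2 * (m - w)))" by simp
        then show ?thesis by (simp only: exp_add[symmetric])
      qed
      moreover have "w < r \<and> w < v \<longleftrightarrow> w < m" by (auto simp: m_def)
      ultimately show "ennreal (time_atom H (l, w) r) * ennreal (time_atom H (l, w) v)
        = ennreal (indicator {..<m} w * l powr (2 - 2 * H) * exp (- (l * (\<delta> + 2 * (m - w)))))"
        using l by (auto simp: time_atom_def indicator_def ennreal_mult[symmetric] algebra_simps)
    qed
    also have "\<dots> = (\<integral>\<^sup>+y. ennreal (indicator {..<m} (m + (-1) * y) * l powr (2 - 2 * H) *
                       exp (- (l * (\<delta> + 2 * (m - (m + (-1) * y)))))) \<partial>lborel)"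
      by (subst nn_integral_real_affine[where c="-1" and t=m]) auto
    also have "\<dots> = (\<integral>\<^sup>+y. ennreal (l powr (2 - 2 * H) * exp (- (l * (\<delta> + 2 * y)))) * indicator {0..} y \<partial>lborel)"
      by (rule nn_integral_cong_AE, rule AE_mp[OF AE_lborel_singleton[of 0]], rule AE_I2) (auto simp: indicator_def)
    also have "\<dots> = ennreal (0 - (- (l powr (2 - 2 * H) * exp (- (l * (\<delta> + 2 * 0))) / (2 * l))))"
    proof (rule nn_integral_FTC_atLeast)
      fix y :: real
      show "((\<lambda>y. - (l powr (2 - 2 * H) * exp (- (l * (\<delta> + 2 * y))) / (2 * l))) has_real_derivative
              l powr (2 - 2 * H) * exp (- (l * (\<delta> + 2 * y)))) (at y)"
        using l by (auto intro!: derivative_eq_intros simp: field_simps)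
      show "((\<lambda>y. - (l powr (2 - 2 * H) * exp (- (l * (\<delta> + 2 * y))) / (2 * l))) \<longlongrightarrow> 0) at_top"
        using l by real_asymp
    qed auto
    also have "l powr (2 - 2 * H) = l powr (1 - 2 * H) * l"
      using l powr_add[of l "1 - 2 * H" 1] by simp
    finally show ?thesis using l by simp
  qed
  have "(\<integral>\<^sup>+p. ennreal (time_atom H p r) * ennreal (time_atom H p v) \<partial>lborel) =
      (\<integral>\<^sup>+l. \<integral>\<^sup>+w. ennreal (time_atom H (l, w) r) * ennreal (time_atom H (l, w) v) \<partial>lborel \<partial>lborel)"
    unfolding lborel_prod[symmetric]
    by (rule lborel.nn_integral_fst[symmetric]) (simp only: lborel_prod, measurable)
  also have "\<dots> = (\<integral>\<^sup>+l. indicator {0<..} l * ennreal (l powr (1 - 2 * H) / 2 * exp (- (l * \<delta>))) \<partial>lborel)"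
    by (simp only: inner)
  also have "\<dots> = ennreal (1 / \<delta>) * (\<integral>\<^sup>+x. indicator {0<..} (0 + (1/\<delta>) * x) *
        ennreal ((0 + (1/\<delta>) * x) powr (1 - 2 * H) / 2 * exp (- ((0 + (1/\<delta>) * x) * \<delta>))) \<partial>lborel)"
    using d by (subst nn_integral_real_affine[where c="1/\<delta>" and t=0]) auto
  also have "\<dots> = ennreal (1 / \<delta>) * (\<integral>\<^sup>+x. ennreal (\<delta> powr (2 * H - 1) / 2) *
        ennreal (indicator {0..} x * x powr ((2 - 2 * H) - 1) / exp x) \<partial>lborel)"
  proof (rule arg_cong2[where f="(*)"], rule refl, rule nn_integral_cong)
    fix x :: real
    have pw: "(x / \<delta>) powr (1 - 2 * H) = \<delta> powr (2 * H - 1) * x powr (1 - 2 * H)" if "x > 0"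
    proof -
      have "\<delta> powr (2 * H - 1) = inverse (\<delta> powr (1 - 2 * H))"
        using powr_minus[of \<delta> "1 - 2 * H"] by simp
      then show ?thesis using d that by (subst powr_divide) (auto simp: field_simps)
    qed
    then show "indicator {0<..} (0 + (1/\<delta>) * x) *
        ennreal ((0 + (1/\<delta>) * x) powr (1 - 2 * H) / 2 * exp (- ((0 + (1/\<delta>) * x) * \<delta>)))
       = ennreal (\<delta> powr (2 * H - 1) / 2) * ennreal (indicator {0..} x * x powr ((2 - 2 * H) - 1) / exp x)"
      using d by (cases "x = 0") (auto simp: indicator_def ennreal_mult[symmetric] exp_minus field_simps zero_less_divide_iff)
  qed
  also have "\<dots> = ennreal (1 / \<delta>) * (ennreal (\<delta> powr (2 * H - 1) / 2) * ennreal (Gamma (2 - 2 * H)))"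
    using H by (subst nn_integral_cmult) (auto simp: Gamma_conv_nn_integral_real)
  also have "\<dots> = ennreal (Gamma (2 - 2 * H) / 2 * \<delta> powr (2 * H - 2))"
  proof -
    have "\<delta> powr (2 * H - 1) = \<delta> powr (2 * H - 2) * \<delta>"
      using d powr_add[of \<delta> "2 * H - 2" 1] by simp
    then show ?thesis
      using d H by (simp add: ennreal_mult[symmetric] Gamma_real_pos less_imp_le field_simps)
  qed
  finally show ?thesis by (simp add: \<delta>_def)
qed

lemma time_energy_nn_integral:
  fixes g :: "real \<Rightarrow> ennreal"
  assumes H: "1/2 < H" "H < 1" and [measurable]: "g \<in> borel_measurable borel"
  shows "(\<integral>\<^sup>+r. \<integral>\<^sup>+v. g r * g v * ennreal (\<bar>r - v\<bar> powr (2 * H - 2)) \<partial>lborel \<partial>lborel) =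
    ennreal (2 / Gamma (2 - 2 * H)) * (\<integral>\<^sup>+p. (\<integral>\<^sup>+r. g r * ennreal (time_atom H p r) \<partial>lborel)\<^sup>2 \<partial>lborel)"
proof -
  define C where "C = ennreal (2 / Gamma (2 - 2 * H))"
  have G: "Gamma (2 - 2 * H) > 0"
    using Gamma_real_pos[of "2 - 2 * H"] H by auto
  then have G0: "Gamma (2 - 2 * H) \<noteq> 0" by (rule less_imp_neq[symmetric])
  have "(\<integral>\<^sup>+r. \<integral>\<^sup>+v. g r * g v * ennreal (\<bar>r - v\<bar> powr (2 * H - 2)) \<partial>lborel \<partial>lborel) =
    (\<integral>\<^sup>+r. \<integral>\<^sup>+v. C * (\<integral>\<^sup>+p. g r * ennreal (time_atom H p r) * (g v * ennreal (time_atom H p v)) \<partial>lborel) \<partial>lborel \<partial>lborel)"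
  proof (rule nn_integral_cong, rule nn_integral_cong_AE, rule AE_mp[OF AE_lborel_singleton], rule AE_I2, rule impI)
    fix r v :: real assume "v \<noteq> r"
    then have eq: "ennreal (\<bar>r - v\<bar> powr (2 * H - 2)) =
        C * (\<integral>\<^sup>+p. ennreal (time_atom H p r) * ennreal (time_atom H p v) \<partial>lborel)"
      using H G G0 unfolding C_def
      by (subst time_atom_integral) (auto simp: ennreal_mult[symmetric] simp del: Gamma_eq_zero_iff)
    have "(\<integral>\<^sup>+p. g r * ennreal (time_atom H p r) * (g v * ennreal (time_atom H p v)) \<partial>lborel)
       = g r * g v * (\<integral>\<^sup>+p. ennreal (time_atom H p r) * ennreal (time_atom H p v) \<partial>lborel)"
      by (subst nn_integral_cmult[symmetric]) (auto simp: mult_ac)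
    then show "g r * g v * ennreal (\<bar>r - v\<bar> powr (2 * H - 2)) =
      C * (\<integral>\<^sup>+p. g r * ennreal (time_atom H p r) * (g v * ennreal (time_atom H p v)) \<partial>lborel)"
      by (simp only: eq) (simp add: mult_ac)
  qed
  also have "\<dots> = C * (\<integral>\<^sup>+r. \<integral>\<^sup>+v. \<integral>\<^sup>+p. g r * ennreal (time_atom H p r) * (g v * ennreal (time_atom H p v)) \<partial>lborel \<partial>lborel \<partial>lborel)"
    by (simp add: nn_integral_cmult)
  also have "(\<integral>\<^sup>+r. \<integral>\<^sup>+v. \<integral>\<^sup>+p. g r * ennreal (time_atom H p r) * (g v * ennreal (time_atom H p v)) \<partial>lborel \<partial>lborel \<partial>lborel)
    = (\<integral>\<^sup>+r. \<integral>\<^sup>+p. \<integral>\<^sup>+v. g r * ennreal (time_atom H p r) * (g v * ennreal (time_atom H p v)) \<partial>lborel \<partial>lborel \<partial>lborel)"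
    by (intro nn_integral_cong lborel_pair.Fubini') measurable
  also have "\<dots> = (\<integral>\<^sup>+p. \<integral>\<^sup>+r. \<integral>\<^sup>+v. g r * ennreal (time_atom H p r) * (g v * ennreal (time_atom H p v)) \<partial>lborel \<partial>lborel \<partial>lborel)"
    by (intro lborel_pair.Fubini') measurable
  also have "\<dots> = (\<integral>\<^sup>+p. (\<integral>\<^sup>+r. g r * ennreal (time_atom H p r) \<partial>lborel)\<^sup>2 \<partial>lborel)"
    by (simp add: nn_integral_cmult nn_integral_multc power2_eq_square)
  finally show ?thesis by (simp add: C_def)
qed


text \<open>The absolute convergence that admissibility in the Hilbert space requires at almost every
  frequency, isolated as a property of a function of time alone.\<close>

definition time_admissible :: "real \<Rightarrow> (real \<Rightarrow> complex) \<Rightarrow> bool" where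
  "time_admissible H \<phi> \<longleftrightarrow> \<phi> \<in> borel_measurable borel \<and>
     set_integrable (lborel \<Otimes>\<^sub>M lborel) ({0..} \<times> {0..})
       (\<lambda>(r, v). \<phi> r * cnj (\<phi> v) * complex_of_real (\<bar>r - v\<bar> powr (2 * H - 2)))"

definition time_energy :: "real \<Rightarrow> (real \<Rightarrow> complex) \<Rightarrow> complex" where
  "time_energy H \<phi> =
     (LINT r:{0..}|lborel. LINT v:{0..}|lborel.
        \<phi> r * cnj (\<phi> v) * complex_of_real (\<bar>r - v\<bar> powr (2 * H - 2)))"

text \<open>The coordinates of \<open>\<phi>\<close> in which the energy becomes a squared \<open>L\<^sup>2\<close> norm.\<close>

definition time_transform :: "real \<Rightarrow> (real \<Rightarrow> complex) \<Rightarrow> real \<times> real \<Rightarrow> complex" where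
  "time_transform H \<phi> p = (LINT r:{0..}|lborel. complex_of_real (time_atom H p r) * \<phi> r)"

text \<open>Absolute convergence of the double integral is an \<open>L\<^sup>2\<close> condition on the transform of the absolute
  value, hence stable under linear combinations although the double integral is quadratic.\<close>

lemma time_admissible_iff:
  assumes H: "1/2 < H" "H < 1" and [measurable]: "\<phi> \<in> borel_measurable borel"
  shows "time_admissible H \<phi> \<longleftrightarrow>
    (\<integral>\<^sup>+p. (\<integral>\<^sup>+r. ennreal (indicator {0..} r * norm (\<phi> r)) * ennreal (time_atom H p r) \<partial>lborel)\<^sup>2 \<partial>lborel) < \<infinity>"
proof -
  define g where "g r = ennreal (indicator {0..} r * norm (\<phi> r))" for r :: real
  have [measurable]: "g \<in> borel_measurable borel" unfolding g_def by measurable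
  have G: "Gamma (2 - 2 * H) > 0"
    using Gamma_real_pos[of "2 - 2 * H"] H by auto
  define C where "C = ennreal (2 / Gamma (2 - 2 * H))"
  have C: "C > 0" "C < \<infinity>" using G by (auto simp: C_def)
  let ?h = "\<lambda>x::real \<times> real. indicator ({0..} \<times> {0..}) x *\<^sub>R (case x of (r, v) \<Rightarrow> \<phi> r * cnj (\<phi> v) * complex_of_real (\<bar>r - v\<bar> powr (2 * H - 2)))"
  have [measurable]: "{0::real..} \<times> {0::real..} \<in> sets (lborel \<Otimes>\<^sub>M lborel)"
    by (intro pair_measureI) auto
  have [measurable]: "?h \<in> borel_measurable (lborel \<Otimes>\<^sub>M lborel)"
    unfolding split_beta by measurable
  have "time_admissible H \<phi> \<longleftrightarrow> integrable (lborel \<Otimes>\<^sub>M lborel) ?h"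
    by (simp add: time_admissible_def set_integrable_def)
  also have "\<dots> \<longleftrightarrow> (\<integral>\<^sup>+x. ennreal (norm (?h x)) \<partial>(lborel \<Otimes>\<^sub>M lborel)) < \<infinity>"
    by (simp add: integrable_iff_bounded)
  also have "(\<integral>\<^sup>+x. ennreal (norm (?h x)) \<partial>(lborel \<Otimes>\<^sub>M lborel)) =
      (\<integral>\<^sup>+r. \<integral>\<^sup>+v. ennreal (norm (?h (r, v))) \<partial>lborel \<partial>lborel)"
    by (rule lborel.nn_integral_fst[symmetric]) measurable
  also have "\<dots> = (\<integral>\<^sup>+r. \<integral>\<^sup>+v. g r * g v * ennreal (\<bar>r - v\<bar> powr (2 * H - 2)) \<partial>lborel \<partial>lborel)"
    by (intro nn_integral_cong) (auto simp: g_def norm_mult ennreal_mult[symmetric] indicator_def)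
  also have "\<dots> = C * (\<integral>\<^sup>+p. (\<integral>\<^sup>+r. g r * ennreal (time_atom H p r) \<partial>lborel)\<^sup>2 \<partial>lborel)"
    unfolding C_def by (rule time_energy_nn_integral) (use H in auto)
  finally show ?thesis using C unfolding g_def
    by (auto simp: ennreal_mult_less_top ennreal_mult_eq_top_iff less_top[symmetric])
qed

lemma ennreal_power2_add_le: "(x + y)\<^sup>2 \<le> 4 * (x\<^sup>2 + y\<^sup>2)" for x y :: ennreal
proof -
  have aux: "(x + y)\<^sup>2 \<le> 4 * (x\<^sup>2 + y\<^sup>2)" if "x \<le> y" for x y :: ennreal
  proof -
    have "(x + y)\<^sup>2 \<le> (2 * y)\<^sup>2"
      using that by (intro power_mono) (auto simp: mult_2 intro: add_mono)
    also have "\<dots> = 4 * y\<^sup>2" by (simp add: power_mult_distrib)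
    also have "\<dots> \<le> 4 * (x\<^sup>2 + y\<^sup>2)" by (intro mult_left_mono) auto
    finally show ?thesis .
  qed
  show ?thesis using aux[of x y] aux[of y x] by (cases "x \<le> y") (auto simp: add.commute)
qed

lemma time_admissible_lincomb:
  assumes H: "1/2 < H" "H < 1" and p: "time_admissible H \<phi>" and q: "time_admissible H \<psi>"
  shows "time_admissible H (\<lambda>r. a * \<phi> r + b * \<psi> r)"
proof -
  have [measurable]: "\<phi> \<in> borel_measurable borel" "\<psi> \<in> borel_measurable borel"
    using p q by (auto simp: time_admissible_def)
  let ?S = "\<lambda>\<phi> p. \<integral>\<^sup>+r. ennreal (indicator {0..} r * norm (\<phi> r :: complex)) * ennreal (time_atom H p r) \<partial>lborel"
  have fin: "(\<integral>\<^sup>+p. (?S \<phi> p)\<^sup>2 \<partial>lborel) < \<infinity>" "(\<integral>\<^sup>+p. (?S \<psi> p)\<^sup>2 \<partial>lborel) < \<infinity>"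
    using p q time_admissible_iff[OF H, of \<phi>] time_admissible_iff[OF H, of \<psi>] by auto
  let ?a = "ennreal (norm a)" and ?b = "ennreal (norm b)"
  have le: "(?S (\<lambda>r. a * \<phi> r + b * \<psi> r) p)\<^sup>2 \<le> 4 * (?a\<^sup>2 * (?S \<phi> p)\<^sup>2 + ?b\<^sup>2 * (?S \<psi> p)\<^sup>2)" for p
  proof -
    have "?S (\<lambda>r. a * \<phi> r + b * \<psi> r) p \<le>
      (\<integral>\<^sup>+r. ?a * (ennreal (indicator {0..} r * norm (\<phi> r)) * ennreal (time_atom H p r)) +
            ?b * (ennreal (indicator {0..} r * norm (\<psi> r)) * ennreal (time_atom H p r)) \<partial>lborel)"
    proof (rule nn_integral_mono)
      fix r
      have "indicator {0..} r * norm (a * \<phi> r + b * \<psi> r) * time_atom H p r \<le>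
        indicator {0..} r * (norm a * norm (\<phi> r) + norm b * norm (\<psi> r)) * time_atom H p r"
        by (intro mult_right_mono mult_left_mono) (auto intro: order_trans[OF norm_triangle_ineq] simp: norm_mult)
      then show "ennreal (indicator {0..} r * norm (a * \<phi> r + b * \<psi> r)) * ennreal (time_atom H p r) \<le>
        ?a * (ennreal (indicator {0..} r * norm (\<phi> r)) * ennreal (time_atom H p r)) +
        ?b * (ennreal (indicator {0..} r * norm (\<psi> r)) * ennreal (time_atom H p r))"
        by (simp add: ennreal_mult[symmetric] ennreal_plus[symmetric] algebra_simps del: ennreal_plus)
    qed
    also have "\<dots> = ?a * ?S \<phi> p + ?b * ?S \<psi> p"
      by (simp add: nn_integral_add nn_integral_cmult)
    finally have "(?S (\<lambda>r. a * \<phi> r + b * \<psi> r) p)\<^sup>2 \<le> (?a * ?S \<phi> p + ?b * ?S \<psi> p)\<^sup>2"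
      by (intro power_mono) auto
    also have "\<dots> \<le> 4 * ((?a * ?S \<phi> p)\<^sup>2 + (?b * ?S \<psi> p)\<^sup>2)" by (rule ennreal_power2_add_le)
    finally show ?thesis by (simp add: power_mult_distrib)
  qed
  have "(\<integral>\<^sup>+p. (?S (\<lambda>r. a * \<phi> r + b * \<psi> r) p)\<^sup>2 \<partial>lborel) \<le>
     (\<integral>\<^sup>+p. 4 * (?a\<^sup>2 * (?S \<phi> p)\<^sup>2 + ?b\<^sup>2 * (?S \<psi> p)\<^sup>2) \<partial>lborel)"
    by (intro nn_integral_mono le)
  also have "\<dots> = 4 * (?a\<^sup>2 * (\<integral>\<^sup>+p. (?S \<phi> p)\<^sup>2 \<partial>lborel) + ?b\<^sup>2 * (\<integral>\<^sup>+p. (?S \<psi> p)\<^sup>2 \<partial>lborel))"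
    by (simp add: nn_integral_add nn_integral_cmult)
  also have "\<dots> < \<infinity>"
    using fin by (auto simp: ennreal_mult_less_top power_less_top_ennreal)
  finally show ?thesis using time_admissible_iff[OF H, of "\<lambda>r. a * \<phi> r + b * \<psi> r"] by simp
qed

lemma time_energy_eq_product_integral:
  assumes "time_admissible H \<phi>"
  shows "time_energy H \<phi> = (LINT x|(lborel \<Otimes>\<^sub>M lborel). indicator ({0..} \<times> {0..}) x *\<^sub>R
     (case x of (r, v) \<Rightarrow> \<phi> r * cnj (\<phi> v) * complex_of_real (\<bar>r - v\<bar> powr (2 * H - 2))))"
    (is "_ = (LINT x|_. ?h x)")
proof -
  have "integrable (lborel \<Otimes>\<^sub>M lborel) ?h"
    using assms by (simp add: time_admissible_def set_integrable_def)
  then have "(LINT x|(lborel \<Otimes>\<^sub>M lborel). ?h x) = (LINT r|lborel. LINT v|lborel. ?h (r, v))"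
    by (rule lborel_pair.integral_fst'[symmetric])
  also have "\<dots> = time_energy H \<phi>"
    unfolding time_energy_def set_lebesgue_integral_def
    by (intro Bochner_Integration.integral_cong refl)
       (auto simp: indicator_def simp flip: integral_scaleR_right)
  finally show ?thesis by simp
qed

lemma time_energy_representation:
  assumes H: "1/2 < H" "H < 1" and adm: "time_admissible H \<phi>"
  shows "integrable lborel (\<lambda>p. (norm (time_transform H \<phi> p))\<^sup>2)" (is ?int)
    and "time_energy H \<phi> =
      complex_of_real (2 / Gamma (2 - 2 * H) * (LINT p|lborel. (norm (time_transform H \<phi> p))\<^sup>2))" (is ?eq)
proof -
  have [measurable]: "\<phi> \<in> borel_measurable borel"
    using adm by (auto simp: time_admissible_def)
  have G: "Gamma (2 - 2 * H) > 0"
    using Gamma_real_pos[of "2 - 2 * H"] H by auto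
  then have G0: "Gamma (2 - 2 * H) \<noteq> 0" by (rule less_imp_neq[symmetric])
  define g where "g r = indicator {0..} r *\<^sub>R \<phi> r" for r :: real
  have [measurable]: "g \<in> borel_measurable borel" unfolding g_def by measurable
  define F where "F x = complex_of_real (time_atom H (fst x) (fst (snd x)) * time_atom H (fst x) (snd (snd x)))
      * (g (fst (snd x)) * cnj (g (snd (snd x))))" for x :: "(real \<times> real) \<times> (real \<times> real)"
  have "F \<in> borel_measurable (borel \<Otimes>\<^sub>M (borel \<Otimes>\<^sub>M borel))"
    unfolding F_def by measurable
  then have [measurable]: "F \<in> borel_measurable borel"
    by (simp only: borel_prod)
  have Fm: "F \<in> borel_measurable (lborel \<Otimes>\<^sub>M lborel)"
    by (simp only: lborel_prod) simp
  have int: "integrable (lborel \<Otimes>\<^sub>M lborel) F"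
  proof (rule integrableI_bounded[OF Fm])
    have "(\<integral>\<^sup>+x. ennreal (norm (F x)) \<partial>(lborel \<Otimes>\<^sub>M lborel)) =
       (\<integral>\<^sup>+p. \<integral>\<^sup>+x. ennreal (norm (F (p, x))) \<partial>lborel \<partial>lborel)"
      by (rule lborel.nn_integral_fst[symmetric]) (use Fm in measurable)
    also have "\<dots> = (\<integral>\<^sup>+p. \<integral>\<^sup>+r. \<integral>\<^sup>+v. ennreal (norm (F (p, (r, v)))) \<partial>lborel \<partial>lborel \<partial>lborel)"
      unfolding lborel_prod[symmetric, where 'a=real and 'b=real]
      by (intro nn_integral_cong lborel.nn_integral_fst[symmetric]) (simp add: F_def, measurable)
    also have "\<dots> = (\<integral>\<^sup>+p. \<integral>\<^sup>+r. \<integral>\<^sup>+v. (ennreal (norm (g r)) * ennreal (time_atom H p r)) *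
         (ennreal (norm (g v)) * ennreal (time_atom H p v)) \<partial>lborel \<partial>lborel \<partial>lborel)"
      by (intro nn_integral_cong) (simp add: F_def norm_mult ennreal_mult[symmetric] mult_ac)
    also have "\<dots> = (\<integral>\<^sup>+p. (\<integral>\<^sup>+r. ennreal (norm (g r)) * ennreal (time_atom H p r) \<partial>lborel)\<^sup>2 \<partial>lborel)"
      by (simp add: nn_integral_cmult nn_integral_multc power2_eq_square)
    also have "\<dots> < \<infinity>"
      using adm time_admissible_iff[OF H, of \<phi>] by (simp add: g_def)
    finally show "(\<integral>\<^sup>+x. ennreal (norm (F x)) \<partial>(lborel \<Otimes>\<^sub>M lborel)) < \<infinity>" .
  qed
  have T: "time_transform H \<phi> p = (LINT r|lborel. complex_of_real (time_atom H p r) * g r)" for p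
    unfolding time_transform_def set_lebesgue_integral_def g_def by simp
  have slice: "(LINT x|lborel. F (p, x)) = complex_of_real ((norm (time_transform H \<phi> p))\<^sup>2)"
    if "integrable lborel (\<lambda>x. F (p, x))" for p
  proof -
    have "(LINT x|lborel. F (p, x)) = (LINT r|lborel. LINT v|lborel. F (p, (r, v)))"
      using that unfolding lborel_prod[symmetric, where 'a=real and 'b=real]
      by (rule lborel_pair.integral_fst'[symmetric])
    also have "\<dots> = (LINT r|lborel. LINT v|lborel. (complex_of_real (time_atom H p r) * g r) *
         cnj (complex_of_real (time_atom H p v) * g v))"
      by (intro Bochner_Integration.integral_cong refl) (simp add: F_def mult_ac)
    \<comment> \<open>Scalars can be pulled out of a Bochner integral even if the integrand is not integrable.\<close>
    also have "\<dots> = time_transform H \<phi> p * cnj (time_transform H \<phi> p)"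
      by (simp only: T integral_mult_right_zero integral_mult_left_zero Bochner_Integration.integral_cnj)
    finally show ?thesis by (simp only: complex_norm_square)
  qed
  have AEs: "AE p in lborel. integrable lborel (\<lambda>x. F (p, x))"
    by (rule lborel_pair.AE_integrable_fst') (rule int)
  have [measurable]: "(\<lambda>p. time_transform H \<phi> p) \<in> borel_measurable lborel"
    unfolding T by measurable
  have "integrable lborel (\<lambda>p. LINT x|lborel. F (p, x))"
    by (rule lborel_pair.integrable_fst') (rule int)
  then have "integrable lborel (\<lambda>p. complex_of_real ((norm (time_transform H \<phi> p))\<^sup>2))"
    by (rule integrable_cong_AE_imp) (use AEs slice in \<open>auto elim: eventually_mono\<close>)
  then show ?int by (simp only: complex_of_real_integrable_eq)
  have pair: "(LINT p|lborel. F (p, x)) = complex_of_real (Gamma (2 - 2 * H) / 2) *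
      (indicator ({0..} \<times> {0..}) x *\<^sub>R
     (case x of (r, v) \<Rightarrow> \<phi> r * cnj (\<phi> v) * complex_of_real (\<bar>r - v\<bar> powr (2 * H - 2))))"
    if "fst x \<noteq> snd x" for x
  proof -
    have "(LINT p|lborel. F (p, x)) = complex_of_real (LINT p|lborel. time_atom H p (fst x) * time_atom H p (snd x))
        * (g (fst x) * cnj (g (snd x)))"
      unfolding F_def fst_conv snd_conv by (simp only: integral_mult_left_zero integral_complex_of_real)
    also have "(LINT p|lborel. time_atom H p (fst x) * time_atom H p (snd x)) =
       Gamma (2 - 2 * H) / 2 * \<bar>fst x - snd x\<bar> powr (2 * H - 2)"
      using time_atom_integral[OF H that] G
      by (subst integral_eq_nn_integral) (auto simp: ennreal_mult)
    finally show ?thesis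
      by (cases x) (auto simp: g_def indicator_def)
  qed
  \<comment> \<open>the representation of the kernel fails on the diagonal, a null set\<close>
  have "AE x in lborel \<Otimes>\<^sub>M lborel. fst x \<noteq> (snd x :: real)"
  proof (rule lborel_pair.AE_pair_measure)
    show "{x \<in> space (lborel \<Otimes>\<^sub>M lborel). fst x \<noteq> (snd x :: real)} \<in> sets (lborel \<Otimes>\<^sub>M lborel)"
      by measurable
    show "AE x in lborel. AE y in lborel. fst (x, y) \<noteq> (snd (x, y) :: real)"
    proof (rule AE_I2)
      fix x :: real
      show "AE y in lborel. fst (x, y) \<noteq> snd (x, y)"
        using AE_lborel_singleton[of x] by eventually_elim auto
    qed
  qed
  then have AEd: "AE x in (lborel :: (real \<times> real) measure). fst x \<noteq> snd x" by (simp only: lborel_prod)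
  have "complex_of_real (LINT p|lborel. (norm (time_transform H \<phi> p))\<^sup>2) = (LINT p|lborel. LINT x|lborel. F (p, x))"
    unfolding integral_complex_of_real[symmetric]
    by (rule integral_cong_AE) (use AEs slice Fm in \<open>auto elim: eventually_mono\<close>)
  also have "\<dots> = (LINT x|lborel. LINT p|lborel. F (p, x))"
    using lborel_pair.Fubini_integral[of "\<lambda>p x. F (p, x)"] int by simp
  also have "\<dots> = complex_of_real (Gamma (2 - 2 * H) / 2) * time_energy H \<phi>"
    unfolding time_energy_eq_product_integral[OF adm] integral_mult_right_zero[symmetric] lborel_prod
  proof (rule integral_cong_AE)
    show "(\<lambda>x. LINT p|lborel. F (p, x)) \<in> borel_measurable lborel" using Fm by measurable
    have "set_integrable lborel ({0..} \<times> {0..})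
       (\<lambda>(r, v). \<phi> r * cnj (\<phi> v) * complex_of_real (\<bar>r - v\<bar> powr (2 * H - 2)))"
      using adm by (simp add: time_admissible_def lborel_prod)
    from borel_measurable_integrable[OF this[unfolded set_integrable_def]]
    show "(\<lambda>x. complex_of_real (Gamma (2 - 2 * H) / 2) * (indicator ({0..} \<times> {0..}) x *\<^sub>R
      (case x of (r, v) \<Rightarrow> \<phi> r * cnj (\<phi> v) * complex_of_real (\<bar>r - v\<bar> powr (2 * H - 2)))))
      \<in> borel_measurable lborel" by (rule borel_measurable_times[OF borel_measurable_const])
  qed (use AEd pair in \<open>auto elim!: eventually_mono simp del: scaleR_conv_of_real\<close>)
  finally show ?eq using G0 by (simp add: field_simps del: Gamma_eq_zero_iff)
qed

lemma time_energy_nonneg: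
  assumes "1/2 < H" "H < 1" "time_admissible H \<phi>"
  shows "0 \<le> Re (time_energy H \<phi>)"
  using assms Gamma_real_pos[of "2 - 2 * H"]
  by (simp add: time_energy_representation(2) zero_le_mult_iff del: Gamma_eq_zero_iff)

text \<open>With \<open>s\<^sup>2 = \<eta>\<close> the parallelogram-type identity
  \<open>E(\<phi>+\<psi>) + E(s\<phi> - \<psi>/s) = (1+\<eta>) E(\<phi>) + (1+1/\<eta>) E(\<psi>)\<close> has no mixed terms, and the second summand
  on its left is nonnegative. In this form the inequality can be integrated over the frequencies;
  optimizing over \<open>\<eta>\<close> afterwards gives the triangle inequality.\<close>

lemma time_energy_add_le:
  assumes H: "1/2 < H" "H < 1" and p: "time_admissible H \<phi>" and q: "time_admissible H \<psi>" and e: "0 < \<eta>"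
  shows "Re (time_energy H (\<lambda>r. \<phi> r + \<psi> r)) \<le> (1 + \<eta>) * Re (time_energy H \<phi>) + (1 + 1 / \<eta>) * Re (time_energy H \<psi>)"
proof -
  define s where "s = sqrt \<eta>"
  have s: "s > 0" "s * s = \<eta>" using e by (auto simp: s_def)
  define \<rho> where "\<rho> r = complex_of_real s * \<phi> r + complex_of_real (- 1 / s) * \<psi> r" for r
  define \<sigma> where "\<sigma> r = \<phi> r + \<psi> r" for r
  have a: "time_admissible H \<sigma>" unfolding \<sigma>_def
    using time_admissible_lincomb[OF H p q, of 1 1] by simp
  have b: "time_admissible H \<rho>" unfolding \<rho>_def
    by (rule time_admissible_lincomb[OF H p q])
  let ?h = "\<lambda>\<phi> (x :: real \<times> real). indicator ({0..} \<times> {0..}) x *\<^sub>R (case x of (r, v) \<Rightarrow> \<phi> r * cnj (\<phi> v) * complex_of_real (\<bar>r - v\<bar> powr (2 * H - 2)))"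
  have i: "integrable (lborel \<Otimes>\<^sub>M lborel) (?h \<phi>)" if "time_admissible H \<phi>" for \<phi>
    using that by (simp add: time_admissible_def set_integrable_def)
  have pt: "?h \<sigma> x + ?h \<rho> x = complex_of_real (1 + \<eta>) * ?h \<phi> x + complex_of_real (1 + 1 / \<eta>) * ?h \<psi> x" for x
  proof -
    obtain r v where x: "x = (r, v)" by (cases x)
    have c: "complex_of_real s * complex_of_real s = complex_of_real \<eta>" using s by (metis of_real_mult)
    have c0: "complex_of_real s \<noteq> 0" using s by simp
    have "\<sigma> r * cnj (\<sigma> v) + \<rho> r * cnj (\<rho> v) =
      complex_of_real (1 + \<eta>) * (\<phi> r * cnj (\<phi> v)) + complex_of_real (1 + 1 / \<eta>) * (\<psi> r * cnj (\<psi> v))"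
      unfolding \<sigma>_def \<rho>_def s(2)[symmetric] using c0 by (simp add: field_simps)
    then have "(\<sigma> r * cnj (\<sigma> v) + \<rho> r * cnj (\<rho> v)) * complex_of_real (\<bar>r - v\<bar> powr (2 * H - 2)) =
      (complex_of_real (1 + \<eta>) * (\<phi> r * cnj (\<phi> v)) + complex_of_real (1 + 1 / \<eta>) * (\<psi> r * cnj (\<psi> v)))
        * complex_of_real (\<bar>r - v\<bar> powr (2 * H - 2))"
      by (rule arg_cong)
    then show ?thesis by (simp add: x indicator_def ring_distribs mult.assoc)
  qed
  have "time_energy H \<sigma> + time_energy H \<rho> =
     complex_of_real (1 + \<eta>) * time_energy H \<phi> + complex_of_real (1 + 1 / \<eta>) * time_energy H \<psi>"
    unfolding time_energy_eq_product_integral[OF a] time_energy_eq_product_integral[OF b]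
      time_energy_eq_product_integral[OF p] time_energy_eq_product_integral[OF q]
      Bochner_Integration.integral_add[OF i[OF a] i[OF b], symmetric] pt
    by (subst Bochner_Integration.integral_add[OF integrable_mult_right[OF i[OF p]] integrable_mult_right[OF i[OF q]]])
       (simp only: integral_mult_right_zero)
  then have "Re (time_energy H \<sigma>) + Re (time_energy H \<rho>) =
      (1 + \<eta>) * Re (time_energy H \<phi>) + (1 + 1 / \<eta>) * Re (time_energy H \<psi>)"
    by (simp add: complex_eq_iff)
  with time_energy_nonneg[OF H b] show ?thesis unfolding \<sigma>_def by simp
qed

section \<open>The Hilbert seminorm and the isometry in the limit\<close>

lemma hp_time_form_diag: "hp_time_form H \<Phi> \<Phi> = (\<lambda>\<xi>. time_energy H (\<lambda>r. \<Phi> r \<xi>))"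
  by (simp add: fun_eq_iff hp_time_form_def time_energy_def)

lemma measurable_time_slice:
  fixes \<Phi> :: "real \<Rightarrow> 'a::euclidean_space \<Rightarrow> complex"
  assumes "case_prod \<Phi> \<in> borel_measurable (borel \<Otimes>\<^sub>M borel)"
  shows "(\<lambda>r. \<Phi> r \<xi>) \<in> borel_measurable borel"
  using measurable_compose[OF _ assms, of "\<lambda>r. (r, \<xi>)" borel] by simp

lemma hp_admissible_iff:
  "hp_admissible H \<beta> \<Phi> \<longleftrightarrow> case_prod \<Phi> \<in> borel_measurable (borel \<Otimes>\<^sub>M borel) \<and>
     (AE \<xi> in riesz_measure \<beta>. time_admissible H (\<lambda>r. \<Phi> r \<xi>)) \<and>
     integrable (riesz_measure \<beta>) (\<lambda>\<xi>. time_energy H (\<lambda>r. \<Phi> r \<xi>))"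
  unfolding hp_admissible_def hp_time_form_diag time_admissible_def
  using measurable_time_slice[of \<Phi>] by auto

lemma sets_riesz_measure [measurable_cong, simp]: "sets (riesz_measure \<beta>) = sets borel"
  by (simp add: riesz_measure_def)

lemma space_riesz_measure [simp]: "space (riesz_measure \<beta>) = UNIV"
  by (simp add: riesz_measure_def)

lemma time_energy_real:
  assumes "1/2 < H" "H < 1" "time_admissible H \<phi>"
  shows "time_energy H \<phi> = complex_of_real (Re (time_energy H \<phi>))"
  by (subst (1 2) time_energy_representation(2)[OF assms]) simp

lemma Re_hp_inner_diag:
  assumes H: "1/2 < H" "H < 1" and adm: "hp_admissible H \<beta> \<Phi>"
  shows "Re (hp_inner H \<beta> \<Phi> \<Phi>) = H * (2 * H - 1) * (LINT \<xi>|riesz_measure \<beta>. Re (time_energy H (\<lambda>r. \<Phi> r \<xi>)))"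
    and "0 \<le> Re (hp_inner H \<beta> \<Phi> \<Phi>)"
proof -
  have "0 \<le> (LINT \<xi>|riesz_measure \<beta>. Re (time_energy H (\<lambda>r. \<Phi> r \<xi>)))"
    using adm time_energy_nonneg[OF H]
    by (intro integral_nonneg_AE) (auto simp: hp_admissible_iff)
  moreover show "Re (hp_inner H \<beta> \<Phi> \<Phi>) = H * (2 * H - 1) * (LINT \<xi>|riesz_measure \<beta>. Re (time_energy H (\<lambda>r. \<Phi> r \<xi>)))"
    using adm by (simp add: hp_inner_def hp_time_form_diag hp_admissible_iff integral_Re)
  ultimately show "0 \<le> Re (hp_inner H \<beta> \<Phi> \<Phi>)" using H by simp
qed

lemma hp_norm_sq:
  assumes "1/2 < H" "H < 1" "hp_admissible H \<beta> \<Phi>"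
  shows "(hp_norm H \<beta> \<Phi>)\<^sup>2 = H * (2 * H - 1) * (LINT \<xi>|riesz_measure \<beta>. Re (time_energy H (\<lambda>r. \<Phi> r \<xi>)))"
  using Re_hp_inner_diag[OF assms] by (simp add: hp_norm_def)

lemma hp_norm_nonneg:
  assumes "1/2 < H" "H < 1" "hp_admissible H \<beta> \<Phi>"
  shows "0 \<le> hp_norm H \<beta> \<Phi>"
  using Re_hp_inner_diag(2)[OF assms] by (simp add: hp_norm_def)

lemma borel_measurable_time_energy:
  fixes \<Phi> :: "real \<Rightarrow> 'a::euclidean_space \<Rightarrow> complex"
  assumes [measurable]: "case_prod \<Phi> \<in> borel_measurable (borel \<Otimes>\<^sub>M borel)"
  shows "(\<lambda>\<xi>. time_energy H (\<lambda>r. \<Phi> r \<xi>)) \<in> borel_measurable borel"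
  unfolding time_energy_def set_lebesgue_integral_def by measurable

lemma hp_admissible_add:
  fixes \<Phi> \<Psi> :: "real \<Rightarrow> 'a::euclidean_space \<Rightarrow> complex"
  assumes H: "1/2 < H" "H < 1" and p: "hp_admissible H \<beta> \<Phi>" and q: "hp_admissible H \<beta> \<Psi>"
  shows "hp_admissible H \<beta> (\<lambda>r \<xi>. \<Phi> r \<xi> + \<Psi> r \<xi>)"
proof -
  have [measurable]: "case_prod \<Phi> \<in> borel_measurable (borel \<Otimes>\<^sub>M borel)" "case_prod \<Psi> \<in> borel_measurable (borel \<Otimes>\<^sub>M borel)"
    using p q by (auto simp: hp_admissible_iff)
  have m: "case_prod (\<lambda>r \<xi>. \<Phi> r \<xi> + \<Psi> r \<xi>) \<in> borel_measurable (borel \<Otimes>\<^sub>M borel)"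
    by measurable
  have a: "AE \<xi> in riesz_measure \<beta>. time_admissible H (\<lambda>r. \<Phi> r \<xi>)" "AE \<xi> in riesz_measure \<beta>. time_admissible H (\<lambda>r. \<Psi> r \<xi>)"
    using p q by (auto simp: hp_admissible_iff)
  have i: "integrable (riesz_measure \<beta>) (\<lambda>\<xi>. time_energy H (\<lambda>r. \<Phi> r \<xi>))" "integrable (riesz_measure \<beta>) (\<lambda>\<xi>. time_energy H (\<lambda>r. \<Psi> r \<xi>))"
    using p q by (auto simp: hp_admissible_iff)
  have "AE \<xi> in riesz_measure \<beta>. time_admissible H (\<lambda>r. \<Phi> r \<xi> + \<Psi> r \<xi>)"
    using a by eventually_elim (use time_admissible_lincomb[OF H, of _ _ 1 1] in auto)
  moreover have "integrable (riesz_measure \<beta>) (\<lambda>\<xi>. time_energy H (\<lambda>r. \<Phi> r \<xi> + \<Psi> r \<xi>))"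
  proof (rule Bochner_Integration.integrable_bound)
    show "integrable (riesz_measure \<beta>) (\<lambda>\<xi>. 2 * norm (time_energy H (\<lambda>r. \<Phi> r \<xi>)) + 2 * norm (time_energy H (\<lambda>r. \<Psi> r \<xi>)))"
      using i by auto
    show "AE \<xi> in riesz_measure \<beta>. norm (time_energy H (\<lambda>r. \<Phi> r \<xi> + \<Psi> r \<xi>)) \<le>
        norm (2 * norm (time_energy H (\<lambda>r. \<Phi> r \<xi>)) + 2 * norm (time_energy H (\<lambda>r. \<Psi> r \<xi>)))"
      using a
    proof eventually_elim
      case (elim \<xi>)
      let ?p = "\<lambda>r. \<Phi> r \<xi>" and ?q = "\<lambda>r. \<Psi> r \<xi>"
      have s: "time_admissible H (\<lambda>r. ?p r + ?q r)"
        using time_admissible_lincomb[OF H elim, of 1 1] by simp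
      have "norm (time_energy H (\<lambda>r. ?p r + ?q r)) = Re (time_energy H (\<lambda>r. ?p r + ?q r))"
        by (subst time_energy_real[OF H s]) (use time_energy_nonneg[OF H s] in \<open>simp add: norm_of_real\<close>)
      also have "\<dots> \<le> 2 * Re (time_energy H ?p) + 2 * Re (time_energy H ?q)"
        using time_energy_add_le[OF H elim, of 1] by simp
      also have "\<dots> \<le> 2 * norm (time_energy H ?p) + 2 * norm (time_energy H ?q)"
        using complex_Re_le_cmod[of "time_energy H ?p"] complex_Re_le_cmod[of "time_energy H ?q"] by linarith
      finally show ?case by simp
    qed
    show "(\<lambda>\<xi>. time_energy H (\<lambda>r. \<Phi> r \<xi> + \<Psi> r \<xi>)) \<in> borel_measurable (riesz_measure \<beta>)"
      using borel_measurable_time_energy[OF m, of H] by simp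
  qed
  ultimately show ?thesis using m by (simp add: hp_admissible_iff)
qed

lemma hp_admissible_uminus:
  "hp_admissible H \<beta> (\<lambda>r \<xi>. - \<Phi> r \<xi>) \<longleftrightarrow> hp_admissible H \<beta> \<Phi>"
proof -
  have "case_prod (\<lambda>r \<xi>. - \<Phi> r \<xi>) \<in> borel_measurable (borel \<Otimes>\<^sub>M borel)
     \<longleftrightarrow> case_prod \<Phi> \<in> borel_measurable (borel \<Otimes>\<^sub>M borel)"
    using borel_measurable_uminus_eq[of "case_prod \<Phi>"] by (simp add: split_beta')
  moreover have "hp_time_form H (\<lambda>r \<xi>. - \<Phi> r \<xi>) (\<lambda>r \<xi>. - \<Phi> r \<xi>) = hp_time_form H \<Phi> \<Phi>"
    by (simp add: fun_eq_iff hp_time_form_def)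
  ultimately show ?thesis by (simp add: hp_admissible_def)
qed

lemma hp_norm_uminus: "hp_norm H \<beta> (\<lambda>r \<xi>. - \<Phi> r \<xi>) = hp_norm H \<beta> \<Phi>"
  by (simp add: hp_norm_def hp_inner_def hp_time_form_def)

text \<open>The optimal weight is \<open>\<eta> = sqrt b / sqrt a\<close>; adding a small \<open>\<delta>\<close> to \<open>a\<close> and \<open>b\<close> avoids the cases in
  which one of them vanishes.\<close>

lemma sqrt_triangle_of_weighted:
  fixes a b c :: real
  assumes a: "0 \<le> a" and b: "0 \<le> b" and le: "\<And>\<eta>. 0 < \<eta> \<Longrightarrow> c \<le> (1 + \<eta>) * a + (1 + 1 / \<eta>) * b"
  shows "sqrt c \<le> sqrt a + sqrt b"
proof -
  have "c \<le> (sqrt (a + \<delta>) + sqrt (b + \<delta>))\<^sup>2" if d: "0 < \<delta>" for \<delta>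
  proof -
    define x y where "x = sqrt (a + \<delta>)" and "y = sqrt (b + \<delta>)"
    have xy: "x > 0" "y > 0" "x\<^sup>2 = a + \<delta>" "y\<^sup>2 = b + \<delta>" using a b d by (auto simp: x_def y_def)
    \<comment> \<open>the weight that minimizes \<open>(1+\<eta>) x\<^sup>2 + (1+1/\<eta>) y\<^sup>2\<close>\<close>
    have "c \<le> (1 + y / x) * a + (1 + 1 / (y / x)) * b" using xy by (intro le) auto
    also have "\<dots> \<le> (1 + y / x) * x\<^sup>2 + (1 + 1 / (y / x)) * y\<^sup>2"
      using xy d by (intro add_mono mult_left_mono) auto
    also have "\<dots> = (x + y)\<^sup>2" using xy(1,2) by (simp add: field_simps power2_eq_square)
    finally show ?thesis by (simp add: x_def y_def)
  qed
  then have "\<forall>\<^sub>F \<delta> in at_right 0. c \<le> (sqrt (a + \<delta>) + sqrt (b + \<delta>))\<^sup>2"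
    by (auto simp: eventually_at_right_less intro: eventually_mono[OF eventually_at_right_less])
  moreover have "((\<lambda>\<delta>. (sqrt (a + \<delta>) + sqrt (b + \<delta>))\<^sup>2) \<longlongrightarrow> (sqrt (a + 0) + sqrt (b + 0))\<^sup>2) (at_right 0)"
    by (intro tendsto_intros)
  ultimately have "c \<le> (sqrt a + sqrt b)\<^sup>2"
    using tendsto_lowerbound[of _ _ "at_right (0::real)" c] by (simp add: trivial_limit_at_right_real)
  then show ?thesis using a b by (intro real_le_lsqrt) auto
qed

lemma hp_norm_triangle:
  fixes \<Phi> \<Psi> :: "real \<Rightarrow> 'a::euclidean_space \<Rightarrow> complex"
  assumes H: "1/2 < H" "H < 1" and p: "hp_admissible H \<beta> \<Phi>" and q: "hp_admissible H \<beta> \<Psi>"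
  shows "hp_norm H \<beta> (\<lambda>r \<xi>. \<Phi> r \<xi> + \<Psi> r \<xi>) \<le> hp_norm H \<beta> \<Phi> + hp_norm H \<beta> \<Psi>"
proof -
  note s = hp_admissible_add[OF H p q]
  have R: "integrable (riesz_measure \<beta>) (\<lambda>\<xi>. Re (time_energy H (\<lambda>r. \<Xi> r \<xi>)))" if "hp_admissible H \<beta> \<Xi>"
    for \<Xi> :: "real \<Rightarrow> 'a \<Rightarrow> complex"
    using that by (auto simp: hp_admissible_iff)
  have "sqrt ((hp_norm H \<beta> (\<lambda>r \<xi>. \<Phi> r \<xi> + \<Psi> r \<xi>))\<^sup>2) \<le> sqrt ((hp_norm H \<beta> \<Phi>)\<^sup>2) + sqrt ((hp_norm H \<beta> \<Psi>)\<^sup>2)"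
  proof (rule sqrt_triangle_of_weighted)
    fix \<eta> :: real assume e: "0 < \<eta>"
    have "(LINT \<xi>|riesz_measure \<beta>. Re (time_energy H (\<lambda>r. \<Phi> r \<xi> + \<Psi> r \<xi>))) \<le>
      (LINT \<xi>|riesz_measure \<beta>. (1 + \<eta>) * Re (time_energy H (\<lambda>r. \<Phi> r \<xi>)) + (1 + 1 / \<eta>) * Re (time_energy H (\<lambda>r. \<Psi> r \<xi>)))"
    proof (rule integral_mono_AE)
      show "AE \<xi> in riesz_measure \<beta>. Re (time_energy H (\<lambda>r. \<Phi> r \<xi> + \<Psi> r \<xi>)) \<le>
        (1 + \<eta>) * Re (time_energy H (\<lambda>r. \<Phi> r \<xi>)) + (1 + 1 / \<eta>) * Re (time_energy H (\<lambda>r. \<Psi> r \<xi>))"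
        using p q e unfolding hp_admissible_iff
        by (auto elim!: eventually_elim2 intro: time_energy_add_le[OF H])
    qed (use R[OF p] R[OF q] R[OF s] in auto)
    also have "\<dots> = (1 + \<eta>) * (LINT \<xi>|riesz_measure \<beta>. Re (time_energy H (\<lambda>r. \<Phi> r \<xi>))) +
       (1 + 1 / \<eta>) * (LINT \<xi>|riesz_measure \<beta>. Re (time_energy H (\<lambda>r. \<Psi> r \<xi>)))"
      using R[OF p] R[OF q] by simp
    finally have "H * (2 * H - 1) * (LINT \<xi>|riesz_measure \<beta>. Re (time_energy H (\<lambda>r. \<Phi> r \<xi> + \<Psi> r \<xi>))) \<le>
      H * (2 * H - 1) * \<dots>" using H by (intro mult_left_mono) auto
    then show "(hp_norm H \<beta> (\<lambda>r \<xi>. \<Phi> r \<xi> + \<Psi> r \<xi>))\<^sup>2 \<le> (1 + \<eta>) * (hp_norm H \<beta> \<Phi>)\<^sup>2 + (1 + 1 / \<eta>) * (hp_norm H \<beta> \<Psi>)\<^sup>2"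
      unfolding hp_norm_sq[OF H p] hp_norm_sq[OF H q] hp_norm_sq[OF H s]
      by (simp only: distrib_left mult.left_commute)
  qed auto
  then show ?thesis using hp_norm_nonneg[OF H p] hp_norm_nonneg[OF H q] hp_norm_nonneg[OF H s] by simp
qed

lemma rms_triangle:
  fixes X Y :: "'w \<Rightarrow> real"
  assumes [measurable]: "X \<in> borel_measurable P" "Y \<in> borel_measurable P"
    and X: "integrable P (\<lambda>\<omega>. (X \<omega>)\<^sup>2)" and Y: "integrable P (\<lambda>\<omega>. (Y \<omega>)\<^sup>2)"
  shows "integrable P (\<lambda>\<omega>. (X \<omega> + Y \<omega>)\<^sup>2)"
    and "sqrt (LINT \<omega>|P. (X \<omega> + Y \<omega>)\<^sup>2) \<le> sqrt (LINT \<omega>|P. (X \<omega>)\<^sup>2) + sqrt (LINT \<omega>|P. (Y \<omega>)\<^sup>2)"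
proof -
  have pt: "(x + y)\<^sup>2 \<le> (1 + \<eta>) * x\<^sup>2 + (1 + 1 / \<eta>) * y\<^sup>2" if "0 < \<eta>" for x y \<eta> :: real
  proof -
    have "0 \<le> (\<eta> * x - y)\<^sup>2 / \<eta>" using that by simp
    also have "\<dots> = (1 + \<eta>) * x\<^sup>2 + (1 + 1 / \<eta>) * y\<^sup>2 - (x + y)\<^sup>2"
      using that by (simp add: field_simps power2_eq_square)
    finally show ?thesis by simp
  qed
  show int: "integrable P (\<lambda>\<omega>. (X \<omega> + Y \<omega>)\<^sup>2)"
  proof (rule Bochner_Integration.integrable_bound)
    show "integrable P (\<lambda>\<omega>. 2 * (X \<omega>)\<^sup>2 + 2 * (Y \<omega>)\<^sup>2)" using X Y by auto
    show "AE \<omega> in P. norm ((X \<omega> + Y \<omega>)\<^sup>2) \<le> norm (2 * (X \<omega>)\<^sup>2 + 2 * (Y \<omega>)\<^sup>2)"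
      using pt[of 1] by auto
  qed measurable
  show "sqrt (LINT \<omega>|P. (X \<omega> + Y \<omega>)\<^sup>2) \<le> sqrt (LINT \<omega>|P. (X \<omega>)\<^sup>2) + sqrt (LINT \<omega>|P. (Y \<omega>)\<^sup>2)"
  proof (rule sqrt_triangle_of_weighted)
    fix \<eta> :: real assume e: "0 < \<eta>"
    have "(LINT \<omega>|P. (X \<omega> + Y \<omega>)\<^sup>2) \<le> (LINT \<omega>|P. (1 + \<eta>) * (X \<omega>)\<^sup>2 + (1 + 1 / \<eta>) * (Y \<omega>)\<^sup>2)"
      using int X Y pt[OF e] by (intro integral_mono) auto
    then show "(LINT \<omega>|P. (X \<omega> + Y \<omega>)\<^sup>2) \<le> (1 + \<eta>) * (LINT \<omega>|P. (X \<omega>)\<^sup>2) + (1 + 1 / \<eta>) * (LINT \<omega>|P. (Y \<omega>)\<^sup>2)"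
      using X Y by simp
  qed auto
qed

text \<open>The Fourier transform of \<open>1\<^sub>A\<close>, through which every step function is expressed.\<close>

definition indicator_fourier :: "'a::euclidean_space set \<Rightarrow> 'a \<Rightarrow> complex" where
  "indicator_fourier A = fourier (indicator A)"

lemma integrable_bounded_phase:
  fixes A :: "'a::euclidean_space set"
  assumes "A \<in> sets borel" "bounded A"
  shows "integrable lborel (\<lambda>x. exp (- \<i> * complex_of_real (\<xi> \<bullet> x)) * indicator A x)"
proof (rule Bochner_Integration.integrable_bound)
  have "emeasure lborel A < \<infinity>" using assms emeasure_bounded_finite by blast
  then show "integrable lborel (indicator A :: 'a \<Rightarrow> real)" using assms by simp
  show "(\<lambda>x. exp (- \<i> * complex_of_real (\<xi> \<bullet> x)) * indicator A x) \<in> borel_measurable lborel"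
    using assms by measurable
qed (auto simp: norm_mult indicator_def)

lemma step_fourier_eq:
  assumes "step_ok L"
  shows "step_fourier L r \<xi> =
     (\<Sum>(c, s, A)\<leftarrow>L. complex_of_real (c * indicator {0..s} r) * indicator_fourier A \<xi>)"
proof -
  have "integrable lborel (\<lambda>x. exp (- \<i> * complex_of_real (\<xi> \<bullet> x)) * complex_of_real (step_fun L r x)) \<and>
     (LINT x|lborel. exp (- \<i> * complex_of_real (\<xi> \<bullet> x)) * complex_of_real (step_fun L r x)) =
     (\<Sum>(c, s, A)\<leftarrow>L. complex_of_real (c * indicator {0..s} r) * indicator_fourier A \<xi>)"
    using assms
  proof (induction L)
    case Nil
    then show ?case by (simp add: step_fun_def)
  next
    case (Cons a L)
    obtain c s A where a: "a = (c, s, A)" by (cases a)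
    have A: "A \<in> sets borel" "bounded A" and L: "step_ok L"
      using Cons.prems by (auto simp: step_ok_def a noise_index_def)
    let ?e = "\<lambda>x. exp (- \<i> * complex_of_real (\<xi> \<bullet> x))"
    have eq: "?e x * complex_of_real (step_fun (a # L) r x) =
      complex_of_real (c * indicator {0..s} r) * (?e x * indicator A x) + ?e x * complex_of_real (step_fun L r x)" for x
      by (simp add: step_fun_def a ring_distribs indicator_times[symmetric]) (auto simp: indicator_def)
    show ?case
      unfolding eq using integrable_bounded_phase[OF A, of \<xi>] Cons.IH[OF L]
      by (simp add: a indicator_fourier_def fourier_def)
  qed
  then show ?thesis by (simp add: step_fourier_def fourier_def)
qed

definition step_uminus :: "'a step \<Rightarrow> 'a step" where
  "step_uminus = map (\<lambda>(c, s, A). (- c, s, A))"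

lemma step_diff:
  assumes "step_ok L" "step_ok L'"
  shows "step_ok (L @ step_uminus L')"
    and "step_fourier (L @ step_uminus L') r \<xi> = step_fourier L r \<xi> - step_fourier L' r \<xi>"
    and "step_integral W (L @ step_uminus L') \<omega> = step_integral W L \<omega> - step_integral W L' \<omega>"
proof -
  show ok: "step_ok (L @ step_uminus L')"
    using assms by (auto simp: step_ok_def step_uminus_def)
  have "(\<Sum>(c, s, A)\<leftarrow>step_uminus L'. complex_of_real (c * indicator {0..s} r) * indicator_fourier A \<xi>)
     = - (\<Sum>(c, s, A)\<leftarrow>L'. complex_of_real (c * indicator {0..s} r) * indicator_fourier A \<xi>)"
    unfolding step_uminus_def by (induction L') auto
  then show "step_fourier (L @ step_uminus L') r \<xi> = step_fourier L r \<xi> - step_fourier L' r \<xi>"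
    using assms ok by (simp add: step_fourier_eq)
  have "(\<Sum>(c, s, A)\<leftarrow>step_uminus L'. c * W s A \<omega>) = - (\<Sum>(c, s, A)\<leftarrow>L'. c * W s A \<omega>)"
    unfolding step_uminus_def by (induction L') auto
  then show "step_integral W (L @ step_uminus L') \<omega> = step_integral W L \<omega> - step_integral W L' \<omega>"
    by (simp add: step_integral_def)
qed

text \<open>The differences of the approximating step functions of \<open>\<Phi>\<close> and \<open>\<Psi>\<close> are step functions, for which
  the isometry is a hypothesis. Their Hilbert norms tend to that of \<open>\<Phi>-\<Psi>\<close> and their mean square
  norms to that of \<open>X-Y\<close>, by the triangle inequality on either side, so both limits agree. The
  admissibility of \<open>\<Phi>-\<Psi>\<close> follows on the way from that of the step functions and of the errors.\<close>

lemma wiener_integral_diff_isometry: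
  fixes P :: "'w measure" and \<Phi> \<Psi> :: "real \<Rightarrow> 'a::euclidean_space \<Rightarrow> complex"
  assumes H: "1/2 < H" "H < 1"
    and adm: "\<And>L. step_ok L \<Longrightarrow> hp_admissible H \<beta> (step_fourier L :: real \<Rightarrow> 'a \<Rightarrow> complex)"
    and meas: "\<And>L. step_ok L \<Longrightarrow> step_integral W L \<in> borel_measurable P"
    and sq: "\<And>L. step_ok L \<Longrightarrow> integrable P (\<lambda>\<omega>. (step_integral W L \<omega>)\<^sup>2)"
    and iso: "\<And>L. step_ok L \<Longrightarrow> (LINT \<omega>|P. (step_integral W L \<omega>)\<^sup>2) = (hp_norm H \<beta> (step_fourier L))\<^sup>2"
    and X: "wiener_integral P H \<beta> W \<Phi> X" and Y: "wiener_integral P H \<beta> W \<Psi> Y"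
  shows "hp_admissible H \<beta> (\<lambda>r \<xi>. \<Phi> r \<xi> - \<Psi> r \<xi>)"
    and "(LINT \<omega>|P. (X \<omega> - Y \<omega>)\<^sup>2) = (hp_norm H \<beta> (\<lambda>r \<xi>. \<Phi> r \<xi> - \<Psi> r \<xi>))\<^sup>2"
proof -
  from X have [measurable]: "X \<in> borel_measurable P" and X2: "integrable P (\<lambda>\<omega>. (X \<omega>)\<^sup>2)"
    by (auto simp: wiener_integral_def)
  from Y have [measurable]: "Y \<in> borel_measurable P" and Y2: "integrable P (\<lambda>\<omega>. (Y \<omega>)\<^sup>2)"
    by (auto simp: wiener_integral_def)
  obtain L where L: "\<And>n. step_ok (L n)" "\<And>n. hp_admissible H \<beta> (\<lambda>r \<xi>. step_fourier (L n) r \<xi> - \<Phi> r \<xi>)"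
    "(\<lambda>n. hp_norm H \<beta> (\<lambda>r \<xi>. step_fourier (L n) r \<xi> - \<Phi> r \<xi>)) \<longlonglongrightarrow> 0"
    "(\<lambda>n. LINT \<omega>|P. (step_integral W (L n) \<omega> - X \<omega>)\<^sup>2) \<longlonglongrightarrow> 0"
    using X by (auto simp: wiener_integral_def)
  obtain K where K: "\<And>n. step_ok (K n)" "\<And>n. hp_admissible H \<beta> (\<lambda>r \<xi>. step_fourier (K n) r \<xi> - \<Psi> r \<xi>)"
    "(\<lambda>n. hp_norm H \<beta> (\<lambda>r \<xi>. step_fourier (K n) r \<xi> - \<Psi> r \<xi>)) \<longlonglongrightarrow> 0"
    "(\<lambda>n. LINT \<omega>|P. (step_integral W (K n) \<omega> - Y \<omega>)\<^sup>2) \<longlonglongrightarrow> 0"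
    using Y by (auto simp: wiener_integral_def)
  define S where "S n = L n @ step_uminus (K n)" for n
  have Sn: "step_ok (S n)" "step_fourier (S n) r \<xi> = step_fourier (L n) r \<xi> - step_fourier (K n) r \<xi>"
      "step_integral W (S n) \<omega> = step_integral W (L n) \<omega> - step_integral W (K n) \<omega>" for n r \<xi> \<omega>
    unfolding S_def using step_diff[OF L(1)[of n] K(1)[of n]] by auto
  define D where "D r \<xi> = \<Phi> r \<xi> - \<Psi> r \<xi>" for r \<xi>
  define E where "E n r \<xi> = step_fourier (S n) r \<xi> - D r \<xi>" for n r \<xi>
  have E_eq: "E n = (\<lambda>r \<xi>. (step_fourier (L n) r \<xi> - \<Phi> r \<xi>) + - (step_fourier (K n) r \<xi> - \<Psi> r \<xi>))" for n
    by (intro ext) (simp add: E_def D_def Sn)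
  have K': "hp_admissible H \<beta> (\<lambda>r \<xi>. - (step_fourier (K n) r \<xi> - \<Psi> r \<xi>))" for n
    using K(2)[of n] by (subst hp_admissible_uminus)
  have Eadm: "hp_admissible H \<beta> (E n)" for n
    unfolding E_eq by (rule hp_admissible_add[OF H L(2) K'])
  then have Eadm': "hp_admissible H \<beta> (\<lambda>r \<xi>. - E n r \<xi>)" for n
    by (subst hp_admissible_uminus)
  have Dn: "D = (\<lambda>r \<xi>. step_fourier (S n) r \<xi> + - E n r \<xi>)" for n
    by (intro ext) (simp add: E_def)
  have Sdec: "step_fourier (S n) = (\<lambda>r \<xi>. D r \<xi> + E n r \<xi>)" for n
    by (intro ext) (simp add: E_def)
  have Dadm: "hp_admissible H \<beta> D"
    by (subst Dn[of 0], rule hp_admissible_add[OF H adm[OF Sn(1)] Eadm'])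
  then show "hp_admissible H \<beta> (\<lambda>r \<xi>. \<Phi> r \<xi> - \<Psi> r \<xi>)" by (simp add: D_def[abs_def])
  have Ele: "hp_norm H \<beta> (E n) \<le> hp_norm H \<beta> (\<lambda>r \<xi>. step_fourier (L n) r \<xi> - \<Phi> r \<xi>) +
      hp_norm H \<beta> (\<lambda>r \<xi>. step_fourier (K n) r \<xi> - \<Psi> r \<xi>)" for n
    unfolding E_eq using hp_norm_triangle[OF H L(2) K'] by (simp only: hp_norm_uminus)
  have E0: "(\<lambda>n. hp_norm H \<beta> (E n)) \<longlonglongrightarrow> 0"
  proof (rule tendsto_sandwich[OF _ _ tendsto_const])
    show "(\<lambda>n. hp_norm H \<beta> (\<lambda>r \<xi>. step_fourier (L n) r \<xi> - \<Phi> r \<xi>) +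
      hp_norm H \<beta> (\<lambda>r \<xi>. step_fourier (K n) r \<xi> - \<Psi> r \<xi>)) \<longlonglongrightarrow> 0"
      using tendsto_add[OF L(3) K(3)] by simp
  qed (use Ele hp_norm_nonneg[OF H Eadm] in auto)
  have hpd: "\<bar>hp_norm H \<beta> (step_fourier (S n)) - hp_norm H \<beta> D\<bar> \<le> hp_norm H \<beta> (E n)" for n
  proof -
    have "hp_norm H \<beta> D \<le> hp_norm H \<beta> (step_fourier (S n)) + hp_norm H \<beta> (E n)"
      by (subst Dn[of n], rule order_trans[OF hp_norm_triangle[OF H adm[OF Sn(1)] Eadm']]) (simp add: hp_norm_uminus)
    moreover have "hp_norm H \<beta> (step_fourier (S n)) \<le> hp_norm H \<beta> D + hp_norm H \<beta> (E n)"
      unfolding Sdec by (rule hp_norm_triangle[OF H Dadm Eadm])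
    ultimately show ?thesis by linarith
  qed
  have "(\<lambda>n. hp_norm H \<beta> (step_fourier (S n)) - hp_norm H \<beta> D) \<longlonglongrightarrow> 0"
    by (rule Lim_null_comparison[OF _ E0]) (use hpd in auto)
  then have lim1: "(\<lambda>n. hp_norm H \<beta> (step_fourier (S n))) \<longlonglongrightarrow> hp_norm H \<beta> D"
    by (simp add: LIM_zero_iff)
  define rms where "rms Z = sqrt (LINT \<omega>|P. (Z \<omega>)\<^sup>2)" for Z :: "'w \<Rightarrow> real"
  define L2 where "L2 Z \<longleftrightarrow> Z \<in> borel_measurable P \<and> integrable P (\<lambda>\<omega>. (Z \<omega>)\<^sup>2)" for Z :: "'w \<Rightarrow> real"
  have tri: "rms (\<lambda>\<omega>. Z \<omega> + Z' \<omega>) \<le> rms Z + rms Z'" "L2 (\<lambda>\<omega>. Z \<omega> + Z' \<omega>)" if "L2 Z" "L2 Z'" for Z Z'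
    using rms_triangle[of Z P Z'] that by (auto simp: rms_def L2_def)
  have neg: "L2 (\<lambda>\<omega>. - Z \<omega>) \<longleftrightarrow> L2 Z" "rms (\<lambda>\<omega>. - Z \<omega>) = rms Z" for Z
    by (auto simp: L2_def rms_def borel_measurable_uminus_eq)
  define I where "I n = step_integral W (S n)" for n
  have I: "L2 (I n)" for n using meas sq Sn(1) by (auto simp: L2_def I_def)
  have L2s: "L2 (step_integral W (L n))" "L2 (step_integral W (K n))" "L2 X" "L2 Y" for n
    using meas sq L(1) K(1) X2 Y2 by (auto simp: L2_def)
  define A B where "A n = (\<lambda>\<omega>. step_integral W (L n) \<omega> + - X \<omega>)" and "B n = (\<lambda>\<omega>. step_integral W (K n) \<omega> + - Y \<omega>)" for n
  have AB: "L2 (A n)" "L2 (B n)" for n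
    unfolding A_def B_def
    by (rule tri(2)[OF L2s(1) neg(1)[THEN iffD2, OF L2s(3)]], rule tri(2)[OF L2s(2) neg(1)[THEN iffD2, OF L2s(4)]])
  have A0: "(\<lambda>n. rms (A n)) \<longlonglongrightarrow> 0" and B0: "(\<lambda>n. rms (B n)) \<longlonglongrightarrow> 0"
    using tendsto_real_sqrt[OF L(4)] tendsto_real_sqrt[OF K(4)] by (auto simp: rms_def A_def B_def)
  define Z where "Z = (\<lambda>\<omega>. X \<omega> + - Y \<omega>)"
  define R where "R n = (\<lambda>\<omega>. A n \<omega> + - B n \<omega>)" for n
  have ZR: "L2 Z" "L2 (R n)" for n
    unfolding Z_def R_def
    by (rule tri(2)[OF L2s(3) neg(1)[THEN iffD2, OF L2s(4)]], rule tri(2)[OF AB(1) neg(1)[THEN iffD2, OF AB(2)]])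
  have Rle: "rms (R n) \<le> rms (A n) + rms (B n)" for n
    unfolding R_def using tri(1)[of "A n" "\<lambda>\<omega>. - B n \<omega>"] AB by (simp add: neg)
  have R0: "(\<lambda>n. rms (A n) + rms (B n)) \<longlonglongrightarrow> 0" using tendsto_add[OF A0 B0] by simp
  have rd: "\<bar>rms (I n) - rms Z\<bar> \<le> rms (A n) + rms (B n)" for n
  proof -
    have "I n = (\<lambda>\<omega>. Z \<omega> + R n \<omega>)" by (intro ext) (simp add: I_def Sn Z_def R_def A_def B_def)
    then have "rms (I n) \<le> rms Z + rms (R n)" using tri(1)[OF ZR(1) ZR(2)] by simp
    moreover have "Z = (\<lambda>\<omega>. I n \<omega> + - R n \<omega>)" by (intro ext) (simp add: I_def Sn Z_def R_def A_def B_def)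
    then have "rms Z \<le> rms (I n) + rms (R n)" using tri(1)[OF I[of n], of "\<lambda>\<omega>. - R n \<omega>"] ZR by (simp add: neg)
    ultimately show ?thesis using Rle[of n] by linarith
  qed
  have "(\<lambda>n. rms (I n) - rms Z) \<longlonglongrightarrow> 0"
    by (rule Lim_null_comparison[OF _ R0]) (use rd in auto)
  then have "(\<lambda>n. rms (I n)) \<longlonglongrightarrow> rms Z" by (simp add: LIM_zero_iff)
  moreover have "rms (I n) = hp_norm H \<beta> (step_fourier (S n))" for n
    using iso[OF Sn(1)] hp_norm_nonneg[OF H adm[OF Sn(1)]] by (simp add: rms_def I_def)
  ultimately have "rms Z = hp_norm H \<beta> D"
    using lim1 LIMSEQ_unique by simp
  then have "(rms Z)\<^sup>2 = (hp_norm H \<beta> D)\<^sup>2" by simp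
  then show "(LINT \<omega>|P. (X \<omega> - Y \<omega>)\<^sup>2) = (hp_norm H \<beta> (\<lambda>r \<xi>. \<Phi> r \<xi> - \<Psi> r \<xi>))\<^sup>2"
    by (simp add: rms_def Z_def D_def[abs_def])
qed

section \<open>Radial integrals\<close>

text \<open>Polar coordinates: both measures give a half-line \<open>{..a}\<close> the volume of the ball of radius \<open>a\<close>.\<close>

lemma distr_norm_lborel:
  "distr lborel borel (norm :: 'a::euclidean_space \<Rightarrow> real) =
     density lborel (\<lambda>r. ennreal (indicator {0..} r * (DIM('a) * unit_ball_vol DIM('a) * r ^ (DIM('a) - 1))))"
proof (rule measure_eqI_generator_eq[where E="range atMost" and \<Omega>=UNIV and A="\<lambda>i. {..real i}"])
  let ?d = "DIM('a)" and ?v = "unit_ball_vol (real DIM('a))"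
  have D: "emeasure (distr lborel borel (norm :: 'a \<Rightarrow> real)) {..a} = ennreal (if 0 \<le> a then ?v * a ^ ?d else 0)" for a
  proof -
    have "norm -` {..a} = (cball 0 a :: 'a set)" by auto
    then show ?thesis by (auto simp: emeasure_distr emeasure_cball)
  qed
  show "emeasure (distr lborel borel (norm :: 'a \<Rightarrow> real)) X =
    emeasure (density lborel (\<lambda>r. ennreal (indicator {0..} r * (?d * ?v * r ^ (?d - 1))))) X"
    if X: "X \<in> range atMost" for X
  proof -
    obtain a where a: "X = {..a}" using X by auto
    have "emeasure (density lborel (\<lambda>r. ennreal (indicator {0..} r * (?d * ?v * r ^ (?d - 1))))) X
      = (\<integral>\<^sup>+r. ennreal (?d * ?v * r ^ (?d - 1)) * indicator {0..a} r \<partial>lborel)"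
      by (auto simp: a emeasure_density intro!: nn_integral_cong split: split_indicator)
    also have "\<dots> = ennreal (if 0 \<le> a then ?v * a ^ ?d else 0)"
    proof (cases "0 \<le> a")
      case True
      have "(\<integral>\<^sup>+r. ennreal (?d * ?v * r ^ (?d - 1)) * indicator {0..a} r \<partial>lborel) = ennreal (?v * a ^ ?d - ?v * 0 ^ ?d)"
        using True by (intro nn_integral_FTC_Icc) (auto intro!: derivative_eq_intros)
      then show ?thesis using True by simp
    qed auto
    finally show ?thesis using D[of a] a by simp
  qed
  show "sets (distr lborel borel (norm :: 'a \<Rightarrow> real)) = sigma_sets UNIV (range atMost)"
    by (simp add: borel_eq_atMost)
  show "sets (density lborel (\<lambda>r. ennreal (indicator {0..} r * (?d * ?v * r ^ (?d - 1))))) = sigma_sets UNIV (range atMost)"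
    by (simp add: borel_eq_atMost)
  show "Int_stable (range atMost :: real set set)" by (auto simp: Int_stable_def)
  show "(\<Union>i. {..real i}) = (UNIV :: real set)" by (auto simp: real_arch_simple)
  show "emeasure (distr lborel borel (norm :: 'a \<Rightarrow> real)) {..real i} \<noteq> \<infinity>" for i
    by (simp add: D)
qed auto

lemma nn_integral_radial:
  assumes [measurable]: "g \<in> borel_measurable borel"
  shows "(\<integral>\<^sup>+\<xi>. g (norm (\<xi> :: 'a::euclidean_space)) \<partial>lborel) =
    (\<integral>\<^sup>+r. ennreal (DIM('a) * unit_ball_vol DIM('a) * r ^ (DIM('a) - 1)) * g r * indicator {0..} r \<partial>lborel)"
proof -
  have "(\<integral>\<^sup>+\<xi>. g (norm (\<xi> :: 'a)) \<partial>lborel) = (\<integral>\<^sup>+r. g r \<partial>distr lborel borel (norm :: 'a \<Rightarrow> real))"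
    by (simp add: nn_integral_distr)
  also have "\<dots> = (\<integral>\<^sup>+r. ennreal (indicator {0..} r * (DIM('a) * unit_ball_vol DIM('a) * r ^ (DIM('a) - 1))) * g r \<partial>lborel)"
    unfolding distr_norm_lborel by (simp add: nn_integral_density)
  also have "\<dots> = (\<integral>\<^sup>+r. ennreal (DIM('a) * unit_ball_vol DIM('a) * r ^ (DIM('a) - 1)) * g r * indicator {0..} r \<partial>lborel)"
    by (intro nn_integral_cong) (auto split: split_indicator)
  finally show ?thesis .
qed

lemma radial_weight_powr:
  assumes "0 < r" "0 < n" shows "r powr e * r ^ (n - 1) = r powr (real n + e - 1)"
proof -
  have "r ^ (n - 1) = r powr (real n - 1)"
    using assms by (simp add: powr_realpow[symmetric] of_nat_diff)
  then show ?thesis by (simp add: powr_add[symmetric] algebra_simps)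
qed

lemma nn_integral_norm_powr_cball:
  fixes e R :: real
  assumes e: "- real DIM('a) < e" and R: "0 \<le> R"
  shows "(\<integral>\<^sup>+\<xi>. ennreal (norm (\<xi> :: 'a::euclidean_space) powr e) * indicator (cball 0 R) \<xi> \<partial>lborel) =
    ennreal (DIM('a) * unit_ball_vol DIM('a) / (DIM('a) + e) * R powr (DIM('a) + e))"
proof -
  let ?c = "DIM('a) * unit_ball_vol DIM('a)"
  have "(\<integral>\<^sup>+\<xi>. ennreal (norm (\<xi> :: 'a) powr e) * indicator (cball 0 R) \<xi> \<partial>lborel) =
    (\<integral>\<^sup>+\<xi>. (\<lambda>r. ennreal (r powr e) * indicator {..R} r) (norm (\<xi> :: 'a)) \<partial>lborel)"
    by (intro nn_integral_cong) (auto split: split_indicator)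
  also have "\<dots> = (\<integral>\<^sup>+r. ennreal (?c * r ^ (DIM('a) - 1)) * (ennreal (r powr e) * indicator {..R} r) * indicator {0..} r \<partial>lborel)"
    by (rule nn_integral_radial) measurable
  also have "\<dots> = (\<integral>\<^sup>+r. ennreal (?c * r powr (DIM('a) + e - 1)) * indicator {0..R} r \<partial>lborel)"
  proof (intro nn_integral_cong)
    fix r :: real
    have "?c * r ^ (DIM('a) - 1) * r powr e = ?c * r powr (DIM('a) + e - 1)" if "0 \<le> r"
      using radial_weight_powr[of r "DIM('a)" e] that by (cases "r = 0") (auto simp: mult_ac)
    then show "ennreal (?c * r ^ (DIM('a) - 1)) * (ennreal (r powr e) * indicator {..R} r) * indicator {0..} r =
      ennreal (?c * r powr (DIM('a) + e - 1)) * indicator {0..R} r"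
      by (auto split: split_indicator simp: ennreal_mult[symmetric])
  qed
  also have "\<dots> = ennreal (?c * (R powr (DIM('a) + e - 1 + 1) / (DIM('a) + e - 1 + 1)))"
  proof (rule nn_integral_has_integral_lebesgue')
    show "((\<lambda>r. ?c * r powr (DIM('a) + e - 1)) has_integral ?c * (R powr (DIM('a) + e - 1 + 1) / (DIM('a) + e - 1 + 1))) {0..R}"
      using e R by (intro has_integral_mult_right has_integral_powr_from_0) auto
  qed auto
  finally show ?thesis by (simp add: mult_ac)
qed

lemma nn_integral_norm_powr_outside:
  fixes e R :: real
  assumes e: "e < - real DIM('a)" and R: "0 < R"
  shows "(\<integral>\<^sup>+\<xi>. ennreal (norm (\<xi> :: 'a::euclidean_space) powr e) * indicator {\<xi>. R \<le> norm \<xi>} \<xi> \<partial>lborel) =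
    ennreal (DIM('a) * unit_ball_vol DIM('a) / (- (DIM('a) + e)) * R powr (DIM('a) + e))"
proof -
  let ?c = "DIM('a) * unit_ball_vol DIM('a)"
  have "(\<integral>\<^sup>+\<xi>. ennreal (norm (\<xi> :: 'a) powr e) * indicator {\<xi>. R \<le> norm \<xi>} \<xi> \<partial>lborel) =
    (\<integral>\<^sup>+\<xi>. (\<lambda>r. ennreal (r powr e) * indicator {R..} r) (norm (\<xi> :: 'a)) \<partial>lborel)"
    by (intro nn_integral_cong) (auto split: split_indicator)
  also have "\<dots> = (\<integral>\<^sup>+r. ennreal (?c * r ^ (DIM('a) - 1)) * (ennreal (r powr e) * indicator {R..} r) * indicator {0..} r \<partial>lborel)"
    by (rule nn_integral_radial) measurable
  also have "\<dots> = (\<integral>\<^sup>+r. ennreal (?c * r powr (DIM('a) + e - 1)) * indicator {R..} r \<partial>lborel)"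
  proof (intro nn_integral_cong)
    fix r :: real
    have "?c * r ^ (DIM('a) - 1) * r powr e = ?c * r powr (DIM('a) + e - 1)" if "R \<le> r"
      using radial_weight_powr[of r "DIM('a)" e] that R by (auto simp: mult_ac)
    then show "ennreal (?c * r ^ (DIM('a) - 1)) * (ennreal (r powr e) * indicator {R..} r) * indicator {0..} r =
      ennreal (?c * r powr (DIM('a) + e - 1)) * indicator {R..} r"
      using R by (auto split: split_indicator simp: ennreal_mult[symmetric])
  qed
  also have "\<dots> = ennreal (0 - ?c / (DIM('a) + e) * R powr (DIM('a) + e))"
  proof (rule nn_integral_FTC_atLeast)
    show "((\<lambda>r. ?c / (DIM('a) + e) * r powr (DIM('a) + e)) has_real_derivative ?c * x powr (DIM('a) + e - 1)) (at x)"
      if "R \<le> x" for x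
      using that R e by (auto intro!: derivative_eq_intros)
    have "((\<lambda>r. r powr (DIM('a) + e)) \<longlongrightarrow> 0) at_top"
      using e by (intro tendsto_neg_powr filterlim_ident) auto
    then show "((\<lambda>r. ?c / (DIM('a) + e) * r powr (DIM('a) + e)) \<longlongrightarrow> 0) at_top"
      by (rule tendsto_mult_right_zero)
  qed auto
  finally show ?thesis by (simp add: divide_minus_right del: minus_add_distrib)
qed

lemma nn_integral_riesz_measure:
  assumes [measurable]: "g \<in> borel_measurable borel"
  shows "(\<integral>\<^sup>+\<xi>. g \<xi> \<partial>riesz_measure \<beta>) =
    (\<integral>\<^sup>+\<xi>. ennreal (norm \<xi> powr (- real DIM('a) + \<beta>)) * g (\<xi> :: 'a::euclidean_space) \<partial>lborel)"
  unfolding riesz_measure_def by (subst nn_integral_density) auto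

section \<open>Gaussians as Schwartz functions and their Fourier transforms\<close>

text \<open>The centred Gaussian density with covariance \<open>s\<^sup>2\<close> times the identity.\<close>

definition gauss :: "real \<Rightarrow> 'a::euclidean_space \<Rightarrow> real" where
  "gauss s x = exp (- (norm x)\<^sup>2 / (2 * s\<^sup>2)) / (sqrt (2 * pi) * s) ^ DIM('a)"

lemma gauss_measurable [measurable]: "gauss s \<in> borel_measurable borel"
  unfolding gauss_def by measurable

lemma gauss_nonneg: "0 \<le> s \<Longrightarrow> 0 \<le> gauss s x"
  by (simp add: gauss_def)

lemma real_polynomial_function_has_derivative:
  assumes "real_polynomial_function p"
  shows "\<exists>D. (\<forall>x. (p has_derivative D x) (at x)) \<and> (\<forall>b. real_polynomial_function (\<lambda>x. D x b))"
  using assms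
proof induction
  case (linear f)
  then show ?case by (intro exI[of _ "\<lambda>_. f"]) (auto intro: bounded_linear_imp_has_derivative real_polynomial_function.intros)
next
  case (const c)
  then show ?case by (intro exI[of _ "\<lambda>_ _. 0"]) (auto intro: real_polynomial_function.intros)
next
  case (add f g)
  then obtain D E where "\<forall>x. (f has_derivative D x) (at x)" "\<forall>b. real_polynomial_function (\<lambda>x. D x b)"
    "\<forall>x. (g has_derivative E x) (at x)" "\<forall>b. real_polynomial_function (\<lambda>x. E x b)" by blast
  then show ?case
    by (intro exI[of _ "\<lambda>x b. D x b + E x b"]) (auto intro!: has_derivative_add real_polynomial_function.intros(3))
next
  case (mult f g)
  then obtain D E where "\<forall>x. (f has_derivative D x) (at x)" "\<forall>b. real_polynomial_function (\<lambda>x. D x b)"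
    "\<forall>x. (g has_derivative E x) (at x)" "\<forall>b. real_polynomial_function (\<lambda>x. E x b)" by blast
  then show ?case using mult.hyps
    by (intro exI[of _ "\<lambda>x b. f x * E x b + D x b * g x"])
       (auto intro!: has_derivative_mult real_polynomial_function.intros(3,4))
qed

text \<open>Growth below every \<open>e\<^bsup>\<epsilon>|x|\<^sup>2\<^esup>\<close> is all that is needed of polynomials here, and, unlike a bound by
  a power, it is inherited by products simply by halving \<open>\<epsilon>\<close>.\<close>

lemma real_polynomial_function_exp_bound:
  fixes p :: "'a::euclidean_space \<Rightarrow> real"
  assumes "real_polynomial_function p" "0 < \<epsilon>"
  shows "\<exists>C\<ge>0. \<forall>x. \<bar>p x\<bar> \<le> C * exp (\<epsilon> * (norm x)\<^sup>2)"
  using assms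
proof (induction arbitrary: \<epsilon>)
  case (linear f)
  obtain K where K: "K \<ge> 0" "\<And>x. norm (f x) \<le> norm x * K"
    using bounded_linear.nonneg_bounded[OF linear.hyps] by blast
  show ?case
  proof (intro exI[of _ "K * (1 + 1 / \<epsilon>)"] conjI allI)
    show "0 \<le> K * (1 + 1 / \<epsilon>)" using K linear.prems by auto
    fix x :: 'a
    have "0 \<le> (norm x - 1)\<^sup>2" by (rule zero_le_power2)
    then have "2 * norm x \<le> 1 + (norm x)\<^sup>2" by (simp add: power2_eq_square algebra_simps)
    then have "norm x \<le> 1 + (norm x)\<^sup>2" using norm_ge_zero[of x] by linarith
    also have "\<dots> \<le> (1 + 1 / \<epsilon>) * (1 + \<epsilon> * (norm x)\<^sup>2)"
      using linear.prems by (simp add: field_simps)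
    also have "\<dots> \<le> (1 + 1 / \<epsilon>) * exp (\<epsilon> * (norm x)\<^sup>2)"
      using linear.prems by (intro mult_left_mono exp_ge_add_one_self) auto
    finally have "norm x * K \<le> (1 + 1 / \<epsilon>) * exp (\<epsilon> * (norm x)\<^sup>2) * K"
      using K by (intro mult_right_mono)
    then show "\<bar>f x\<bar> \<le> K * (1 + 1 / \<epsilon>) * exp (\<epsilon> * (norm x)\<^sup>2)" using K(2)[of x] by (simp add: mult_ac)
  qed
next
  case (const c)
  have "1 \<le> exp (\<epsilon> * (norm x)\<^sup>2)" for x :: 'a using const by simp
  then have "\<bar>c\<bar> * 1 \<le> \<bar>c\<bar> * exp (\<epsilon> * (norm x)\<^sup>2)" for x :: 'a by (intro mult_left_mono) auto
  then show ?case by (intro exI[of _ "\<bar>c\<bar>"]) auto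
next
  case (add f g)
  obtain C D where "C \<ge> 0" "D \<ge> 0" "\<forall>x. \<bar>f x\<bar> \<le> C * exp (\<epsilon> * (norm x)\<^sup>2)" "\<forall>x. \<bar>g x\<bar> \<le> D * exp (\<epsilon> * (norm x)\<^sup>2)"
    using add.IH[OF add.prems] by blast
  then show ?case
    by (intro exI[of _ "C + D"]) (auto simp: distrib_right intro!: order_trans[OF abs_triangle_ineq] add_mono)
next
  case (mult f g)
  obtain C D where *: "C \<ge> 0" "D \<ge> 0" "\<forall>x. \<bar>f x\<bar> \<le> C * exp (\<epsilon> / 2 * (norm x)\<^sup>2)" "\<forall>x. \<bar>g x\<bar> \<le> D * exp (\<epsilon> / 2 * (norm x)\<^sup>2)"
    using mult.IH[of "\<epsilon> / 2"] mult.prems by (metis half_gt_zero)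
  have "\<bar>f x * g x\<bar> \<le> C * D * exp (\<epsilon> * (norm x)\<^sup>2)" for x
  proof -
    have "\<bar>f x * g x\<bar> \<le> (C * exp (\<epsilon> / 2 * (norm x)\<^sup>2)) * (D * exp (\<epsilon> / 2 * (norm x)\<^sup>2))"
      unfolding abs_mult using * by (intro mult_mono) auto
    also have "\<dots> = C * D * (exp (\<epsilon> / 2 * (norm x)\<^sup>2) * exp (\<epsilon> / 2 * (norm x)\<^sup>2))" by (simp add: mult_ac)
    also have "\<dots> = C * D * exp (\<epsilon> * (norm x)\<^sup>2)" by (simp add: exp_add[symmetric] del: mult_eq_0_iff)
    finally show ?thesis .
  qed
  with * show ?case by (intro exI[of _ "C * D"]) auto
qed

text \<open>Moving the centre of a Gaussian by a bounded amount costs a constant factor and a factor \<open>1/2\<close> in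
  the exponent. This is how Gaussians are compared below.\<close>

lemma norm_sq_le_shift: "(norm x)\<^sup>2 \<le> 2 * (norm (x - a))\<^sup>2 + 2 * (norm (a :: 'a::real_normed_vector))\<^sup>2"
proof -
  have "norm x \<le> norm (x - a) + norm a" using norm_triangle_ineq[of "x - a" a] by simp
  then have "(norm x)\<^sup>2 \<le> (norm (x - a) + norm a)\<^sup>2" by (intro power_mono) auto
  also have "\<dots> \<le> 2 * (norm (x - a))\<^sup>2 + 2 * (norm a)\<^sup>2"
    using zero_le_power2[of "norm (x - a) - norm a"] by (simp add: power2_eq_square algebra_simps)
  finally show ?thesis .
qed

text \<open>Polynomials times a fixed Gaussian are closed under partial derivatives and bounded.\<close>

lemma schwartz_polynomial_gaussian:
  fixes a :: "'a::euclidean_space"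
  assumes p: "real_polynomial_function p" and c: "0 < c"
  shows "schwartz (\<lambda>x. complex_of_real (p x * exp (- c * (norm (x - a))\<^sup>2)))"
proof -
  define E where "E x = exp (- c * (norm (x - a))\<^sup>2)" for x
  have Ed: "(E has_derivative (\<lambda>b. E x * (- c * (2 * ((x - a) \<bullet> b))))) (at x)" for x
    unfolding E_def power2_norm_eq_inner
    by (auto intro!: derivative_eq_intros simp: inner_commute algebra_simps)
  have step: "\<exists>q. real_polynomial_function q \<and> iter_partial bs (\<lambda>x. complex_of_real (p x * E x)) = (\<lambda>x. complex_of_real (q x * E x))"
    for bs
  proof (induction bs)
    case Nil
    show ?case using p by auto
  next
    case (Cons b bs)
    then obtain q where q: "real_polynomial_function q"
      "iter_partial bs (\<lambda>x. complex_of_real (p x * E x)) = (\<lambda>x. complex_of_real (q x * E x))" by blast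
    obtain D where D: "\<And>x. (q has_derivative D x) (at x)" "\<And>b. real_polynomial_function (\<lambda>x. D x b)"
      using real_polynomial_function_has_derivative[OF q(1)] by blast
    have der: "((\<lambda>x. complex_of_real (q x * E x)) has_derivative
       (\<lambda>b. complex_of_real (q x * (E x * (- c * (2 * ((x - a) \<bullet> b)))) + D x b * E x))) (at x)" for x
      by (rule has_derivative_of_real[OF has_derivative_mult[OF D(1) Ed]])
    have lin: "real_polynomial_function (\<lambda>x. x \<bullet> b)"
      by (rule real_polynomial_function.intros(1)) (rule bounded_linear_inner_left)
    have "real_polynomial_function (\<lambda>x. D x b + q x * (- 2 * c * (x \<bullet> b + - (a \<bullet> b))))"
      using q(1) D(2) lin by (intro real_polynomial_function.intros(2-4))
    moreover have "iter_partial (b # bs) (\<lambda>x. complex_of_real (p x * E x)) =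
      (\<lambda>x. complex_of_real ((D x b + q x * (- 2 * c * (x \<bullet> b + - (a \<bullet> b)))) * E x))"
      by (simp only: iter_partial.simps q(2) frechet_derivative_at[OF der, symmetric])
         (simp add: algebra_simps inner_diff_left)
    ultimately show ?case by blast
  qed
  show ?thesis
    unfolding schwartz_def E_def[symmetric]
  proof (intro allI impI conjI)
    fix bs :: "'a list" and x
    obtain q where q: "real_polynomial_function q"
      "iter_partial bs (\<lambda>x. complex_of_real (p x * E x)) = (\<lambda>x. complex_of_real (q x * E x))"
      using step by blast
    obtain D where D: "\<And>x. (q has_derivative D x) (at x)" "\<And>b. real_polynomial_function (\<lambda>x. D x b)"
      using real_polynomial_function_has_derivative[OF q(1)] by blast
    show "iter_partial bs (\<lambda>x. complex_of_real (p x * E x)) differentiable at x"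
      unfolding q(2) differentiable_def using has_derivative_of_real[OF has_derivative_mult[OF D(1) Ed]] by blast
    fix k :: nat
    have "real_polynomial_function (\<lambda>x::'a. x \<bullet> x)"
      by (subst euclidean_inner, intro real_polynomial_function_sum real_polynomial_function.intros(4) real_polynomial_function.intros(1) bounded_linear_inner_left) auto
    then have "real_polynomial_function (\<lambda>x. (1 + (x \<bullet> x) ^ k) * q x)"
      using q(1) by (intro real_polynomial_function.intros(4) real_polynomial_function.intros(3) real_polynomial_function.intros(2) real_polynomial_function_power)
    then obtain C where C: "C \<ge> 0" "\<And>x. \<bar>(1 + (x \<bullet> x) ^ k) * q x\<bar> \<le> C * exp (c / 2 * (norm x)\<^sup>2)"
      using real_polynomial_function_exp_bound[of "\<lambda>x. (1 + (x \<bullet> x) ^ k) * q x" "c / 2"] c by auto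
    have "norm (norm x ^ k * norm (complex_of_real (q x * E x))) \<le> C * exp (c * (norm a)\<^sup>2)" for x
    proof -
      have "norm x ^ k \<le> 1 + (x \<bullet> x) ^ k"
      proof (cases "norm x \<le> 1")
        case True
        then have "norm x ^ k \<le> 1" by (intro power_le_one) auto
        then show ?thesis using zero_le_power[of "x \<bullet> x" k] by (smt (verit) inner_ge_zero)
      next
        case False
        then have "norm x ^ k \<le> norm x ^ (2 * k)" by (intro power_increasing) auto
        then show ?thesis by (simp add: power_mult power2_norm_eq_inner)
      qed
      then have "norm (norm x ^ k * norm (complex_of_real (q x * E x))) \<le> \<bar>(1 + (x \<bullet> x) ^ k) * q x\<bar> * E x"
        using mult_right_mono[of "norm x ^ k" "1 + (x \<bullet> x) ^ k" "\<bar>q x\<bar> * E x"]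
        by (simp add: norm_mult abs_mult E_def mult.assoc)
      also have "\<dots> \<le> C * exp (c / 2 * (norm x)\<^sup>2) * E x"
        using C by (intro mult_right_mono) (auto simp: E_def)
      also have "\<dots> = C * exp (c / 2 * (norm x)\<^sup>2 + - c * (norm (x - a))\<^sup>2)"
        by (simp add: E_def exp_add[symmetric])
      also have "\<dots> \<le> C * exp (c * (norm a)\<^sup>2)"
      proof -
        have "c / 2 * (norm x)\<^sup>2 \<le> c / 2 * (2 * (norm (x - a))\<^sup>2 + 2 * (norm a)\<^sup>2)"
          using c norm_sq_le_shift by (intro mult_left_mono) auto
        then show ?thesis using C(1) by (intro mult_left_mono) (auto simp: algebra_simps)
      qed
      finally show ?thesis .
    qed
    then show "bounded (range (\<lambda>x. norm x ^ k * norm (iter_partial bs (\<lambda>x. complex_of_real (p x * E x)) x)))"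
      unfolding q(2) bounded_iff by blast
  qed
qed

lemma schwartz_gauss_shift:
  assumes "0 < s" shows "schwartz (\<lambda>x. complex_of_real (gauss s (x - a)))"
proof -
  have "schwartz (\<lambda>x. complex_of_real (1 / (sqrt (2 * pi) * s) ^ DIM('a) * exp (- (1 / (2 * s\<^sup>2)) * (norm (x - a))\<^sup>2)))"
    for a :: 'a using assms by (intro schwartz_polynomial_gaussian real_polynomial_function.intros(2)) auto
  then show ?thesis by (simp add: gauss_def)
qed

lemma integral_lborel_prod:
  fixes f :: "'a::euclidean_space \<Rightarrow> real \<Rightarrow> complex"
  assumes int: "\<And>b. b \<in> Basis \<Longrightarrow> integrable lborel (f b)"
  shows "integrable lborel (\<lambda>x::'a. \<Prod>b\<in>Basis. f b (x \<bullet> b))" (is ?int)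
    and "(LINT x|lborel. (\<Prod>b\<in>Basis. f b (x \<bullet> (b::'a)))) = (\<Prod>b\<in>Basis. (LINT t|lborel. f b t))" (is ?eq)
proof -
  interpret product_sigma_finite "\<lambda>_::'a. lborel :: real measure" by standard
  have [measurable]: "b \<in> Basis \<Longrightarrow> f b \<in> borel_measurable borel" for b using int by auto
  have fm: "(\<lambda>x. \<Prod>b\<in>Basis. f b (x \<bullet> b)) \<in> borel_measurable borel" by measurable
  have gm: "(\<lambda>g. \<Sum>b\<in>Basis. g b *\<^sub>R b) \<in> (\<Pi>\<^sub>M b\<in>(Basis::'a set). lborel) \<rightarrow>\<^sub>M borel" by measurable
  have eq: "(\<lambda>g. \<Prod>b\<in>Basis. f b ((\<Sum>b\<in>Basis. g b *\<^sub>R b) \<bullet> b)) = (\<lambda>g. \<Prod>b\<in>(Basis::'a set). f b (g b))"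
    by (intro ext prod.cong refl) simp
  have "integrable (\<Pi>\<^sub>M b\<in>(Basis::'a set). lborel) (\<lambda>g. \<Prod>b\<in>Basis. f b (g b))"
    by (rule product_integrable_prod) (use int in auto)
  then show ?int unfolding lborel_eq[where 'a='a] integrable_distr_eq[OF gm fm] eq .
  show ?eq unfolding lborel_eq[where 'a='a] integral_distr[OF gm fm] eq
    by (rule product_integral_prod[OF finite_Basis int])
qed

lemma sum_Basis_inner_squares: "(\<Sum>b\<in>Basis. (x \<bullet> b)\<^sup>2) = (norm x)\<^sup>2"
  unfolding power2_norm_eq_inner by (subst euclidean_inner) (simp add: power2_eq_square)

lemma gauss_1_prod: "gauss 1 x = (\<Prod>b\<in>Basis. std_normal_density (x \<bullet> b))"
proof -
  have "(\<Prod>b\<in>Basis. std_normal_density (x \<bullet> b)) = (\<Prod>b\<in>(Basis::'a set). 1 / sqrt (2 * pi)) * exp (\<Sum>b\<in>Basis. - (x \<bullet> b)\<^sup>2 / 2)"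
    unfolding std_normal_density_def prod.distrib exp_sum[OF finite_Basis] ..
  also have "(\<Sum>b\<in>Basis. - (x \<bullet> b)\<^sup>2 / 2) = - (norm x)\<^sup>2 / 2"
    by (simp add: sum_negf sum_divide_distrib[symmetric] sum_Basis_inner_squares)
  finally show ?thesis by (simp add: gauss_def power_divide)
qed

text \<open>The Gaussian factorizes over the coordinates, and in one dimension its Fourier transform is the
  characteristic function of the standard normal distribution.\<close>

lemma fourier_gauss_1:
  fixes \<xi> :: "'a::euclidean_space"
  shows "integrable lborel (\<lambda>x. exp (- \<i> * complex_of_real (\<xi> \<bullet> x)) * complex_of_real (gauss 1 x))" (is "integrable _ ?f")
    and "(LINT x|lborel. exp (- \<i> * complex_of_real (\<xi> \<bullet> x)) * complex_of_real (gauss 1 x)) =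
      complex_of_real (exp (- (norm \<xi>)\<^sup>2 / 2))"
proof -
  let ?g = "\<lambda>b t. exp (- \<i> * complex_of_real ((\<xi> \<bullet> b) * t)) * complex_of_real (std_normal_density t)"
  have f: "?f = (\<lambda>x. \<Prod>b\<in>Basis. ?g b (x \<bullet> b))"
  proof
    fix x
    have "exp (- \<i> * complex_of_real (\<xi> \<bullet> x)) = exp (\<Sum>b\<in>Basis. - \<i> * complex_of_real ((\<xi> \<bullet> b) * (x \<bullet> b)))"
      by (subst euclidean_inner) (simp add: sum_distrib_left sum_negf)
    then show "?f x = (\<Prod>b\<in>Basis. ?g b (x \<bullet> b))"
      by (simp add: gauss_1_prod prod.distrib exp_sum)
  qed
  have i: "integrable lborel (?g b)" for b
  proof (rule Bochner_Integration.integrable_bound)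
    show "integrable lborel std_normal_density" by simp
    show "?g b \<in> borel_measurable lborel" by measurable
  qed (simp add: norm_mult)
  show "integrable lborel ?f" unfolding f by (rule integral_lborel_prod(1)) (rule i)
  have "(LINT t|lborel. ?g b t) = complex_of_real (exp (- (\<xi> \<bullet> b)\<^sup>2 / 2))" for b
  proof -
    have "(LINT t|lborel. ?g b t) = (LINT t|lborel. std_normal_density t *\<^sub>R exp (\<i> * complex_of_real (- (\<xi> \<bullet> b) * t)))"
      by (intro Bochner_Integration.integral_cong) (auto simp: scaleR_conv_of_real)
    also have "\<dots> = char std_normal_distribution (- (\<xi> \<bullet> b))"
      unfolding char_def by (subst integral_density) auto
    finally show ?thesis by (simp add: char_std_normal_distribution)
  qed
  then have "(LINT x|lborel. ?f x) = (\<Prod>b\<in>Basis. complex_of_real (exp (- (\<xi> \<bullet> b)\<^sup>2 / 2)))"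
    unfolding f by (subst integral_lborel_prod(2)[OF i]) simp
  also have "\<dots> = complex_of_real (exp (\<Sum>b\<in>Basis. - (\<xi> \<bullet> b)\<^sup>2 / 2))"
    by (simp add: exp_sum)
  also have "(\<Sum>b\<in>Basis. - (\<xi> \<bullet> b)\<^sup>2 / 2) = - (norm \<xi>)\<^sup>2 / 2"
    by (simp add: sum_negf sum_divide_distrib[symmetric] sum_Basis_inner_squares)
  finally show "(LINT x|lborel. ?f x) = complex_of_real (exp (- (norm \<xi>)\<^sup>2 / 2))" .
qed

lemma integrable_gauss_1: "integrable lborel (gauss 1 :: 'a::euclidean_space \<Rightarrow> real)"
  using fourier_gauss_1(1)[of "0 :: 'a"] by (simp add: complex_of_real_integrable_eq)

lemma integral_gauss_1: "(LINT x|lborel. gauss 1 (x :: 'a::euclidean_space)) = 1"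
  using fourier_gauss_1(2)[of "0 :: 'a"] by (simp flip: of_real_eq_iff)

lemma integral_lborel_affine:
  fixes g :: "'a::euclidean_space \<Rightarrow> 'b::{banach, second_countable_topology}"
  assumes [measurable]: "g \<in> borel_measurable borel" and s: "s \<noteq> (0::real)"
  shows "(LINT x|lborel. g x) = (LINT x|lborel. \<bar>s\<bar> ^ DIM('a) *\<^sub>R g (a + s *\<^sub>R x))"
  by (subst lborel_affine[of s a]) (use s in \<open>simp_all add: integral_density integral_distr\<close>)

lemma nn_integral_lborel_affine:
  fixes g :: "'a::euclidean_space \<Rightarrow> ennreal"
  assumes [measurable]: "g \<in> borel_measurable borel" and s: "s \<noteq> (0::real)"
  shows "(\<integral>\<^sup>+x. g x \<partial>lborel) = ennreal (\<bar>s\<bar> ^ DIM('a)) * (\<integral>\<^sup>+x. g (a + s *\<^sub>R x) \<partial>lborel)"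
  by (subst lborel_affine[of s a]) (use s in \<open>simp_all add: nn_integral_density nn_integral_distr nn_integral_cmult power_abs\<close>)

lemma gauss_scale: "0 < s \<Longrightarrow> s ^ DIM('a) * gauss s (s *\<^sub>R z) = gauss 1 (z :: 'a::euclidean_space)"
  by (simp add: gauss_def power_mult_distrib field_simps)

lemma fourier_gauss_shift:
  fixes a :: "'a::euclidean_space"
  assumes s: "0 < s"
  shows "fourier (\<lambda>x. complex_of_real (gauss s (x - a))) \<xi> =
    exp (- \<i> * complex_of_real (\<xi> \<bullet> a)) * complex_of_real (exp (- (s\<^sup>2 * (norm \<xi>)\<^sup>2) / 2))"
proof -
  have "fourier (\<lambda>x. complex_of_real (gauss s (x - a))) \<xi> =
    (LINT x|lborel. \<bar>s\<bar> ^ DIM('a) *\<^sub>R (exp (- \<i> * complex_of_real (\<xi> \<bullet> (a + s *\<^sub>R x))) * complex_of_real (gauss s (a + s *\<^sub>R x - a))))"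
    unfolding fourier_def using s by (intro integral_lborel_affine) measurable
  also have "\<dots> = (LINT x|lborel. exp (- \<i> * complex_of_real (\<xi> \<bullet> a)) *
      (exp (- \<i> * complex_of_real ((s *\<^sub>R \<xi>) \<bullet> x)) * complex_of_real (gauss 1 x)))"
  proof (intro Bochner_Integration.integral_cong refl)
    fix x
    have "exp (- \<i> * complex_of_real (\<xi> \<bullet> (a + s *\<^sub>R x))) =
        exp (- \<i> * complex_of_real (\<xi> \<bullet> a)) * exp (- \<i> * complex_of_real ((s *\<^sub>R \<xi>) \<bullet> x))"
      unfolding exp_add[symmetric] by (simp add: inner_add_right algebra_simps)
    then show "\<bar>s\<bar> ^ DIM('a) *\<^sub>R (exp (- \<i> * complex_of_real (\<xi> \<bullet> (a + s *\<^sub>R x))) * complex_of_real (gauss s (a + s *\<^sub>R x - a)))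
      = exp (- \<i> * complex_of_real (\<xi> \<bullet> a)) * (exp (- \<i> * complex_of_real ((s *\<^sub>R \<xi>) \<bullet> x)) * complex_of_real (gauss 1 x))"
      using s by (simp add: gauss_scale[OF s, symmetric] scaleR_conv_of_real mult_ac)
  qed
  also have "\<dots> = exp (- \<i> * complex_of_real (\<xi> \<bullet> a)) * complex_of_real (exp (- (norm (s *\<^sub>R \<xi>))\<^sup>2 / 2))"
    by (simp only: integral_mult_right_zero fourier_gauss_1(2))
  finally show ?thesis by (simp add: power_mult_distrib)
qed

section \<open>Overlaps of translated sets\<close>

lemma integrable_lborel_pair_bound:
  fixes F :: "'a::euclidean_space \<times> 'b::euclidean_space \<Rightarrow> 'c::{banach, second_countable_topology}"
  assumes F: "F \<in> borel_measurable borel"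
    and u: "integrable lborel (u :: 'a \<Rightarrow> real)" and v: "integrable lborel (v :: 'b \<Rightarrow> real)"
    and le: "\<And>x y. norm (F (x, y)) \<le> u x * v y"
  shows "integrable (lborel \<Otimes>\<^sub>M lborel) F"
proof (rule integrableI_bounded)
  show F': "F \<in> borel_measurable (lborel \<Otimes>\<^sub>M lborel)" using F by (simp add: lborel_prod)
  have "(\<lambda>z. ennreal (norm (F z))) \<in> borel_measurable (lborel \<Otimes>\<^sub>M lborel)"
    unfolding lborel_prod using F by measurable
  then have "(\<integral>\<^sup>+z. ennreal (norm (F z)) \<partial>(lborel \<Otimes>\<^sub>M lborel)) =
      (\<integral>\<^sup>+x. \<integral>\<^sup>+y. ennreal (norm (F (x, y))) \<partial>lborel \<partial>lborel)"
    by (rule lborel.nn_integral_fst[symmetric])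
  also have "\<dots> \<le> (\<integral>\<^sup>+x. \<integral>\<^sup>+y. ennreal (norm (u x)) * ennreal (norm (v y)) \<partial>lborel \<partial>lborel)"
  proof (intro nn_integral_mono)
    fix x y
    have "norm (F (x, y)) \<le> norm (u x) * norm (v y)"
      using le[of x y] abs_ge_self[of "u x * v y"] by (simp add: abs_mult)
    then show "ennreal (norm (F (x, y))) \<le> ennreal (norm (u x)) * ennreal (norm (v y))"
      by (simp add: ennreal_mult[symmetric] del: real_norm_def)
  qed
  also have "\<dots> = (\<integral>\<^sup>+x. ennreal (norm (u x)) \<partial>lborel) * (\<integral>\<^sup>+y. ennreal (norm (v y)) \<partial>lborel)"
    using u v by (simp add: nn_integral_cmult nn_integral_multc)
  also have "\<dots> < \<infinity>"
    using u v unfolding integrable_iff_bounded by (simp add: ennreal_mult_less_top)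
  finally show "(\<integral>\<^sup>+z. ennreal (norm (F z)) \<partial>(lborel \<Otimes>\<^sub>M lborel)) < \<infinity>" .
qed

lemma integrable_indicator_bounded:
  fixes A :: "'a::euclidean_space set"
  assumes "A \<in> sets borel" "bounded A"
  shows "integrable lborel (indicator A :: 'a \<Rightarrow> real)"
  using assms emeasure_bounded_finite[of A] by simp

lemma lborel_integral_translate:
  fixes g :: "'a::euclidean_space \<Rightarrow> 'b::{banach, second_countable_topology}"
  assumes "g \<in> borel_measurable borel"
  shows "(LINT x|lborel. g (a + x)) = (LINT x|lborel. g x)"
  using integral_lborel_affine[OF assms, of 1 a] by simp

lemma lborel_integrable_translate:
  fixes g :: "'a::euclidean_space \<Rightarrow> 'b::{banach, second_countable_topology}"
  assumes g: "integrable lborel g"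
  shows "integrable lborel (\<lambda>x. g (a + x))"
proof -
  have [measurable]: "g \<in> borel_measurable borel" using g by auto
  have "integrable (distr lborel borel ((+) a)) g" using g by (simp add: lborel_distr_plus)
  then show ?thesis by (simp add: integrable_distr_eq)
qed

text \<open>As \<open>U\<close> and its translates have the same volume, the \<open>L\<^sup>1\<close> distance is twice the integral of the
  positive part of \<open>1\<^sub>U(q) - 1\<^sub>U(y\<^sub>n+q)\<close>. This positive part is dominated by \<open>1\<^sub>U\<close> and tends to \<open>0\<close>
  pointwise because \<open>U\<close> is open.\<close>

lemma open_translate_L1_tendsto:
  fixes U :: "'a::euclidean_space set"
  assumes U: "open U" "emeasure lborel U < \<infinity>" and y: "y \<longlonglongrightarrow> 0"
  shows "(\<lambda>n. LINT q|lborel. \<bar>indicator U (y n + q) - indicator U q :: real\<bar>) \<longlonglongrightarrow> 0"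
proof -
  let ?i = "indicator U :: 'a \<Rightarrow> real"
  have [measurable]: "U \<in> sets borel" using U by simp
  have int: "integrable lborel ?i" using U by simp
  have int': "integrable lborel (\<lambda>q. ?i (a + q))" for a by (rule lborel_integrable_translate[OF int])
  have eq: "(LINT q|lborel. \<bar>?i (a + q) - ?i q\<bar>) = 2 * (LINT q|lborel. max 0 (?i q - ?i (a + q)))" for a
  proof -
    have "(LINT q|lborel. \<bar>?i (a + q) - ?i q\<bar>) =
      (LINT q|lborel. 2 * max 0 (?i q - ?i (a + q)) - (?i q - ?i (a + q)))"
      by (intro Bochner_Integration.integral_cong) (auto split: split_indicator)
    also have "\<dots> = 2 * (LINT q|lborel. max 0 (?i q - ?i (a + q))) - ((LINT q|lborel. ?i q) - (LINT q|lborel. ?i (a + q)))"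
      using int int' by (simp add: integrable_max)
    also have "(LINT q|lborel. ?i (a + q)) = (LINT q|lborel. ?i q)"
      by (rule lborel_integral_translate) measurable
    finally show ?thesis by simp
  qed
  have "(\<lambda>n. LINT q|lborel. max 0 (?i q - ?i (y n + q))) \<longlonglongrightarrow> (LINT q|(lborel :: 'a measure). (0 :: real))"
  proof (rule integral_dominated_convergence[where w="?i"])
    show "AE q in lborel. (\<lambda>n. max 0 (?i q - ?i (y n + q))) \<longlonglongrightarrow> 0"
    proof (rule AE_I2)
      fix q :: 'a
      show "(\<lambda>n. max 0 (?i q - ?i (y n + q))) \<longlonglongrightarrow> 0"
      proof (cases "q \<in> U")
        case True
        have "(\<lambda>n. y n + q) \<longlonglongrightarrow> 0 + q" by (intro tendsto_intros y)
        then have "\<forall>\<^sub>F n in sequentially. y n + q \<in> U"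
          using topological_tendstoD U(1) True by fastforce
        then have "\<forall>\<^sub>F n in sequentially. max 0 (?i q - ?i (y n + q)) = 0"
          by eventually_elim (use True in auto)
        then show ?thesis by (rule tendsto_eventually)
      qed auto
    qed
  qed (use int in \<open>auto simp: indicator_def\<close>)
  then show ?thesis unfolding eq using tendsto_mult_right_zero by auto
qed

text \<open>By outer regularity \<open>A\<close> lies in an open set \<open>U\<close> of almost the same volume, and replacing \<open>A\<close> by \<open>U\<close>
  in both terms costs at most twice the volume of \<open>U - A\<close>.\<close>

lemma translate_L1_tendsto:
  fixes A :: "'a::euclidean_space set"
  assumes A: "A \<in> sets borel" "bounded A" and y: "y \<longlonglongrightarrow> 0"
  shows "(\<lambda>n. LINT q|lborel. \<bar>indicator A (y n + q) - indicator A q :: real\<bar>) \<longlonglongrightarrow> 0"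
proof (rule LIMSEQ_I)
  fix r :: real assume r: "0 < r"
  define e where "e = r / 4"
  have e: "0 < e" using r by (simp add: e_def)
  obtain U where U: "open U" "A \<subseteq> U" "emeasure lborel (U - A) < e"
    using outer_regular_lborel[OF A(1) e] .
  have [measurable]: "A \<in> sets borel" "U \<in> sets borel" using A U by auto
  have "emeasure lborel U \<le> emeasure lborel A + emeasure lborel (U - A)"
    using U(2) emeasure_subadditive[of A lborel "U - A"] by (simp add: Un_absorb1)
  also have "\<dots> < \<infinity>" using U(3) emeasure_bounded_finite[OF A(2)] by (simp add: less_top order.strict_trans[OF U(3)])
  finally have Ufin: "emeasure lborel U < \<infinity>" .
  let ?a = "indicator A :: 'a \<Rightarrow> real" and ?u = "indicator U :: 'a \<Rightarrow> real" and ?d = "indicator (U - A) :: 'a \<Rightarrow> real"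
  have inta: "integrable lborel ?a" by (rule integrable_indicator_bounded[OF A])
  have intu: "integrable lborel ?u" using Ufin by simp
  have "emeasure lborel (U - A) < \<infinity>" using U(3) by (simp add: order.strict_trans[OF U(3)])
  then have intd: "integrable lborel ?d" by simp
  have d: "(LINT q|lborel. ?d q) < e"
  proof -
    have "(LINT q|lborel. ?d q) = measure lborel (U - A)" by simp
    also have "\<dots> < e" using U(3) e by (simp add: measure_def enn2real_less_iff order.strict_trans[OF U(3)])
    finally show ?thesis .
  qed
  note T = lborel_integrable_translate[OF inta] lborel_integrable_translate[OF intu] lborel_integrable_translate[OF intd]
  have le: "(LINT q|lborel. \<bar>?a (b + q) - ?a q\<bar>) \<le> 2 * (LINT q|lborel. ?d q) + (LINT q|lborel. \<bar>?u (b + q) - ?u q\<bar>)" for b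
  proof -
    have "(LINT q|lborel. \<bar>?a (b + q) - ?a q\<bar>) \<le> (LINT q|lborel. ?d (b + q) + ?d q + \<bar>?u (b + q) - ?u q\<bar>)"
      using U(2) by (intro integral_mono integrable_abs Bochner_Integration.integrable_diff
          Bochner_Integration.integrable_add inta intu intd T) (auto split: split_indicator)
    also have "\<dots> = (LINT q|lborel. ?d (b + q)) + (LINT q|lborel. ?d q) + (LINT q|lborel. \<bar>?u (b + q) - ?u q\<bar>)"
      using intu intd T by simp
    also have "(LINT q|lborel. ?d (b + q)) = (LINT q|lborel. ?d q)"
      by (rule lborel_integral_translate) measurable
    finally show ?thesis by simp
  qed
  obtain N where N: "\<And>n. n \<ge> N \<Longrightarrow> norm ((LINT q|lborel. \<bar>?u (y n + q) - ?u q\<bar>) - 0) < e"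
    using LIMSEQ_D[OF open_translate_L1_tendsto[OF U(1) Ufin y] e] by blast
  show "\<exists>N. \<forall>n\<ge>N. norm ((LINT q|lborel. \<bar>?a (y n + q) - ?a q\<bar>) - 0) < r"
  proof (intro exI[of _ N] allI impI)
    fix n assume "N \<le> n"
    have "0 \<le> (LINT q|lborel. \<bar>?a (y n + q) - ?a q\<bar>)" by (rule integral_nonneg_AE) auto
    then show "norm ((LINT q|lborel. \<bar>?a (y n + q) - ?a q\<bar>) - 0) < r"
      using le[of "y n"] d N[OF \<open>N \<le> n\<close>] r by (simp add: e_def)
  qed
qed

text \<open>The volume of \<open>{q \<in> B. x + q \<in> A}\<close>: the weight with which \<open>f(x)\<close> enters the integral of \<open>f(p-q)\<close>
  over \<open>A \<times> B\<close>.\<close>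

definition overlap :: "'a::euclidean_space set \<Rightarrow> 'a set \<Rightarrow> 'a \<Rightarrow> real" where
  "overlap A B x = (LINT q|lborel. indicator B q * indicator A (x + q))"

lemma overlap_integrable:
  assumes "A \<in> sets borel" "B \<in> sets borel" "bounded B"
  shows "integrable lborel (\<lambda>q. indicator B q * indicator A (x + q) :: real)"
proof (rule Bochner_Integration.integrable_bound[OF integrable_indicator_bounded[OF assms(2,3)]])
  show "(\<lambda>q. indicator B q * indicator A (x + q) :: real) \<in> borel_measurable lborel"
    using assms by measurable
qed (auto simp: indicator_def)

lemma overlap_tendsto:
  fixes A :: "'a::euclidean_space set"
  assumes A: "A \<in> sets borel" "bounded A" and B: "B \<in> sets borel" "bounded B" and y: "y \<longlonglongrightarrow> 0"
  shows "(\<lambda>n. overlap A B (x + y n)) \<longlonglongrightarrow> overlap A B x"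
proof -
  have [measurable]: "A \<in> sets borel" "B \<in> sets borel" by fact+
  have inta: "integrable lborel (indicator A :: 'a \<Rightarrow> real)" by (rule integrable_indicator_bounded[OF A])
  have "(\<lambda>n. overlap A B (x + y n) - overlap A B x) \<longlonglongrightarrow> 0"
  proof (rule Lim_null_comparison[OF _ translate_L1_tendsto[OF A y]], rule always_eventually, rule allI)
    fix n
    have "norm (overlap A B (x + y n) - overlap A B x) =
      norm (LINT q|lborel. indicator B q * indicator A (x + y n + q) - indicator B q * indicator A (x + q) :: real)"
      unfolding overlap_def by (simp add: overlap_integrable[OF A(1) B])
    also have "\<dots> \<le> (LINT q|lborel. norm (indicator B q * indicator A (x + y n + q) - indicator B q * indicator A (x + q) :: real))"
      by (rule integral_norm_bound)
    also have "\<dots> \<le> (LINT q|lborel. \<bar>indicator A (x + y n + q) - indicator A (x + q) :: real\<bar>)"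
      using lborel_integrable_translate[OF inta]
      by (intro integral_mono integrable_norm Bochner_Integration.integrable_diff overlap_integrable A(1) B integrable_abs)
         (auto simp: indicator_def)
    also have "\<dots> = (LINT q|lborel. (\<lambda>q. \<bar>indicator A (y n + q) - indicator A q :: real\<bar>) (x + q))"
      by (simp add: add_ac)
    also have "\<dots> = (LINT q|lborel. \<bar>indicator A (y n + q) - indicator A q :: real\<bar>)"
      by (rule lborel_integral_translate) measurable
    finally show "norm (overlap A B (x + y n) - overlap A B x) \<le> \<dots>" .
  qed
  then show ?thesis by (simp add: LIM_zero_iff)
qed

lemma overlap_nonneg: "0 \<le> overlap A B x"
  unfolding overlap_def by (rule integral_nonneg_AE) auto

lemma overlap_le:
  assumes "A \<in> sets borel" "B \<in> sets borel" "bounded B"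
  shows "overlap A B x \<le> measure lborel B"
proof -
  have "overlap A B x \<le> (LINT q|lborel. indicator B q)"
    unfolding overlap_def
    by (intro integral_mono overlap_integrable assms integrable_indicator_bounded) (auto simp: indicator_def)
  then show ?thesis by simp
qed

lemma overlap_measurable [measurable]:
  assumes [measurable]: "A \<in> sets borel" "B \<in> sets borel"
  shows "overlap A B \<in> borel_measurable borel"
  unfolding overlap_def by measurable

lemma overlap_eq_0:
  assumes "\<And>a. a \<in> A \<Longrightarrow> norm a \<le> R" "\<And>b. b \<in> B \<Longrightarrow> norm b \<le> R" "2 * R < norm x"
  shows "overlap A B x = 0"
proof -
  have "indicator B q * indicator A (x + q) = (0 :: real)" for q
  proof (rule ccontr)
    assume "indicator B q * indicator A (x + q) \<noteq> (0 :: real)"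
    then have "q \<in> B" "x + q \<in> A" by (auto simp: indicator_def split: if_splits)
    then have "norm (x + q) + norm q \<le> 2 * R" using assms(1)[of "x + q"] assms(2)[of q] by simp
    moreover have "norm x \<le> norm (x + q) + norm q" using norm_triangle_ineq4[of "x + q" q] by simp
    ultimately show False using assms(3) by simp
  qed
  then have "(\<lambda>q. indicator B q * indicator A (x + q)) = (\<lambda>_. 0 :: real)" by blast
  then show ?thesis by (simp only: overlap_def) simp
qed

text \<open>Near \<open>0\<close> the density of the spectral measure is integrable because of \<open>\<beta> > 0\<close>; far out the
  exponential is below a multiple of \<open>|\<xi>|\<^bsup>-2d\<^esup>\<close>.\<close>

lemma integrable_gaussian_riesz:
  assumes \<beta>: "0 < \<beta>" "\<beta> < real DIM('a)" and c: "0 < c"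
  shows "integrable lborel (\<lambda>\<xi>::'a::euclidean_space. norm \<xi> powr (- real DIM('a) + \<beta>) * exp (- (c * (norm \<xi>)\<^sup>2)))"
proof (rule integrableI_bounded)
  let ?d = "DIM('a)"
  define C where "C = (real ?d / c) ^ ?d"
  have C: "C \<ge> 0" using c by (simp add: C_def)
  have le: "norm (norm \<xi> powr (- real ?d + \<beta>) * exp (- (c * (norm \<xi>)\<^sup>2))) \<le>
     norm \<xi> powr (- real ?d + \<beta>) * indicator (cball 0 1) \<xi> + C * (norm \<xi> powr (- real ?d + \<beta> - 2 * real ?d) * indicator {\<xi>. 1 \<le> norm \<xi>} \<xi>)"
    for \<xi> :: 'a
  proof (cases "norm \<xi> \<le> 1")
    case True
    have "exp (- (c * (norm \<xi>)\<^sup>2)) \<le> 1" using c by simp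
    then have "norm \<xi> powr (- real ?d + \<beta>) * exp (- (c * (norm \<xi>)\<^sup>2)) \<le> norm \<xi> powr (- real ?d + \<beta>) * 1"
      by (intro mult_left_mono) auto
    then show ?thesis using True C by (simp add: abs_mult add_increasing2)
  next
    case False
    define x where "x = c * (norm \<xi>)\<^sup>2"
    have n: "0 < norm \<xi>" using False by linarith
    have x: "0 < x" unfolding x_def using c n by (intro mult_pos_pos zero_less_power)
    have "(x / real ?d) ^ ?d \<le> (1 + x / real ?d) ^ ?d" using x by (intro power_mono) auto
    also have "\<dots> \<le> exp x" using x by (intro exp_ge_one_plus_x_over_n_power_n) auto
    finally have "exp (- x) \<le> 1 / (x / real ?d) ^ ?d"
      using x by (simp add: exp_minus field_simps)
    also have "\<dots> = C * (1 / ((norm \<xi>)\<^sup>2) ^ ?d)"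
      by (simp add: C_def x_def power_divide power_mult_distrib)
    also have "1 / ((norm \<xi>)\<^sup>2) ^ ?d = norm \<xi> powr (- 2 * real ?d)"
    proof -
      have "norm \<xi> powr (- real (2 * ?d)) = inverse (norm \<xi> ^ (2 * ?d))"
        using powr_realpow[OF n, of "2 * ?d"] by (simp only: powr_minus)
      then show ?thesis by (simp add: power_mult inverse_eq_divide)
    qed
    finally have "norm \<xi> powr (- real ?d + \<beta>) * exp (- x) \<le> norm \<xi> powr (- real ?d + \<beta>) * (C * norm \<xi> powr (- 2 * real ?d))"
      by (intro mult_left_mono) auto
    also have "\<dots> = C * norm \<xi> powr (- real ?d + \<beta> - 2 * real ?d)"
      by (simp add: powr_add[symmetric] mult_ac)
    finally show ?thesis using False by (simp add: abs_mult x_def)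
  qed
  have "(\<integral>\<^sup>+\<xi>. ennreal (norm (norm \<xi> powr (- real ?d + \<beta>) * exp (- (c * (norm \<xi>)\<^sup>2)))) \<partial>(lborel :: 'a measure)) \<le>
    (\<integral>\<^sup>+\<xi>. ennreal (norm \<xi> powr (- real ?d + \<beta>)) * indicator (cball 0 1) \<xi> +
       ennreal C * (ennreal (norm \<xi> powr (- real ?d + \<beta> - 2 * real ?d)) * indicator {\<xi>. 1 \<le> norm \<xi>} \<xi>) \<partial>(lborel :: 'a measure))"
  proof (rule nn_integral_mono)
    fix \<xi> :: 'a
    have "ennreal (norm (norm \<xi> powr (- real ?d + \<beta>) * exp (- (c * (norm \<xi>)\<^sup>2)))) \<le>
     ennreal (norm \<xi> powr (- real ?d + \<beta>) * indicator (cball 0 1) \<xi> + C * (norm \<xi> powr (- real ?d + \<beta> - 2 * real ?d) * indicator {\<xi>. 1 \<le> norm \<xi>} \<xi>))"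
      by (rule ennreal_leI[OF le])
    then show "ennreal (norm (norm \<xi> powr (- real ?d + \<beta>) * exp (- (c * (norm \<xi>)\<^sup>2)))) \<le>
      ennreal (norm \<xi> powr (- real ?d + \<beta>)) * indicator (cball 0 1) \<xi> +
       ennreal C * (ennreal (norm \<xi> powr (- real ?d + \<beta> - 2 * real ?d)) * indicator {\<xi>. 1 \<le> norm \<xi>} \<xi>)"
      using C by (auto simp: indicator_def ennreal_mult split: if_splits)
  qed
  also have "\<dots> = (\<integral>\<^sup>+\<xi>. ennreal (norm \<xi> powr (- real ?d + \<beta>)) * indicator (cball 0 1) \<xi> \<partial>(lborel :: 'a measure)) +
       ennreal C * (\<integral>\<^sup>+\<xi>. ennreal (norm \<xi> powr (- real ?d + \<beta> - 2 * real ?d)) * indicator {\<xi>. 1 \<le> norm \<xi>} \<xi> \<partial>(lborel :: 'a measure))"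
  proof -
    have [measurable]: "cball (0 :: 'a) 1 \<in> sets borel" "{\<xi> :: 'a. 1 \<le> norm \<xi>} \<in> sets borel" by auto
    show ?thesis by (subst nn_integral_add) (auto simp: nn_integral_cmult)
  qed
  also have "\<dots> < \<infinity>"
  proof -
    have 1: "- real ?d < - real ?d + \<beta>" "- real ?d + \<beta> - 2 * real ?d < - real ?d" using \<beta> by auto
    show ?thesis
      unfolding nn_integral_norm_powr_cball[OF 1(1) zero_le_one] nn_integral_norm_powr_outside[OF 1(2) zero_less_one]
      by (simp add: ennreal_mult_less_top)
  qed
  finally show "(\<integral>\<^sup>+\<xi>. ennreal (norm (norm \<xi> powr (- real ?d + \<beta>) * exp (- (c * (norm \<xi>)\<^sup>2)))) \<partial>(lborel :: 'a measure)) < \<infinity>" .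
qed measurable

section \<open>The covariance of the noise in terms of the spectral measure\<close>

lemma gauss_minus: "gauss s (- x) = gauss s x"
  by (simp add: gauss_def)

lemma integrable_gauss:
  assumes s: "0 < s" shows "integrable lborel (gauss s :: 'a::euclidean_space \<Rightarrow> real)"
proof (rule integrableI_bounded)
  have "(\<integral>\<^sup>+x. ennreal (norm (gauss s (x :: 'a))) \<partial>lborel) =
     ennreal (\<bar>s\<bar> ^ DIM('a)) * (\<integral>\<^sup>+x. ennreal (norm (gauss s (0 + s *\<^sub>R (x :: 'a)))) \<partial>lborel)"
    using s by (intro nn_integral_lborel_affine) auto
  also have "\<dots> = (\<integral>\<^sup>+x. ennreal (norm (gauss 1 (x :: 'a))) \<partial>lborel)"
    using s by (subst nn_integral_cmult[symmetric])
      (auto intro!: nn_integral_cong simp: gauss_scale[OF s, symmetric] gauss_nonneg ennreal_mult[symmetric])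
  also have "\<dots> < \<infinity>"
    using integrable_gauss_1 unfolding integrable_iff_bounded by simp
  finally show "(\<integral>\<^sup>+x. ennreal (norm (gauss s (x :: 'a))) \<partial>lborel) < \<infinity>" .
qed measurable

lemma gauss_shift_le:
  fixes x a :: "'a::euclidean_space"
  assumes s: "0 < s" and a: "norm a \<le> R"
  shows "gauss s (x - a) \<le> (exp (R\<^sup>2 / (2 * s\<^sup>2)) * sqrt 2 ^ DIM('a)) * gauss (sqrt 2 * s) x"
proof -
  have "(norm a)\<^sup>2 \<le> R\<^sup>2" using a by (intro power_mono) auto
  then have "(norm x)\<^sup>2 \<le> 2 * (norm (x - a))\<^sup>2 + 2 * R\<^sup>2" using norm_sq_le_shift[of x a] by simp
  then have "- (norm (x - a))\<^sup>2 \<le> R\<^sup>2 - (norm x)\<^sup>2 / 2" by simp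
  then have "- (norm (x - a))\<^sup>2 / (2 * s\<^sup>2) \<le> (R\<^sup>2 - (norm x)\<^sup>2 / 2) / (2 * s\<^sup>2)"
    by (intro divide_right_mono) auto
  also have "\<dots> = R\<^sup>2 / (2 * s\<^sup>2) + - (norm x)\<^sup>2 / (2 * (sqrt 2 * s)\<^sup>2)"
    by (simp add: diff_divide_distrib power_mult_distrib)
  finally have "exp (- (norm (x - a))\<^sup>2 / (2 * s\<^sup>2)) \<le> exp (R\<^sup>2 / (2 * s\<^sup>2)) * exp (- (norm x)\<^sup>2 / (2 * (sqrt 2 * s)\<^sup>2))"
    unfolding exp_add[symmetric] by simp
  then show ?thesis
    using s by (simp add: gauss_def power_mult_distrib field_simps)
qed

text \<open>The density of the spectral measure, damped by the Fourier transform of a Gaussian of width \<open>s\<close>.\<close>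

definition riesz_weight :: "real \<Rightarrow> real \<Rightarrow> 'a::euclidean_space \<Rightarrow> real" where
  "riesz_weight \<beta> s \<xi> = norm \<xi> powr (- real DIM('a) + \<beta>) * exp (- (s\<^sup>2 * (norm \<xi>)\<^sup>2) / 2)"

lemma riesz_weight_measurable [measurable]: "riesz_weight \<beta> s \<in> borel_measurable borel"
  unfolding riesz_weight_def by measurable

lemma integrable_riesz_weight:
  assumes "0 < \<beta>" "\<beta> < real DIM('a)" "0 < s"
  shows "integrable lborel (riesz_weight \<beta> s :: 'a::euclidean_space \<Rightarrow> real)"
  using integrable_gaussian_riesz[where 'a='a, OF assms(1,2), of "s\<^sup>2 / 2"] assms(3)
  by (simp add: riesz_weight_def[abs_def])

text \<open>The defining property of \<open>f\<close>, applied to a shifted Gaussian. Everything used about \<open>f\<close>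
  later is drawn from these identities, apart from its measurability.\<close>

lemma riesz_kernel_gauss:
  fixes f :: "'a::euclidean_space \<Rightarrow> real"
  assumes f: "riesz_kernel \<beta> f" and s: "0 < s"
  shows "integrable lborel (\<lambda>x. f x * gauss s (x - a))"
    and "complex_of_real (LINT x|lborel. f x * gauss s (x - a)) =
      (LINT \<xi>|lborel. complex_of_real (riesz_weight \<beta> s \<xi>) * exp (- \<i> * complex_of_real (\<xi> \<bullet> a)))"
proof -
  from f schwartz_gauss_shift[OF s, of a]
  have 1: "integrable lborel (\<lambda>x. complex_of_real (f x) * complex_of_real (gauss s (x - a)))"
   and 2: "(LINT x|lborel. complex_of_real (f x) * complex_of_real (gauss s (x - a))) =
      (LINT \<xi>|riesz_measure \<beta>. fourier (\<lambda>x. complex_of_real (gauss s (x - a))) \<xi>)"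
    by (auto simp: riesz_kernel_def)
  have "integrable lborel (\<lambda>x. complex_of_real (f x * gauss s (x - a)))" using 1 by simp
  then show "integrable lborel (\<lambda>x. f x * gauss s (x - a))" by (simp only: complex_of_real_integrable_eq)
  have "complex_of_real (LINT x|lborel. f x * gauss s (x - a)) =
    (LINT \<xi>|riesz_measure \<beta>. exp (- \<i> * complex_of_real (\<xi> \<bullet> a)) * complex_of_real (exp (- (s\<^sup>2 * (norm \<xi>)\<^sup>2) / 2)))"
    using 2 by (simp add: fourier_gauss_shift[OF s] flip: integral_complex_of_real)
  also have "\<dots> = (LINT \<xi>|lborel. (norm \<xi> powr (- real DIM('a) + \<beta>)) *\<^sub>R
      (exp (- \<i> * complex_of_real (\<xi> \<bullet> a)) * complex_of_real (exp (- (s\<^sup>2 * (norm \<xi>)\<^sup>2) / 2))))"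
    unfolding riesz_measure_def by (subst integral_density) auto
  also have "\<dots> = (LINT \<xi>|lborel. complex_of_real (riesz_weight \<beta> s \<xi>) * exp (- \<i> * complex_of_real (\<xi> \<bullet> a)))"
    by (intro Bochner_Integration.integral_cong refl) (simp add: riesz_weight_def scaleR_conv_of_real mult_ac)
  finally show "complex_of_real (LINT x|lborel. f x * gauss s (x - a)) = \<dots>" .
qed

lemma indicator_fourier_measurable [measurable]:
  assumes [measurable]: "A \<in> sets borel"
  shows "indicator_fourier A \<in> borel_measurable borel"
  unfolding indicator_fourier_def fourier_def by measurable

text \<open>The overlap convolved with a Gaussian of width \<open>s\<close>, after rescaling the Gaussian to width \<open>1\<close>.\<close>

definition smoothed_overlap :: "'a::euclidean_space set \<Rightarrow> 'a set \<Rightarrow> real \<Rightarrow> 'a \<Rightarrow> real" where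
  "smoothed_overlap A B s x = (LINT z|lborel. gauss 1 z * overlap A B (x + s *\<^sub>R z))"

lemma smoothed_overlap_measurable [measurable]:
  assumes [measurable]: "A \<in> sets borel" "B \<in> sets borel"
  shows "smoothed_overlap A B s \<in> borel_measurable borel"
  unfolding smoothed_overlap_def by measurable

lemma lborel_integral_pair_product:
  fixes g :: "'a::euclidean_space \<Rightarrow> complex" and h :: "'a \<Rightarrow> complex"
  assumes g: "integrable lborel g" and h: "integrable lborel h"
  shows "(LINT x|lborel. g (fst x) * h (snd x)) = (LINT p|lborel. g p) * (LINT q|lborel. h q)"
proof -
  have [measurable]: "g \<in> borel_measurable borel" "h \<in> borel_measurable borel" using g h by auto
  have "integrable (lborel \<Otimes>\<^sub>M lborel) (\<lambda>x. g (fst x) * h (snd x))"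
    by (rule integrable_lborel_pair_bound[where u="\<lambda>x. norm (g x)" and v="\<lambda>x. norm (h x)"])
       (use g h in \<open>auto simp: norm_mult borel_prod[symmetric]\<close>)
  then have "(LINT p|lborel. LINT q|lborel. g (fst (p, q)) * h (snd (p, q))) = (LINT x|(lborel \<Otimes>\<^sub>M lborel). g (fst x) * h (snd x))"
    by (rule lborel_pair.integral_fst')
  then show ?thesis by (simp add: lborel_prod)
qed

text \<open>The identity for \<open>f\<close> and the Gaussian centred at \<open>p-q\<close> is integrated over \<open>(p,q)\<close> in \<open>A \<times> B\<close>. On
  the side of \<open>f\<close> this averages the Gaussians to the smoothed overlap; on the frequency side the
  phases \<open>e\<^bsup>-i\<xi>(p-q)\<^esup>\<close> integrate to the product of the two Fourier transforms.\<close>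

lemma regularized_covariance:
  fixes f :: "'a::euclidean_space \<Rightarrow> real"
  assumes f: "riesz_kernel \<beta> f" and \<beta>: "0 < \<beta>" "\<beta> < real DIM('a)" and s: "0 < s"
    and A: "A \<in> sets borel" "bounded A" and B: "B \<in> sets borel" "bounded B"
  shows "complex_of_real (LINT x|lborel. f x * smoothed_overlap A B s x) =
    (LINT \<xi>|lborel. complex_of_real (riesz_weight \<beta> s \<xi>) * (indicator_fourier A \<xi> * cnj (indicator_fourier B \<xi>)))"
proof -
  have [measurable]: "A \<in> sets borel" "B \<in> sets borel" "f \<in> borel_measurable borel"
    using A B f by (auto simp: riesz_kernel_def)
  obtain R1 R2 where R1: "\<And>x. x \<in> A \<Longrightarrow> norm x \<le> R1" and R2: "\<And>x. x \<in> B \<Longrightarrow> norm x \<le> R2"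
    using A(2) B(2) by (meson bounded_iff)
  define K where "K = exp ((R1 + R2)\<^sup>2 / (2 * s\<^sup>2)) * sqrt 2 ^ DIM('a)"
  define v where "v x = indicator A (fst x) * (indicator B (snd x) :: real)" for x :: "'a \<times> 'a"
  have vm[measurable]: "v \<in> borel_measurable borel"
    unfolding v_def borel_prod[symmetric] by measurable
  have v: "integrable lborel v"
    unfolding lborel_prod[symmetric]
    by (rule integrable_lborel_pair_bound[OF vm integrable_indicator_bounded[OF A] integrable_indicator_bounded[OF B]])
       (auto simp: v_def)
  define G where "G z = f (fst z) * gauss s (fst z - (fst (snd z) - snd (snd z))) * v (snd z)" for z :: "'a \<times> ('a \<times> 'a)"
  have Gm[measurable]: "G \<in> borel_measurable borel"
    unfolding G_def v_def borel_prod[symmetric] by measurable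
  have u: "integrable lborel (\<lambda>x. K * \<bar>f x * gauss (sqrt 2 * s) x\<bar>)"
    using riesz_kernel_gauss(1)[OF f, of "sqrt 2 * s" 0] s by (intro integrable_mult_right integrable_abs) simp
  have Gi: "integrable (lborel \<Otimes>\<^sub>M lborel) G"
  proof (rule integrable_lborel_pair_bound[OF Gm u v])
    fix x :: 'a and y :: "'a \<times> 'a"
    show "norm (G (x, y)) \<le> K * \<bar>f x * gauss (sqrt 2 * s) x\<bar> * v y"
    proof (cases "fst y \<in> A \<and> snd y \<in> B")
      case True
      have "norm (fst y - snd y) \<le> R1 + R2"
        using R1[of "fst y"] R2[of "snd y"] True norm_triangle_ineq4[of "fst y" "snd y"] by linarith
      then have "gauss s (x - (fst y - snd y)) \<le> K * gauss (sqrt 2 * s) x"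
        unfolding K_def by (rule gauss_shift_le[OF s])
      then have "\<bar>f x\<bar> * gauss s (x - (fst y - snd y)) \<le> \<bar>f x\<bar> * (K * gauss (sqrt 2 * s) x)"
        by (rule mult_left_mono) simp
      then show ?thesis using True s by (simp add: G_def v_def abs_mult gauss_nonneg mult_ac)
    qed (auto simp: G_def v_def)
  qed
  have inner: "(LINT y|lborel. G (x, y)) = f x * smoothed_overlap A B s x" for x
  proof -
    define g where "g y = gauss s (x - (fst y - snd y)) * v y" for y :: "'a \<times> 'a"
    have gm: "g \<in> borel_measurable borel" unfolding g_def v_def borel_prod[symmetric] by measurable
    have gle: "gauss s x \<le> 1 / (sqrt (2 * pi) * s) ^ DIM('a)" for x :: 'a
      using s by (auto simp: gauss_def intro!: divide_right_mono)
    have "integrable lborel g"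
    proof (rule Bochner_Integration.integrable_bound)
      show "integrable lborel (\<lambda>y. 1 / (sqrt (2 * pi) * s) ^ DIM('a) * v y)" using v by simp
      show "AE y in lborel. norm (g y) \<le> norm (1 / (sqrt (2 * pi) * s) ^ DIM('a) * v y)"
        using s mult_right_mono[OF gle] by (auto simp: g_def v_def abs_mult gauss_nonneg indicator_def)
    qed (use gm in simp)
    then have "(LINT y|lborel. g y) = (LINT q|lborel. LINT p|lborel. g (p, q))"
      using lborel_pair.integral_snd[of "\<lambda>p q. g (p, q)"] by (simp add: lborel_prod)
    also have "\<dots> = (LINT q|lborel. LINT p|lborel. indicator B q * (indicator A p * gauss s (x - (p - q))))"
      by (intro Bochner_Integration.integral_cong refl) (simp add: g_def v_def mult_ac)
    also have "\<dots> = (LINT q|lborel. LINT z|lborel. indicator B q * (indicator A (x + q + s *\<^sub>R z) * gauss 1 z))"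
    proof (rule Bochner_Integration.integral_cong, rule refl)
      fix q :: 'a
      have "(LINT p|lborel. indicator B q * (indicator A p * gauss s (x - (p - q)))) =
        (LINT z|lborel. \<bar>s\<bar> ^ DIM('a) *\<^sub>R (indicator B q * (indicator A (x + q + s *\<^sub>R z) * gauss s (x - (x + q + s *\<^sub>R z - q)))))"
        using s by (intro integral_lborel_affine) auto
      also have "\<dots> = (LINT z|lborel. indicator B q * (indicator A (x + q + s *\<^sub>R z) * gauss 1 z))"
      proof (intro Bochner_Integration.integral_cong refl)
        fix z :: 'a
        have "x - (x + q + s *\<^sub>R z - q) = - (s *\<^sub>R z)" by simp
        then have "\<bar>s\<bar> ^ DIM('a) * gauss s (x - (x + q + s *\<^sub>R z - q)) = gauss 1 z"
          using s gauss_scale[OF s, of z] by (simp add: gauss_minus)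
        then show "\<bar>s\<bar> ^ DIM('a) *\<^sub>R (indicator B q * (indicator A (x + q + s *\<^sub>R z) * gauss s (x - (x + q + s *\<^sub>R z - q)))) =
          indicator B q * (indicator A (x + q + s *\<^sub>R z) * gauss 1 z)"
          by (metis mult.left_commute real_scaleR_def)
      qed
      finally show "(LINT p|lborel. indicator B q * (indicator A p * gauss s (x - (p - q)))) = \<dots>" .
    qed
    also have "\<dots> = (LINT z|lborel. LINT q|lborel. indicator B q * (indicator A (x + q + s *\<^sub>R z) * gauss 1 z))"
    proof (rule lborel_pair.Fubini_integral)
      show "integrable (lborel \<Otimes>\<^sub>M lborel) (\<lambda>(z, q). indicator B q * (indicator A (x + q + s *\<^sub>R z) * gauss 1 z))"
        by (rule integrable_lborel_pair_bound[OF _ integrable_gauss_1 integrable_indicator_bounded[OF B]])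
           (auto simp: borel_prod[symmetric] abs_mult gauss_nonneg indicator_def)
    qed
    also have "\<dots> = (LINT z|lborel. gauss 1 z * overlap A B (x + s *\<^sub>R z))"
    proof (intro Bochner_Integration.integral_cong refl)
      fix z :: 'a
      have "(LINT q|lborel. indicator B q * (indicator A (x + q + s *\<^sub>R z) * gauss 1 z)) =
        (LINT q|lborel. gauss 1 z * (indicator B q * indicator A (x + s *\<^sub>R z + q)))"
        by (intro Bochner_Integration.integral_cong refl) (simp add: add_ac mult_ac)
      then show "(LINT q|lborel. indicator B q * (indicator A (x + q + s *\<^sub>R z) * gauss 1 z)) =
         gauss 1 z * overlap A B (x + s *\<^sub>R z)" by (simp add: overlap_def)
    qed
    finally have "(LINT y|lborel. g y) = smoothed_overlap A B s x" by (simp add: smoothed_overlap_def)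
    moreover have "(LINT y|lborel. G (x, y)) = f x * (LINT y|lborel. g y)"
      by (simp add: G_def g_def mult.assoc)
    ultimately show ?thesis by simp
  qed
  have "(LINT x|lborel. f x * smoothed_overlap A B s x) = (LINT x|lborel. LINT y|lborel. G (x, y))"
    by (simp only: inner)
  also have "\<dots> = (LINT y|lborel. LINT x|lborel. G (x, y))"
    using lborel_pair.Fubini_integral[of "\<lambda>x y. G (x, y)"] Gi by simp
  also have "\<dots> = (LINT y|lborel. v y * (LINT x|lborel. f x * gauss s (x - (fst y - snd y))))"
    by (intro Bochner_Integration.integral_cong refl) (simp add: G_def)
  finally have "complex_of_real (LINT x|lborel. f x * smoothed_overlap A B s x) =
     (LINT y|lborel. complex_of_real (v y) * complex_of_real (LINT x|lborel. f x * gauss s (x - (fst y - snd y))))"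
    by (simp flip: integral_complex_of_real)
  also have "\<dots> = (LINT y|lborel. LINT \<xi>|lborel. complex_of_real (v y) *
      (complex_of_real (riesz_weight \<beta> s \<xi>) * exp (- \<i> * complex_of_real (\<xi> \<bullet> (fst y - snd y)))))"
    by (simp only: riesz_kernel_gauss(2)[OF f s] integral_mult_right_zero)
  also have "\<dots> = (LINT \<xi>|lborel. LINT y|lborel. complex_of_real (v y) *
      (complex_of_real (riesz_weight \<beta> s \<xi>) * exp (- \<i> * complex_of_real (\<xi> \<bullet> (fst y - snd y)))))"
  proof (rule lborel_pair.Fubini_integral)
    show "integrable (lborel \<Otimes>\<^sub>M lborel) (\<lambda>(\<xi>, y). complex_of_real (v y) *
      (complex_of_real (riesz_weight \<beta> s \<xi>) * exp (- \<i> * complex_of_real (\<xi> \<bullet> (fst y - snd y)))))"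
    proof (rule integrable_lborel_pair_bound[OF _ integrable_riesz_weight[OF \<beta> s] v])
      show "norm (case (\<xi>, y) of (\<xi>, y) \<Rightarrow> complex_of_real (v y) *
        (complex_of_real (riesz_weight \<beta> s \<xi>) * exp (- \<i> * complex_of_real (\<xi> \<bullet> (fst y - snd y))))) \<le> riesz_weight \<beta> s \<xi> * v y"
        for \<xi> y by (simp add: norm_mult riesz_weight_def v_def abs_mult)
      show "(\<lambda>(\<xi>, y). complex_of_real (v y) *
      (complex_of_real (riesz_weight \<beta> s \<xi>) * exp (- \<i> * complex_of_real (\<xi> \<bullet> (fst y - snd y))))) \<in> borel_measurable borel"
        unfolding borel_prod[symmetric] v_def by measurable
    qed
  qed
  also have "\<dots> = (LINT \<xi>|lborel. complex_of_real (riesz_weight \<beta> s \<xi>) * (indicator_fourier A \<xi> * cnj (indicator_fourier B \<xi>)))"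
  proof (intro Bochner_Integration.integral_cong refl)
    fix \<xi> :: 'a
    let ?e = "\<lambda>D x. exp (- \<i> * complex_of_real (\<xi> \<bullet> x)) * indicator D x"
    have "(LINT y|lborel. complex_of_real (v y) *
      (complex_of_real (riesz_weight \<beta> s \<xi>) * exp (- \<i> * complex_of_real (\<xi> \<bullet> (fst y - snd y))))) =
      (LINT y|lborel. complex_of_real (riesz_weight \<beta> s \<xi>) * (?e A (fst y) * cnj (?e B (snd y))))"
    proof (intro Bochner_Integration.integral_cong refl)
      fix y :: "'a \<times> 'a"
      have "exp (- \<i> * complex_of_real (\<xi> \<bullet> (fst y - snd y))) =
         exp (- \<i> * complex_of_real (\<xi> \<bullet> fst y)) * cnj (exp (- \<i> * complex_of_real (\<xi> \<bullet> snd y)))"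
      proof -
        have "cnj (exp (- \<i> * complex_of_real (\<xi> \<bullet> snd y))) = exp (\<i> * complex_of_real (\<xi> \<bullet> snd y))"
          by (simp add: exp_cnj)
        then show ?thesis
          by (simp only: exp_add[symmetric]) (simp add: inner_diff_right algebra_simps)
      qed
      then show "complex_of_real (v y) *
        (complex_of_real (riesz_weight \<beta> s \<xi>) * exp (- \<i> * complex_of_real (\<xi> \<bullet> (fst y - snd y)))) =
        complex_of_real (riesz_weight \<beta> s \<xi>) * (?e A (fst y) * cnj (?e B (snd y)))"
        by (simp add: v_def indicator_def)
    qed
    also have "\<dots> = complex_of_real (riesz_weight \<beta> s \<xi>) * (LINT y|lborel. ?e A (fst y) * cnj (?e B (snd y)))"
      by (rule integral_mult_right_zero)
    also have "(LINT y|lborel. ?e A (fst y) * cnj (?e B (snd y))) = (LINT p|lborel. ?e A p) * (LINT q|lborel. cnj (?e B q))"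
      by (rule lborel_integral_pair_product)
         (use integrable_bounded_phase[OF A, of \<xi>] integrable_bounded_phase[OF B, of \<xi>, THEN integrable_cnj] in auto)
    also have "\<dots> = indicator_fourier A \<xi> * cnj (indicator_fourier B \<xi>)"
      by (simp only: indicator_fourier_def fourier_def Bochner_Integration.integral_cnj)
    finally show "(LINT y|lborel. complex_of_real (v y) *
      (complex_of_real (riesz_weight \<beta> s \<xi>) * exp (- \<i> * complex_of_real (\<xi> \<bullet> (fst y - snd y))))) =
      complex_of_real (riesz_weight \<beta> s \<xi>) * (indicator_fourier A \<xi> * cnj (indicator_fourier B \<xi>))" .
  qed
  finally show ?thesis .
qed

lemma smoothed_overlap_tendsto:
  fixes A :: "'a::euclidean_space set"
  assumes A: "A \<in> sets borel" "bounded A" and B: "B \<in> sets borel" "bounded B" and s: "s \<longlonglongrightarrow> 0"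
  shows "(\<lambda>n. smoothed_overlap A B (s n) x) \<longlonglongrightarrow> overlap A B x"
proof -
  have [measurable]: "A \<in> sets borel" "B \<in> sets borel" by fact+
  have "(\<lambda>n. LINT z|(lborel :: 'a measure). gauss 1 z * overlap A B (x + s n *\<^sub>R z)) \<longlonglongrightarrow>
     (LINT z|(lborel :: 'a measure). gauss 1 z * overlap A B x)"
  proof (rule integral_dominated_convergence[where w="\<lambda>z. gauss 1 z * measure lborel B"])
    show "AE z in (lborel :: 'a measure). (\<lambda>n. gauss 1 z * overlap A B (x + s n *\<^sub>R z)) \<longlonglongrightarrow> gauss 1 z * overlap A B x"
    proof (rule AE_I2)
      fix z :: 'a
      have "(\<lambda>n. s n *\<^sub>R z) \<longlonglongrightarrow> 0 *\<^sub>R z" by (intro tendsto_intros s)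
      then have "(\<lambda>n. overlap A B (x + s n *\<^sub>R z)) \<longlonglongrightarrow> overlap A B x"
        by (intro overlap_tendsto[OF A B]) simp
      then show "(\<lambda>n. gauss 1 z * overlap A B (x + s n *\<^sub>R z)) \<longlonglongrightarrow> gauss 1 z * overlap A B x"
        by (intro tendsto_intros)
    qed
    show "AE z in (lborel :: 'a measure). norm (gauss 1 z * overlap A B (x + s n *\<^sub>R z)) \<le> gauss 1 z * measure lborel B" for n
      using overlap_le[OF A(1) B] by (auto simp: abs_mult gauss_nonneg overlap_nonneg intro!: mult_left_mono)
  qed (auto intro: integrable_gauss_1)
  then show ?thesis unfolding smoothed_overlap_def by (simp add: integral_gauss_1)
qed

text \<open>A Gaussian majorant that is uniform in the width \<open>s\<close>, for dominated convergence against \<open>f\<close>. The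
  overlap vanishes outside a ball and is therefore below a multiple of \<open>e\<^bsup>-|x|\<^sup>2/4\<^esup>\<close>; the average over
  \<open>x + sz\<close> turns this into \<open>e\<^bsup>-|x|\<^sup>2/8\<^esup>\<close> at the price of \<open>e\<^bsup>|z|\<^sup>2/4\<^esup>\<close>, which the Gaussian in \<open>z\<close> absorbs.\<close>

lemma smoothed_overlap_bound:
  fixes A :: "'a::euclidean_space set"
  assumes A: "A \<in> sets borel" "bounded A" and B: "B \<in> sets borel" "bounded B"
  shows "\<exists>C. \<forall>s x. \<bar>s\<bar> \<le> 1 \<longrightarrow> \<bar>smoothed_overlap A B s x\<bar> \<le> C * gauss 2 x"
proof -
  have [measurable]: "A \<in> sets borel" "B \<in> sets borel" by fact+
  obtain R1 R2 where R1: "\<And>x. x \<in> A \<Longrightarrow> norm x \<le> R1" and R2: "\<And>x. x \<in> B \<Longrightarrow> norm x \<le> R2"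
    using A(2) B(2) by (meson bounded_iff)
  define R where "R = max R1 R2"
  have R: "\<And>x. x \<in> A \<Longrightarrow> norm x \<le> R" "\<And>x. x \<in> B \<Longrightarrow> norm x \<le> R"
    unfolding R_def by (rule max.coboundedI1[OF R1], assumption, rule max.coboundedI2[OF R2], assumption)
  define m where "m = measure lborel B * exp (R\<^sup>2)"
  have m: "m \<ge> 0" by (simp add: m_def)
  have ov: "overlap A B y \<le> m * exp (- (norm y)\<^sup>2 / 4)" for y
  proof (cases "2 * R < norm y")
    case True
    then show ?thesis using overlap_eq_0[of A R B y] R m by simp
  next
    case False
    then have "(norm y)\<^sup>2 \<le> (2 * R)\<^sup>2" by (intro power_mono) auto
    then have "1 \<le> exp (R\<^sup>2 + - (norm y)\<^sup>2 / 4)" by (simp add: power2_eq_square)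
    then have "measure lborel B * 1 \<le> measure lborel B * exp (R\<^sup>2 + - (norm y)\<^sup>2 / 4)"
      by (intro mult_left_mono) auto
    then show ?thesis using overlap_le[OF A(1) B, of y] unfolding m_def mult.assoc exp_add[symmetric] by linarith
  qed
  define D where "D = sqrt 2 ^ DIM('a)"
  define E where "E = (sqrt (2 * pi) * 2) ^ DIM('a)"
  have pt: "gauss 1 z * overlap A B (x + s *\<^sub>R z) \<le> (m * D * E * gauss 2 x) * gauss (sqrt 2) z" if s: "\<bar>s\<bar> \<le> 1" for s and x z :: 'a
  proof -
    have "(norm (s *\<^sub>R z))\<^sup>2 \<le> (norm z)\<^sup>2"
      using s by (intro power_mono) (auto intro: mult_left_le_one_le)
    then have "(norm x)\<^sup>2 \<le> 2 * (norm (x + s *\<^sub>R z))\<^sup>2 + 2 * (norm z)\<^sup>2"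
      using norm_sq_le_shift[of x "- (s *\<^sub>R z)"] unfolding diff_minus_eq_add norm_minus_cancel by linarith
    then have "exp (- (norm z)\<^sup>2 / 2) * exp (- (norm (x + s *\<^sub>R z))\<^sup>2 / 4) \<le> exp (- (norm x)\<^sup>2 / 8) * exp (- (norm z)\<^sup>2 / 4)"
      unfolding exp_add[symmetric] by simp
    then have "gauss 1 z * exp (- (norm (x + s *\<^sub>R z))\<^sup>2 / 4) \<le> (E * gauss 2 x) * (D * gauss (sqrt 2) z)"
      by (simp add: gauss_def D_def E_def power_mult_distrib divide_right_mono)
    then have "m * (gauss 1 z * exp (- (norm (x + s *\<^sub>R z))\<^sup>2 / 4)) \<le> m * ((E * gauss 2 x) * (D * gauss (sqrt 2) z))"
      by (rule mult_left_mono[OF _ m])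
    moreover have "gauss 1 z * overlap A B (x + s *\<^sub>R z) \<le> gauss 1 z * (m * exp (- (norm (x + s *\<^sub>R z))\<^sup>2 / 4))"
      by (intro mult_left_mono ov gauss_nonneg) simp
    ultimately show ?thesis by (simp add: mult_ac)
  qed
  show ?thesis
  proof (intro exI[of _ "m * D * E * (LINT z|lborel. gauss (sqrt 2) (z :: 'a))"] allI impI)
    fix s :: real and x :: 'a assume s: "\<bar>s\<bar> \<le> 1"
    have nn: "0 \<le> gauss 1 z * overlap A B (x + s *\<^sub>R z)" for z
      by (simp add: gauss_nonneg overlap_nonneg)
    have i: "integrable lborel (\<lambda>z. (m * D * E * gauss 2 x) * gauss (sqrt 2) (z :: 'a))"
      using integrable_gauss[where 'a='a, of "sqrt 2"] by simp
    have i': "integrable lborel (\<lambda>z. gauss 1 z * overlap A B (x + s *\<^sub>R z))"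
      by (rule Bochner_Integration.integrable_bound[OF i]) (use nn pt[OF s] order_trans[OF pt[OF s] abs_ge_self] in auto)
    have "\<bar>smoothed_overlap A B s x\<bar> = smoothed_overlap A B s x"
      unfolding smoothed_overlap_def using nn by (simp add: integral_nonneg_AE)
    also have "\<dots> \<le> (LINT z|lborel. (m * D * E * gauss 2 x) * gauss (sqrt 2) (z :: 'a))"
      unfolding smoothed_overlap_def by (rule integral_mono[OF i' i pt[OF s]])
    finally show "\<bar>smoothed_overlap A B s x\<bar> \<le> m * D * E * (LINT z|lborel. gauss (sqrt 2) (z :: 'a)) * gauss 2 x"
      by (simp add: mult_ac)
  qed
qed

text \<open>Fubini, with the substitution \<open>q = p - x\<close>.\<close>

lemma kernel_overlap_integral:
  fixes f :: "'a::euclidean_space \<Rightarrow> real"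
  assumes f: "riesz_kernel \<beta> f"
    and A: "A \<in> sets borel" "bounded A" and B: "B \<in> sets borel" "bounded B"
  shows "(LINT x|lborel. f x * overlap A B x) = (LINT p:A|lborel. LINT q:B|lborel. f (p - q))"
proof -
  have [measurable]: "A \<in> sets borel" "B \<in> sets borel" "f \<in> borel_measurable borel"
    using A B f by (auto simp: riesz_kernel_def)
  obtain R1 R2 where R1: "\<And>x. x \<in> A \<Longrightarrow> norm x \<le> R1" and R2: "\<And>x. x \<in> B \<Longrightarrow> norm x \<le> R2"
    using A(2) B(2) by (meson bounded_iff)
  define R where "R = R1 + R2"
  have ov: "overlap A B x = (LINT p|lborel. indicator A p * indicator B (p - x))" for x
  proof -
    have "overlap A B x = (LINT p|lborel. (\<lambda>q. indicator B q * indicator A (x + q)) (- x + p))"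
      unfolding overlap_def by (rule lborel_integral_translate[symmetric]) measurable
    then show ?thesis by (simp add: mult_ac)
  qed
  define C where "C = exp (R\<^sup>2 / 2) * sqrt (2 * pi) ^ DIM('a)"
  have u: "integrable lborel (\<lambda>x. C * \<bar>f x * gauss 1 x\<bar>)"
    using riesz_kernel_gauss(1)[OF f zero_less_one, of 0] by (intro integrable_mult_right integrable_abs) simp
  have gl: "1 \<le> C * gauss 1 x" if "norm x \<le> R" for x :: 'a
  proof -
    have "(norm x)\<^sup>2 \<le> R\<^sup>2" using that by (intro power_mono) auto
    then show ?thesis by (simp add: C_def gauss_def exp_add[symmetric])
  qed
  define F where "F x p = f x * (indicator A p * indicator B (p - x))" for x p :: 'a
  have int: "integrable (lborel \<Otimes>\<^sub>M lborel) (\<lambda>(x, p). F x p)"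
  proof (rule integrable_lborel_pair_bound[OF _ u integrable_indicator_bounded[OF A]])
    show "(\<lambda>(x, p). F x p) \<in> borel_measurable borel" unfolding F_def borel_prod[symmetric] by measurable
    fix x p :: 'a
    show "norm (case (x, p) of (x, p) \<Rightarrow> F x p) \<le> C * \<bar>f x * gauss 1 x\<bar> * indicator A p"
    proof (cases "p \<in> A \<and> p - x \<in> B")
      case True
      have "norm x \<le> R" using R1[of p] R2[of "p - x"] True norm_triangle_ineq4[of p "p - x"] by (simp add: R_def)
      from mult_left_mono[OF gl[OF this] abs_ge_zero[of "f x"]] show ?thesis
        using True by (simp add: F_def abs_mult gauss_nonneg mult_ac)
    qed (auto simp: F_def C_def)
  qed
  have "(LINT x|lborel. f x * overlap A B x) = (LINT x|lborel. LINT p|lborel. F x p)"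
    by (simp add: ov F_def)
  also have "\<dots> = (LINT p|lborel. LINT x|lborel. F x p)"
    by (rule lborel_pair.Fubini_integral[OF int, symmetric])
  also have "\<dots> = (LINT p|lborel. indicator A p *\<^sub>R (LINT q|lborel. indicator B q *\<^sub>R f (p - q)))"
  proof (rule Bochner_Integration.integral_cong, rule refl)
    fix p :: 'a
    have "(LINT x|lborel. F x p) = (LINT q|lborel. \<bar>- 1\<bar> ^ DIM('a) *\<^sub>R F (p + (- 1) *\<^sub>R q) p)"
      unfolding F_def by (intro integral_lborel_affine) auto
    also have "\<dots> = (LINT q|lborel. indicator A p * (indicator B q * f (p - q)))"
      by (simp add: F_def mult_ac)
    finally show "(LINT x|lborel. F x p) = indicator A p *\<^sub>R (LINT q|lborel. indicator B q *\<^sub>R f (p - q))"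
      by simp
  qed
  finally show ?thesis by (simp add: set_lebesgue_integral_def)
qed

lemma abs_mult_le_sum_squares: "\<bar>x * y\<bar> \<le> x\<^sup>2 + y\<^sup>2" for x y :: real
proof -
  have "0 \<le> (\<bar>x\<bar> - \<bar>y\<bar>)\<^sup>2" by (rule zero_le_power2)
  then have "2 * \<bar>x * y\<bar> \<le> x\<^sup>2 + y\<^sup>2" by (simp add: power2_diff abs_mult)
  then show ?thesis using abs_ge_zero[of "x * y"] by linarith
qed

text \<open>In the regularized identity the width \<open>s\<close> tends to \<open>0\<close>. For \<open>A = B\<close> the integrands on the frequency
  side are nonnegative and increase, so monotone convergence makes \<open>|\<F>1\<^sub>A|\<^sup>2\<close> integrable. This in turn
  provides the majorant \<open>|\<F>1\<^sub>A|\<^sup>2 + |\<F>1\<^sub>B|\<^sup>2\<close> for dominated convergence in general.\<close>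

lemma covariance_spectral:
  fixes f :: "'a::euclidean_space \<Rightarrow> real"
  assumes f: "riesz_kernel \<beta> f" and \<beta>: "0 < \<beta>" "\<beta> < real DIM('a)"
    and A: "A \<in> sets borel" "bounded A" and B: "B \<in> sets borel" "bounded B"
  shows "integrable (riesz_measure \<beta>) (\<lambda>\<xi>. indicator_fourier A \<xi> * cnj (indicator_fourier B \<xi>))" (is ?int)
    and "complex_of_real (LINT p:A|lborel. LINT q:B|lborel. f (p - q)) =
      (LINT \<xi>|riesz_measure \<beta>. indicator_fourier A \<xi> * cnj (indicator_fourier B \<xi>))" (is ?eq)
proof -
  have [measurable]: "A \<in> sets borel" "B \<in> sets borel" "f \<in> borel_measurable borel"
    using A B f by (auto simp: riesz_kernel_def)
  define s where "s n = 1 / real (Suc n)" for n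
  have s: "0 < s n" "\<bar>s n\<bar> \<le> 1" for n by (auto simp: s_def)
  have s0: "s \<longlonglongrightarrow> 0" unfolding s_def using LIMSEQ_inverse_real_of_nat by (simp add: inverse_eq_divide)
  have lhs: "(\<lambda>n. LINT x|lborel. f x * smoothed_overlap A B (s n) x) \<longlonglongrightarrow> (LINT x|lborel. f x * overlap A B x)"
    if A: "A \<in> sets borel" "bounded A" and B: "B \<in> sets borel" "bounded B" for A B
  proof -
    obtain C where C: "\<And>s x. \<bar>s\<bar> \<le> 1 \<Longrightarrow> \<bar>smoothed_overlap A B s x\<bar> \<le> C * gauss 2 x"
      using smoothed_overlap_bound[OF A B] by blast
    have [measurable]: "A \<in> sets borel" "B \<in> sets borel" by fact+
    show ?thesis
    proof (rule integral_dominated_convergence[where w="\<lambda>x. C * \<bar>f x * gauss 2 x\<bar>"])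
      show "integrable lborel (\<lambda>x. C * \<bar>f x * gauss 2 x\<bar>)"
        using riesz_kernel_gauss(1)[OF f, of 2 0] by (intro integrable_mult_right integrable_abs) simp
      show "AE x in lborel. (\<lambda>n. f x * smoothed_overlap A B (s n) x) \<longlonglongrightarrow> f x * overlap A B x"
        by (intro AE_I2 tendsto_intros smoothed_overlap_tendsto A B s0)
      show "AE x in lborel. norm (f x * smoothed_overlap A B (s n) x) \<le> C * \<bar>f x * gauss 2 x\<bar>" for n
        using mult_left_mono[OF C[OF s(2)] abs_ge_zero] by (auto simp: abs_mult gauss_nonneg mult_ac)
    qed measurable
  qed
  have wlim: "(\<lambda>n. riesz_weight \<beta> (s n) \<xi>) \<longlonglongrightarrow> riesz_weight \<beta> 0 \<xi>" for \<xi> :: 'a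
    unfolding riesz_weight_def by (intro tendsto_intros s0) simp
  have sq: "integrable lborel (\<lambda>\<xi>. riesz_weight \<beta> 0 \<xi> * (norm (indicator_fourier A \<xi>))\<^sup>2)"
    if A: "A \<in> sets borel" "bounded A" for A :: "'a set"
  proof (rule integral_monotone_convergence_nonneg(1))
    have [measurable]: "A \<in> sets borel" by fact
    have bd: "norm (indicator_fourier A \<xi>) \<le> measure lborel A" for \<xi>
    proof -
      have "norm (indicator_fourier A \<xi>) \<le> (LINT x|lborel. norm (exp (- \<i> * complex_of_real (\<xi> \<bullet> x)) * indicator A x))"
        unfolding indicator_fourier_def fourier_def by (rule integral_norm_bound)
      also have "\<dots> = (LINT x|lborel. indicator A x)"
        by (intro Bochner_Integration.integral_cong) (auto simp: norm_mult indicator_def)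
      finally show ?thesis by simp
    qed
    show "integrable lborel (\<lambda>\<xi>. riesz_weight \<beta> (s n) \<xi> * (norm (indicator_fourier A \<xi>))\<^sup>2)" for n
    proof (rule Bochner_Integration.integrable_bound)
      show "integrable lborel (\<lambda>\<xi>::'a. riesz_weight \<beta> (s n) \<xi> * (measure lborel A)\<^sup>2)"
        using integrable_riesz_weight[OF \<beta> s(1)] by simp
      show "AE \<xi> in lborel. norm (riesz_weight \<beta> (s n) \<xi> * (norm (indicator_fourier A \<xi>))\<^sup>2) \<le> norm (riesz_weight \<beta> (s n) \<xi> * (measure lborel A)\<^sup>2)"
        using bd by (auto simp: abs_mult intro!: mult_left_mono power_mono)
    qed measurable
    show "AE \<xi> in lborel. mono (\<lambda>n. riesz_weight \<beta> (s n) \<xi> * (norm (indicator_fourier A \<xi>))\<^sup>2)"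
    proof (rule AE_I2, rule monoI)
      fix \<xi> :: 'a and m n :: nat assume mn: "m \<le> n"
      have "(s n)\<^sup>2 \<le> (s m)\<^sup>2" using mn unfolding s_def by (intro power_mono divide_left_mono) auto
      then have "(s n)\<^sup>2 * (norm \<xi>)\<^sup>2 \<le> (s m)\<^sup>2 * (norm \<xi>)\<^sup>2" by (rule mult_right_mono) simp
      then have "riesz_weight \<beta> (s m) \<xi> \<le> riesz_weight \<beta> (s n) \<xi>"
        unfolding riesz_weight_def by (intro mult_left_mono) auto
      then show "riesz_weight \<beta> (s m) \<xi> * (norm (indicator_fourier A \<xi>))\<^sup>2 \<le> riesz_weight \<beta> (s n) \<xi> * (norm (indicator_fourier A \<xi>))\<^sup>2"
        by (rule mult_right_mono) simp
    qed
    show "AE \<xi> in lborel. 0 \<le> riesz_weight \<beta> (s n) \<xi> * (norm (indicator_fourier A \<xi>))\<^sup>2" for n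
      by (simp add: riesz_weight_def)
    show "AE \<xi> in lborel. (\<lambda>n. riesz_weight \<beta> (s n) \<xi> * (norm (indicator_fourier A \<xi>))\<^sup>2) \<longlonglongrightarrow>
        riesz_weight \<beta> 0 \<xi> * (norm (indicator_fourier A \<xi>))\<^sup>2"
      by (intro AE_I2 tendsto_intros wlim)
    have "complex_of_real (LINT x|lborel. f x * smoothed_overlap A A (s n) x) =
      complex_of_real (LINT \<xi>|lborel. riesz_weight \<beta> (s n) \<xi> * (norm (indicator_fourier A \<xi>))\<^sup>2)" for n
      by (subst regularized_covariance[OF f \<beta> s(1) A A], subst integral_complex_of_real[symmetric],
          rule Bochner_Integration.integral_cong, rule refl) (simp only: complex_norm_square of_real_mult)
    then have "(LINT \<xi>|lborel. riesz_weight \<beta> (s n) \<xi> * (norm (indicator_fourier A \<xi>))\<^sup>2) =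
       (LINT x|lborel. f x * smoothed_overlap A A (s n) x)" for n by (simp only: of_real_eq_iff)
    then show "(\<lambda>n. LINT \<xi>|lborel. riesz_weight \<beta> (s n) \<xi> * (norm (indicator_fourier A \<xi>))\<^sup>2) \<longlonglongrightarrow>
      (LINT x|lborel. f x * overlap A A x)"
      using lhs[OF A A] by simp
  qed (use A in measurable)
  let ?F = "\<lambda>\<xi>. indicator_fourier A \<xi> * cnj (indicator_fourier B \<xi>)"
  let ?w = "\<lambda>\<xi>. riesz_weight \<beta> 0 \<xi> * (norm (indicator_fourier A \<xi>))\<^sup>2 + riesz_weight \<beta> 0 \<xi> * (norm (indicator_fourier B \<xi>))\<^sup>2"
  have w: "integrable lborel ?w" using sq[OF A] sq[OF B] by simp
  have lim: "AE \<xi> in lborel. (\<lambda>n. complex_of_real (riesz_weight \<beta> (s n) \<xi>) * ?F \<xi>) \<longlonglongrightarrow> complex_of_real (riesz_weight \<beta> 0 \<xi>) * ?F \<xi>"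
    by (intro AE_I2 tendsto_intros wlim)
  have bnd: "AE \<xi> in lborel. norm (complex_of_real (riesz_weight \<beta> (s n) \<xi>) * ?F \<xi>) \<le> ?w \<xi>" for n
  proof (rule AE_I2)
    fix \<xi> :: 'a
    let ?a = "norm (indicator_fourier A \<xi>)" and ?b = "norm (indicator_fourier B \<xi>)"
    have ab: "?a * ?b \<le> ?a\<^sup>2 + ?b\<^sup>2"
      using abs_mult_le_sum_squares[of ?a ?b] by simp
    have "riesz_weight \<beta> (s n) \<xi> \<le> riesz_weight \<beta> 0 \<xi>"
      unfolding riesz_weight_def by (intro mult_left_mono) auto
    then have "riesz_weight \<beta> (s n) \<xi> * (?a * ?b) \<le> riesz_weight \<beta> 0 \<xi> * (?a\<^sup>2 + ?b\<^sup>2)"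
      using ab by (intro mult_mono) (auto simp: riesz_weight_def)
    then show "norm (complex_of_real (riesz_weight \<beta> (s n) \<xi>) * ?F \<xi>) \<le> ?w \<xi>"
      by (simp add: norm_mult riesz_weight_def abs_mult distrib_left)
  qed
  have m: "(\<lambda>\<xi>. complex_of_real (riesz_weight \<beta> 0 \<xi>) * ?F \<xi>) \<in> borel_measurable lborel"
    "(\<lambda>\<xi>. complex_of_real (riesz_weight \<beta> (s n) \<xi>) * ?F \<xi>) \<in> borel_measurable lborel" for n
    by measurable
  have i0: "integrable lborel (\<lambda>\<xi>. complex_of_real (riesz_weight \<beta> 0 \<xi>) * ?F \<xi>)"
    by (rule integrable_dominated_convergence[OF m w lim bnd])
  have l0: "(\<lambda>n. LINT \<xi>|lborel. complex_of_real (riesz_weight \<beta> (s n) \<xi>) * ?F \<xi>) \<longlonglongrightarrow>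
     (LINT \<xi>|lborel. complex_of_real (riesz_weight \<beta> 0 \<xi>) * ?F \<xi>)"
    by (rule integral_dominated_convergence[OF m w lim bnd])
  have w0: "complex_of_real (riesz_weight \<beta> 0 \<xi>) * ?F \<xi> = (norm \<xi> powr (- real DIM('a) + \<beta>)) *\<^sub>R ?F \<xi>" for \<xi>
    by (simp add: riesz_weight_def scaleR_conv_of_real)
  show ?int
    unfolding riesz_measure_def using i0[unfolded w0] by (subst integrable_density) auto
  have "(LINT \<xi>|riesz_measure \<beta>. ?F \<xi>) = (LINT \<xi>|lborel. complex_of_real (riesz_weight \<beta> 0 \<xi>) * ?F \<xi>)"
    unfolding riesz_measure_def w0 by (subst integral_density) auto
  moreover have "(\<lambda>n. LINT \<xi>|lborel. complex_of_real (riesz_weight \<beta> (s n) \<xi>) * ?F \<xi>) \<longlonglongrightarrow>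
     complex_of_real (LINT x|lborel. f x * overlap A B x)"
    unfolding regularized_covariance[OF f \<beta> s(1) A B, symmetric] by (intro tendsto_intros lhs A B)
  ultimately show ?eq
    using LIMSEQ_unique[OF l0] kernel_overlap_integral[OF f A B] by simp
qed

section \<open>The isometry on step functions\<close>

lemma has_real_derivative_pos_part_powr:
  fixes x p :: real
  assumes "x \<noteq> 0"
  shows "((\<lambda>x. max 0 x powr p) has_real_derivative p * max 0 x powr (p - 1)) (at x)"
proof (cases "0 < x")
  case True
  have "((\<lambda>x. x powr p) has_real_derivative p * x powr (p - 1)) (at x)"
    using True by (auto intro!: derivative_eq_intros)
  then have "((\<lambda>x. max 0 x powr p) has_real_derivative p * x powr (p - 1)) (at x)"
    by (rule has_field_derivative_transform_within_open[where S="{0<..}"]) (use True in auto)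
  then show ?thesis using True by simp
next
  case False
  have "((\<lambda>x. max 0 x powr p) has_real_derivative 0) (at x)"
    by (rule has_field_derivative_transform_within_open[where S="{..<0}" and f="\<lambda>_. 0"]) (use False assms in auto)
  then show ?thesis using False by simp
qed

lemma continuous_on_pos_part_powr:
  fixes p :: real
  assumes "0 < p" "continuous_on S g"
  shows "continuous_on S (\<lambda>x. max 0 (g x) powr p)"
  using assms by (intro continuous_on_powr' continuous_intros) auto

lemma abs_powr_pos_parts: "\<bar>x\<bar> powr p = max 0 x powr p + max 0 (- x) powr p" for x p :: real
  by (auto simp: max_def)

text \<open>The power is singular at \<open>v = r\<close>, where the antiderivative \<open>sgn(v-r) |v-r|\<^sup>p / p\<close> is still continuous.
  Written with positive parts it needs no case distinction.\<close>

lemma has_integral_abs_diff_powr: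
  fixes r s p :: real
  assumes p: "0 < p" and s: "0 \<le> s" and r: "0 \<le> r"
  shows "((\<lambda>v. \<bar>r - v\<bar> powr (p - 1)) has_integral
    (max 0 (s - r) powr p - max 0 (r - s) powr p + r powr p) / p) {0..s}"
proof -
  define F where "F v = (max 0 (v - r) powr p - max 0 (r - v) powr p) / p" for v
  have "((\<lambda>v. \<bar>r - v\<bar> powr (p - 1)) has_integral F s - F 0) {0..s}"
  proof (rule fundamental_theorem_of_calculus_interior_strong[where S="{r}"])
    show "continuous_on {0..s} F"
      unfolding F_def using p by (intro continuous_intros continuous_on_pos_part_powr) auto
    fix v assume v: "v \<in> {0<..<s} - {r}"
    have 1: "((\<lambda>v. max 0 (v - r) powr p) has_real_derivative p * max 0 (v - r) powr (p - 1) * 1) (at v)"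
      by (rule DERIV_chain2[OF has_real_derivative_pos_part_powr]) (use v in \<open>auto intro!: derivative_eq_intros\<close>)
    have 2: "((\<lambda>v. max 0 (r - v) powr p) has_real_derivative p * max 0 (r - v) powr (p - 1) * - 1) (at v)"
      by (rule DERIV_chain2[OF has_real_derivative_pos_part_powr]) (use v in \<open>auto intro!: derivative_eq_intros\<close>)
    have "(F has_real_derivative (p * max 0 (v - r) powr (p - 1) * 1 - p * max 0 (r - v) powr (p - 1) * - 1) / p) (at v)"
      unfolding F_def by (intro DERIV_cdivide DERIV_diff 1 2)
    also have "(p * max 0 (v - r) powr (p - 1) * 1 - p * max 0 (r - v) powr (p - 1) * - 1) / p = \<bar>r - v\<bar> powr (p - 1)"
      using p abs_powr_pos_parts[of "r - v" "p - 1"] by (simp add: field_simps)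
    finally show "(F has_vector_derivative \<bar>r - v\<bar> powr (p - 1)) (at v)"
      by (simp add: has_real_derivative_iff_has_vector_derivative)
  qed (use s in auto)
  also have "F s - F 0 = (max 0 (s - r) powr p - max 0 (r - s) powr p + r powr p) / p"
    using r p by (simp add: F_def field_simps)
  finally show ?thesis .
qed

lemma has_integral_fbm_cov:
  fixes H t s :: real
  assumes H: "1/2 < H" and t: "0 \<le> t" and s: "0 \<le> s"
  shows "((\<lambda>r. (max 0 (s - r) powr (2 * H - 1) - max 0 (r - s) powr (2 * H - 1) + r powr (2 * H - 1)) / (2 * H - 1))
    has_integral fbm_cov H t s / (H * (2 * H - 1))) {0..t}"
proof -
  define F where "F r = (r powr (2 * H) - max 0 (s - r) powr (2 * H) - max 0 (r - s) powr (2 * H)) / (2 * H * (2 * H - 1))" for r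
  let ?p = "2 * H - 1"
  have p: "0 < ?p" "H \<noteq> 0" "?p \<noteq> 0" using H by auto
  have "((\<lambda>r. (max 0 (s - r) powr ?p - max 0 (r - s) powr ?p + r powr ?p) / ?p) has_integral F t - F 0) {0..t}"
  proof (rule fundamental_theorem_of_calculus_interior_strong[where S="{s}"])
    show "continuous_on {0..t} F"
      unfolding F_def using H by (intro continuous_intros continuous_on_pos_part_powr continuous_on_powr') auto
    fix r assume r: "r \<in> {0<..<t} - {s}"
    have 1: "((\<lambda>r. max 0 (r - s) powr (2 * H)) has_real_derivative 2 * H * max 0 (r - s) powr ?p * 1) (at r)"
      by (rule DERIV_chain2[OF has_real_derivative_pos_part_powr]) (use r in \<open>auto intro!: derivative_eq_intros\<close>)
    have 2: "((\<lambda>r. max 0 (s - r) powr (2 * H)) has_real_derivative 2 * H * max 0 (s - r) powr ?p * - 1) (at r)"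
      by (rule DERIV_chain2[OF has_real_derivative_pos_part_powr]) (use r in \<open>auto intro!: derivative_eq_intros\<close>)
    have 3: "((\<lambda>r. r powr (2 * H)) has_real_derivative 2 * H * r powr ?p) (at r)"
      using r by (auto intro!: derivative_eq_intros)
    have "(F has_real_derivative (2 * H * r powr ?p - 2 * H * max 0 (s - r) powr ?p * - 1 - 2 * H * max 0 (r - s) powr ?p * 1) / (2 * H * ?p)) (at r)"
      unfolding F_def by (intro DERIV_cdivide DERIV_diff 1 2 3)
    also have "(2 * H * r powr ?p - 2 * H * max 0 (s - r) powr ?p * - 1 - 2 * H * max 0 (r - s) powr ?p * 1) / (2 * H * ?p) =
       (2 * H) * (max 0 (s - r) powr ?p - max 0 (r - s) powr ?p + r powr ?p) / ((2 * H) * ?p)"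
      by (simp add: algebra_simps)
    also have "\<dots> = (max 0 (s - r) powr ?p - max 0 (r - s) powr ?p + r powr ?p) / ?p"
      using p by (subst mult_divide_mult_cancel_left) auto
    finally show "(F has_vector_derivative (max 0 (s - r) powr ?p - max 0 (r - s) powr ?p + r powr ?p) / ?p) (at r)"
      by (simp add: has_real_derivative_iff_has_vector_derivative)
  qed (use t in auto)
  also have "F t - F 0 = fbm_cov H t s / (H * ?p)"
    unfolding F_def fbm_cov_def abs_powr_pos_parts[of "t - s"] using s t p by (simp add: diff_divide_distrib add_divide_distrib mult_ac)
  finally show ?thesis .
qed

definition fbm_rectangle :: "real \<Rightarrow> real \<Rightarrow> real \<Rightarrow> real \<times> real \<Rightarrow> real" where
  "fbm_rectangle H t s x = indicator ({0..t} \<times> {0..s}) x * \<bar>fst x - snd x\<bar> powr (2 * H - 2)"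

text \<open>The covariance of fractional Brownian motion is the integral of \<open>H(2H-1) |r-v|\<^bsup>2H-2\<^esup>\<close> over
  \<open>[0,t] \<times> [0,s]\<close>.\<close>

lemma fbm_rectangle_integral:
  assumes H: "1/2 < H" and t: "0 \<le> t" and s: "0 \<le> s"
  shows "integrable (lborel \<Otimes>\<^sub>M lborel) (fbm_rectangle H t s)"
    and "(LINT x|(lborel \<Otimes>\<^sub>M lborel). fbm_rectangle H t s x) = fbm_cov H t s / (H * (2 * H - 1))"
proof -
  let ?p = "2 * H - 1"
  have p: "0 < ?p" using H by simp
  define J where "J r = (max 0 (s - r) powr ?p - max 0 (r - s) powr ?p + r powr ?p) / ?p" for r
  have J0: "0 \<le> J r" if "0 \<le> r" for r
    by (rule has_integral_nonneg[OF has_integral_abs_diff_powr[OF p s that, folded J_def]]) simp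
  have [measurable]: "{0..t} \<times> {0..s} \<in> sets (lborel \<Otimes>\<^sub>M lborel)" by (intro pair_measureI) auto
  have m: "fbm_rectangle H t s \<in> borel_measurable (lborel \<Otimes>\<^sub>M lborel)"
    unfolding fbm_rectangle_def by measurable
  have "(\<integral>\<^sup>+x. ennreal (fbm_rectangle H t s x) \<partial>(lborel \<Otimes>\<^sub>M lborel)) =
     (\<integral>\<^sup>+r. \<integral>\<^sup>+v. ennreal (fbm_rectangle H t s (r, v)) \<partial>lborel \<partial>lborel)"
    by (rule lborel.nn_integral_fst[symmetric], rule measurable_compose[OF m measurable_ennreal])
  also have "\<dots> = (\<integral>\<^sup>+r. ennreal (J r) * indicator {0..t} r \<partial>lborel)"
  proof (rule nn_integral_cong)
    fix r :: real
    show "(\<integral>\<^sup>+v. ennreal (fbm_rectangle H t s (r, v)) \<partial>lborel) = ennreal (J r) * indicator {0..t} r"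
    proof (cases "r \<in> {0..t}")
      case True
      have "(\<integral>\<^sup>+v. ennreal (fbm_rectangle H t s (r, v)) \<partial>lborel) = (\<integral>\<^sup>+v. ennreal (\<bar>r - v\<bar> powr (?p - 1)) * indicator {0..s} v \<partial>lborel)"
        using True by (intro nn_integral_cong) (auto simp: fbm_rectangle_def indicator_def)
      also have "\<dots> = ennreal (J r)"
        unfolding J_def using True by (intro nn_integral_has_integral_lebesgue' has_integral_abs_diff_powr p s) auto
      finally show ?thesis using True by simp
    next
      case False
      then have "fbm_rectangle H t s (r, v) = 0" for v by (auto simp: fbm_rectangle_def)
      then show ?thesis using False by simp
    qed
  qed
  also have "\<dots> = ennreal (fbm_cov H t s / (H * ?p))"
    by (rule nn_integral_has_integral_lebesgue') (use J0 has_integral_fbm_cov[OF H t s] in \<open>auto simp: J_def\<close>)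
  finally have nn: "(\<integral>\<^sup>+x. ennreal (fbm_rectangle H t s x) \<partial>(lborel \<Otimes>\<^sub>M lborel)) = ennreal (fbm_cov H t s / (H * ?p))" .
  have nonneg: "0 \<le> fbm_rectangle H t s x" for x by (simp add: fbm_rectangle_def)
  have c0: "0 \<le> fbm_cov H t s / (H * ?p)"
    by (rule has_integral_nonneg[OF has_integral_fbm_cov[OF H t s, folded J_def]]) (use J0 in auto)
  show "integrable (lborel \<Otimes>\<^sub>M lborel) (fbm_rectangle H t s)"
    by (rule integrableI_nonneg[OF m]) (use nonneg nn in auto)
  show "(LINT x|(lborel \<Otimes>\<^sub>M lborel). fbm_rectangle H t s x) = fbm_cov H t s / (H * ?p)"
    by (subst integral_eq_nn_integral) (use m nonneg nn c0 in auto)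
qed

lemma integral_double_sum:
  fixes F :: "nat \<Rightarrow> nat \<Rightarrow> 'w \<Rightarrow> 'b::{banach, second_countable_topology}"
  assumes "\<And>i j. i < n \<Longrightarrow> j < n \<Longrightarrow> integrable M (F i j)"
  shows "(LINT x|M. (\<Sum>i<n. \<Sum>j<n. F i j x)) = (\<Sum>i<n. \<Sum>j<n. (LINT x|M. F i j x))"
proof -
  have "(LINT x|M. (\<Sum>i<n. \<Sum>j<n. F i j x)) = (\<Sum>i<n. (LINT x|M. (\<Sum>j<n. F i j x)))"
    by (rule Bochner_Integration.integral_sum) (auto intro!: Bochner_Integration.integrable_sum assms)
  also have "\<dots> = (\<Sum>i<n. \<Sum>j<n. (LINT x|M. F i j x))"
    by (intro sum.cong refl Bochner_Integration.integral_sum) (auto intro: assms)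
  finally show ?thesis .
qed

lemma time_energy_indicator_sum:
  fixes a :: "nat \<Rightarrow> complex" and s :: "nat \<Rightarrow> real"
  assumes H: "1/2 < H" and s: "\<And>i. i < n \<Longrightarrow> 0 \<le> s i"
  defines "\<phi> \<equiv> \<lambda>r. \<Sum>i<n. a i * indicator {0..s i} r"
  shows "time_admissible H \<phi>"
    and "time_energy H \<phi> = (\<Sum>i<n. \<Sum>j<n. a i * cnj (a j) * complex_of_real (fbm_cov H (s i) (s j) / (H * (2 * H - 1))))"
proof -
  let ?h = "\<lambda>x. indicator ({0..} \<times> {0..}) x *\<^sub>R (case x of (r, v) \<Rightarrow> \<phi> r * cnj (\<phi> v) * complex_of_real (\<bar>r - v\<bar> powr (2 * H - 2)))"
  have eq: "?h = (\<lambda>x. \<Sum>i<n. \<Sum>j<n. a i * cnj (a j) * complex_of_real (fbm_rectangle H (s i) (s j) x))"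
  proof
    fix x :: "real \<times> real"
    obtain r v where x: "x = (r, v)" by (cases x)
    have "indicator {0..s i} r * indicator {0..s j} v * \<bar>r - v\<bar> powr (2 * H - 2) = fbm_rectangle H (s i) (s j) x" for i j
      by (simp add: fbm_rectangle_def x indicator_def)
    then have k: "complex_of_real (fbm_rectangle H (s i) (s j) x) =
       indicator {0..s i} r * indicator {0..s j} v * complex_of_real (\<bar>r - v\<bar> powr (2 * H - 2))" for i j
      by (metis of_real_mult of_real_indicator)
    have "\<phi> r * cnj (\<phi> v) * complex_of_real (\<bar>r - v\<bar> powr (2 * H - 2)) =
       (\<Sum>i<n. \<Sum>j<n. a i * cnj (a j) * complex_of_real (fbm_rectangle H (s i) (s j) x))"
    proof -
      have "\<phi> r * cnj (\<phi> v) = (\<Sum>i<n. \<Sum>j<n. a i * indicator {0..s i} r * cnj (a j * indicator {0..s j} v))"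
        unfolding \<phi>_def cnj_sum by (rule sum_product)
      then show ?thesis
        unfolding k by (simp only: sum_distrib_right) (intro sum.cong refl, simp add: mult_ac indicator_def)
    qed
    moreover have "\<not> (0 \<le> r \<and> 0 \<le> v) \<Longrightarrow> fbm_rectangle H (s i) (s j) x = 0" for i j
      by (auto simp: fbm_rectangle_def x)
    ultimately show "?h x = (\<Sum>i<n. \<Sum>j<n. a i * cnj (a j) * complex_of_real (fbm_rectangle H (s i) (s j) x))"
      by (cases "0 \<le> r \<and> 0 \<le> v") (auto simp: x)
  qed
  have int: "integrable (lborel \<Otimes>\<^sub>M lborel) (\<lambda>x. a i * cnj (a j) * complex_of_real (fbm_rectangle H (s i) (s j) x))"
    if "i < n" "j < n" for i j
    using fbm_rectangle_integral(1)[OF H s[OF that(1)] s[OF that(2)]] by (intro integrable_mult_right integrable_of_real)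
  have "\<phi> \<in> borel_measurable borel" unfolding \<phi>_def by measurable
  then show adm: "time_admissible H \<phi>"
    unfolding time_admissible_def set_integrable_def eq
    by (intro conjI Bochner_Integration.integrable_sum int) auto
  show "time_energy H \<phi> = (\<Sum>i<n. \<Sum>j<n. a i * cnj (a j) * complex_of_real (fbm_cov H (s i) (s j) / (H * (2 * H - 1))))"
    unfolding time_energy_eq_product_integral[OF adm] eq
    by (subst integral_double_sum[OF int]) (auto intro!: sum.cong simp: fbm_rectangle_integral(2)[OF H s s])
qed

lemma centered_gaussian_square_integrable:
  assumes "centered_gaussian P X"
  shows "X \<in> borel_measurable P" "integrable P (\<lambda>\<omega>. (X \<omega>)\<^sup>2)"
proof -
  show X[measurable]: "X \<in> borel_measurable P" using assms by (simp add: centered_gaussian_def)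
  have "integrable (distr P borel X) (\<lambda>x. x\<^sup>2)"
  proof (cases "distr P borel X = return borel 0")
    case True
    then show ?thesis by (simp add: integrable_iff_bounded nn_integral_return)
  next
    case False
    then obtain \<sigma> where \<sigma>: "\<sigma> > 0" "distr P borel X = density lborel (\<lambda>x. ennreal (normal_density 0 \<sigma> x))"
      using assms by (auto simp: centered_gaussian_def)
    show ?thesis unfolding \<sigma>(2)
      by (subst integrable_density) (simp_all add: integrable_normal_moment[OF \<sigma>(1), of 0 2, unfolded diff_zero])
  qed
  then show "integrable P (\<lambda>\<omega>. (X \<omega>)\<^sup>2)" by (simp add: integrable_distr_eq)
qed

lemma integrable_mult_square_integrable:
  fixes X Y :: "'w \<Rightarrow> real"
  assumes [measurable]: "X \<in> borel_measurable P" "Y \<in> borel_measurable P"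
    and X: "integrable P (\<lambda>\<omega>. (X \<omega>)\<^sup>2)" and Y: "integrable P (\<lambda>\<omega>. (Y \<omega>)\<^sup>2)"
  shows "integrable P (\<lambda>\<omega>. X \<omega> * Y \<omega>)"
proof (rule Bochner_Integration.integrable_bound[OF Bochner_Integration.integrable_add[OF X Y]])
  show "AE \<omega> in P. norm (X \<omega> * Y \<omega>) \<le> norm ((X \<omega>)\<^sup>2 + (Y \<omega>)\<^sup>2)"
    using abs_mult_le_sum_squares by auto
qed measurable

text \<open>Both sides expand into the same double sum over the steps: time contributes the fractional
  covariance, space the spectral form of the double integral of \<open>f\<close>.\<close>

lemma step_isometry:
  fixes f :: "'a::euclidean_space \<Rightarrow> real" and W :: "real \<Rightarrow> 'a set \<Rightarrow> 'w \<Rightarrow> real"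
  assumes H: "1/2 < H" "H < 1" and \<beta>: "0 < \<beta>" "\<beta> < real DIM('a)" and f: "riesz_kernel \<beta> f"
    and W: "fractional_colored_noise P H f W" and L: "step_ok L"
  shows "hp_admissible H \<beta> (step_fourier L)"
    and "step_integral W L \<in> borel_measurable P"
    and "integrable P (\<lambda>\<omega>. (step_integral W L \<omega>)\<^sup>2)"
    and "(LINT \<omega>|P. (step_integral W L \<omega>)\<^sup>2) = (hp_norm H \<beta> (step_fourier L))\<^sup>2"
proof -
  define n where "n = length L"
  define c where "c i = fst (L ! i)" for i
  define s where "s i = fst (snd (L ! i))" for i
  define A where "A i = snd (snd (L ! i))" for i
  have idx: "(s i, A i) \<in> noise_index" if "i < n" for i
  proof -
    have "(c i, s i, A i) \<in> set L"
      using nth_mem[of i L] that by (simp add: c_def s_def A_def n_def)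
    then show ?thesis using L by (auto simp: step_ok_def)
  qed
  then have ok: "0 \<le> s i" "A i \<in> sets borel" "bounded (A i)" if "i < n" for i
    using that by (auto simp: noise_index_def)
  have sl: "(\<Sum>(c, s, A)\<leftarrow>L. g c s A) = (\<Sum>i<n. g (c i) (s i) (A i))" for g :: "real \<Rightarrow> real \<Rightarrow> 'a set \<Rightarrow> 'b::comm_monoid_add"
    by (simp add: sum_list_sum_nth n_def c_def s_def A_def atLeast0LessThan split_beta)
  let ?\<kappa> = "\<lambda>i j. fbm_cov H (s i) (s j) / (H * (2 * H - 1))"
  let ?F = "\<lambda>i \<xi>. indicator_fourier (A i) \<xi>"
  have sf: "step_fourier L r \<xi> = (\<Sum>i<n. (complex_of_real (c i) * ?F i \<xi>) * indicator {0..s i} r)" for r \<xi>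
    unfolding step_fourier_eq[OF L] sl by (intro sum.cong refl) (simp add: mult_ac indicator_def)
  have te: "time_admissible H (\<lambda>r. step_fourier L r \<xi>)"
    "time_energy H (\<lambda>r. step_fourier L r \<xi>) = (\<Sum>i<n. \<Sum>j<n. complex_of_real (c i * c j * ?\<kappa> i j) * (?F i \<xi> * cnj (?F j \<xi>)))" for \<xi>
    unfolding sf using time_energy_indicator_sum[OF H(1), of n s "\<lambda>i. complex_of_real (c i) * ?F i \<xi>"] ok
    by (auto intro!: sum.cong simp: mult_ac)
  have int: "integrable (riesz_measure \<beta>) (\<lambda>\<xi>. complex_of_real (c i * c j * ?\<kappa> i j) * (?F i \<xi> * cnj (?F j \<xi>)))"
    if "i < n" "j < n" for i j
    using covariance_spectral(1)[OF f \<beta> ok(2,3)[OF that(1)] ok(2,3)[OF that(2)]] by (rule integrable_mult_right)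
  have meas: "case_prod (step_fourier L) \<in> borel_measurable (borel \<Otimes>\<^sub>M borel)"
    unfolding sf[abs_def] split_beta using ok by measurable
  show adm: "hp_admissible H \<beta> (step_fourier L)"
    unfolding hp_admissible_iff te(2)
    by (intro conjI AE_I2 te(1) meas Bochner_Integration.integrable_sum int) auto
  have "hp_inner H \<beta> (step_fourier L) (step_fourier L) = complex_of_real (H * (2 * H - 1)) *
      (\<Sum>i<n. \<Sum>j<n. complex_of_real (c i * c j * ?\<kappa> i j) * (LINT \<xi>|riesz_measure \<beta>. ?F i \<xi> * cnj (?F j \<xi>)))"
    unfolding hp_inner_def hp_time_form_diag te(2)
    by (subst integral_double_sum[OF int]) (simp_all only: integral_mult_right_zero)
  also have "\<dots> = complex_of_real (H * (2 * H - 1)) *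
      (\<Sum>i<n. \<Sum>j<n. complex_of_real (c i * c j * ?\<kappa> i j) * complex_of_real (LINT p:A i|lborel. LINT q:A j|lborel. f (p - q)))"
    using ok by (intro arg_cong2[where f="(*)"] refl sum.cong) (auto simp: covariance_spectral(2)[OF f \<beta>])
  also have "\<dots> = complex_of_real (\<Sum>i<n. \<Sum>j<n. c i * c j * (fbm_cov H (s i) (s j) * (LINT p:A i|lborel. LINT q:A j|lborel. f (p - q))))"
  proof -
    have "H * (2 * H - 1) * (c i * c j * ?\<kappa> i j * S) = c i * c j * (fbm_cov H (s i) (s j) * S)" for i j S
      using H by (simp add: field_simps)
    then show ?thesis
      by (simp only: of_real_mult[symmetric] of_real_sum[symmetric] sum_distrib_left)
  qed
  finally have inner: "Re (hp_inner H \<beta> (step_fourier L) (step_fourier L)) =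
     (\<Sum>i<n. \<Sum>j<n. c i * c j * (fbm_cov H (s i) (s j) * (LINT p:A i|lborel. LINT q:A j|lborel. f (p - q))))"
    by simp
  have gauss: "centered_gaussian P (W (s i) (A i))" if "i < n" for i
    using W idx[OF that] unfolding fractional_colored_noise_def centered_gaussian_family_def
    by (auto dest!: spec[of _ "{(s i, A i)}"] spec[of _ "\<lambda>_. 1"])
  note L2 = centered_gaussian_square_integrable[OF gauss]
  have prod: "integrable P (\<lambda>\<omega>. W (s i) (A i) \<omega> * W (s j) (A j) \<omega>)" if "i < n" "j < n" for i j
    by (rule integrable_mult_square_integrable[OF L2(1) L2(1) L2(2) L2(2)]) (use that in auto)
  have cov: "(LINT \<omega>|P. W (s i) (A i) \<omega> * W (s j) (A j) \<omega>) =
     fbm_cov H (s i) (s j) * (LINT p:A i|lborel. LINT q:A j|lborel. f (p - q))" if "i < n" "j < n" for i j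
    using W idx[OF that(1)] idx[OF that(2)] unfolding fractional_colored_noise_def by fastforce
  have si: "step_integral W L = (\<lambda>\<omega>. \<Sum>i<n. c i * W (s i) (A i) \<omega>)"
    by (intro ext) (simp add: step_integral_def sl)
  show "step_integral W L \<in> borel_measurable P"
    unfolding si using L2(1) by measurable
  have sq: "(step_integral W L \<omega>)\<^sup>2 = (\<Sum>i<n. \<Sum>j<n. c i * c j * (W (s i) (A i) \<omega> * W (s j) (A j) \<omega>))" for \<omega>
    unfolding si power2_eq_square sum_product by (intro sum.cong refl) (simp add: mult_ac)
  have iprod: "integrable P (\<lambda>\<omega>. c i * c j * (W (s i) (A i) \<omega> * W (s j) (A j) \<omega>))" if "i < n" "j < n" for i j
    using prod[OF that] by (rule integrable_mult_right)
  show "integrable P (\<lambda>\<omega>. (step_integral W L \<omega>)\<^sup>2)"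
    unfolding sq by (intro Bochner_Integration.integrable_sum iprod) auto
  have "(LINT \<omega>|P. (step_integral W L \<omega>)\<^sup>2) = (\<Sum>i<n. \<Sum>j<n. c i * c j * (LINT \<omega>|P. W (s i) (A i) \<omega> * W (s j) (A j) \<omega>))"
    unfolding sq by (subst integral_double_sum[OF iprod]) (simp_all only: integral_mult_right_zero)
  also have "\<dots> = Re (hp_inner H \<beta> (step_fourier L) (step_fourier L))"
    unfolding inner by (intro sum.cong refl) (simp add: cov)
  also have "\<dots> = (hp_norm H \<beta> (step_fourier L))\<^sup>2"
    unfolding hp_norm_sq[OF H adm] by (rule Re_hp_inner_diag(1)[OF H adm])
  finally show "(LINT \<omega>|P. (step_integral W L \<omega>)\<^sup>2) = (hp_norm H \<beta> (step_fourier L))\<^sup>2" .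
qed

section \<open>The energy of a wave at a single frequency\<close>

text \<open>The Fourier transform of the wave kernel depends on \<open>\<xi>\<close> through \<open>k = |\<xi>|\<close> only; this is its time
  profile up to time \<open>t\<close>, without the phase.\<close>

definition wave_profile :: "real \<Rightarrow> real \<Rightarrow> real \<Rightarrow> complex" where
  "wave_profile t k r = complex_of_real (indicator {0..t} r * (sin ((t - r) * k) / k))"

text \<open>The integral of \<open>e\<^bsup>-l(r-w)\<^esup> sin((t-r)k)\<close> over \<open>max w 0 \<le> r \<le> t\<close>. For exponentials started at a time
  \<open>w < 0\<close> the response is that for \<open>w = 0\<close>, damped by \<open>e\<^bsup>lw\<^esup>\<close>.\<close>

definition wave_response :: "real \<Rightarrow> real \<Rightarrow> real \<Rightarrow> real \<Rightarrow> real" where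
  "wave_response t k l w = exp (l * min w 0) *
     (k * exp (- (l * (t - max w 0))) + l * sin ((t - max w 0) * k) - k * cos ((t - max w 0) * k)) / (l\<^sup>2 + k\<^sup>2)"

lemma wave_response_measurable [measurable (raw)]:
  assumes [measurable]: "f \<in> borel_measurable M" "g \<in> borel_measurable M"
  shows "(\<lambda>x. wave_response t k (f x) (g x)) \<in> borel_measurable M"
  unfolding wave_response_def by measurable

lemma wave_profile_measurable [measurable]: "wave_profile t k \<in> borel_measurable borel"
  unfolding wave_profile_def by measurable

lemma time_transform_wave:
  assumes t: "0 \<le> t" and k: "0 < k"
  shows "time_transform H (wave_profile t k) (l, w) =
    complex_of_real (if 0 < l \<and> w < t then l powr (1 - H) / k * wave_response t k l w else 0)"
proof (cases "0 < l \<and> w < t")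
  case True
  define m where "m = max w 0"
  have m: "m \<le> t" "0 \<le> m" using True t by (auto simp: m_def)
  define f where "f r = exp (- (l * (r - w))) * sin ((t - r) * k)" for r
  define F where "F r = exp (- (l * (r - w))) * (k * cos ((t - r) * k) - l * sin ((t - r) * k)) / (l\<^sup>2 + k\<^sup>2)" for r
  have D: "l\<^sup>2 + k\<^sup>2 > 0" using k True by (intro add_pos_pos) auto
  have "time_transform H (wave_profile t k) (l, w) =
     (LINT r|lborel. complex_of_real (l powr (1 - H) / k * (f r * indicator {m..t} r)))"
    unfolding time_transform_def set_lebesgue_integral_def
  proof (rule integral_cong_AE)
    show "AE r in lborel. indicator {0..} r *\<^sub>R (complex_of_real (time_atom H (l, w) r) * wave_profile t k r) =
      complex_of_real (l powr (1 - H) / k * (f r * indicator {m..t} r))"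
      using AE_lborel_singleton[of w]
      by eventually_elim
        (use True in \<open>auto simp: time_atom_def wave_profile_def f_def m_def indicator_def\<close>)
  qed (unfold f_def, measurable)
  also have "\<dots> = complex_of_real (l powr (1 - H) / k * (LINT r|lborel. f r * indicator {m..t} r))"
    by (simp only: integral_complex_of_real integral_mult_right_zero)
  also have "(LINT r|lborel. f r * indicator {m..t} r) = F t - F m"
  proof (rule integral_FTC_Icc_real[OF m(1)])
    fix r
    have "(F has_real_derivative ((l\<^sup>2 + k\<^sup>2) * (exp (- (l * (r - w))) * sin ((t - r) * k))) / (l\<^sup>2 + k\<^sup>2)) (at r)"
      unfolding F_def
      by (rule DERIV_cdivide) (auto intro!: derivative_eq_intros simp: algebra_simps power2_eq_square)
    then show "(F has_real_derivative f r) (at r)" using k by (simp add: f_def)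
    show "isCont f r" unfolding f_def by (intro continuous_intros)
  qed
  also have "F t - F m = wave_response t k l w"
  proof -
    have 1: "exp (- (l * (m - w))) = exp (l * min w 0)" by (auto simp: m_def min_def max_def algebra_simps)
    have 2: "exp (- (l * (t - w))) = exp (l * min w 0) * exp (- (l * (t - m)))"
      unfolding exp_add[symmetric] by (auto simp: m_def min_def max_def algebra_simps)
    show ?thesis unfolding F_def wave_response_def 1 2 m_def[symmetric]
      by (simp add: diff_divide_distrib[symmetric] algebra_simps)
  qed
  finally show ?thesis using True by simp
next
  case False
  then have z: "complex_of_real (time_atom H (l, w) r) * wave_profile t k r = 0" for r
    by (auto simp: time_atom_def wave_profile_def)
  have "time_transform H (wave_profile t k) (l, w) = 0"
    unfolding time_transform_def set_lebesgue_integral_def z by simp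
  then show ?thesis using False by auto
qed

lemma wave_response_le:
  assumes l: "0 < l" and k: "0 < k" and w: "w < t" and t: "0 \<le> t"
  shows "(wave_response t k l w)\<^sup>2 \<le> 5 / (l\<^sup>2 + k\<^sup>2) * exp (2 * l * min w 0)"
proof -
  define \<tau> where "\<tau> = t - max w 0"
  have \<tau>: "0 \<le> \<tau>" using w t by (simp add: \<tau>_def)
  have D: "l\<^sup>2 + k\<^sup>2 > 0" using k l by (intro add_pos_pos) auto
  define B where "B = k * exp (- (l * \<tau>)) + l * sin (\<tau> * k) - k * cos (\<tau> * k)"
  have "\<bar>B\<bar> \<le> \<bar>k * exp (- (l * \<tau>))\<bar> + \<bar>l * sin (\<tau> * k)\<bar> + \<bar>k * cos (\<tau> * k)\<bar>"
    unfolding B_def by linarith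
  also have "\<dots> \<le> k * 1 + l * 1 + k * 1"
    unfolding abs_mult using l k \<tau> by (intro add_mono mult_mono) auto
  finally have "B\<^sup>2 \<le> (l + 2 * k)\<^sup>2" using l k by (intro power2_le_iff_abs_le[THEN iffD2]) auto
  also have "\<dots> \<le> 5 * (l\<^sup>2 + k\<^sup>2)"
    using zero_le_power2[of "2 * l - k"] by (simp add: power2_eq_square algebra_simps)
  finally have B: "B\<^sup>2 \<le> 5 * (l\<^sup>2 + k\<^sup>2)" .
  have "(wave_response t k l w)\<^sup>2 = exp (2 * l * min w 0) * (B\<^sup>2 / (l\<^sup>2 + k\<^sup>2)\<^sup>2)"
    by (simp add: wave_response_def B_def \<tau>_def power_mult_distrib power_divide exp_double[symmetric] mult.assoc)
  also have "\<dots> \<le> exp (2 * l * min w 0) * (5 * (l\<^sup>2 + k\<^sup>2) / (l\<^sup>2 + k\<^sup>2)\<^sup>2)"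
    using B by (intro mult_left_mono divide_right_mono) auto
  also have "5 * (l\<^sup>2 + k\<^sup>2) / (l\<^sup>2 + k\<^sup>2)\<^sup>2 = 5 / (l\<^sup>2 + k\<^sup>2)"
    unfolding power2_eq_square[of "l\<^sup>2 + k\<^sup>2"] by (rule mult_divide_mult_cancel_right) (rule less_imp_neq[symmetric, OF D])
  also have "exp (2 * l * min w 0) * (5 / (l\<^sup>2 + k\<^sup>2)) = 5 / (l\<^sup>2 + k\<^sup>2) * exp (2 * l * min w 0)"
    by (rule mult.commute)
  finally show ?thesis .
qed

text \<open>The profile is bounded by \<open>t\<close>, since \<open>|sin(ak)| \<le> ak\<close>. The resulting bound on the energy is uniform
  in \<open>k\<close> and serves for small frequencies.\<close>

lemma wave_profile_admissible:
  assumes H: "1/2 < H" and t: "0 \<le> t" and k: "0 < k"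
  shows "time_admissible H (wave_profile t k)"
    and "Re (time_energy H (wave_profile t k)) \<le> t\<^sup>2 * (fbm_cov H t t / (H * (2 * H - 1)))"
proof -
  let ?h = "\<lambda>x. indicator ({0..} \<times> {0..}) x *\<^sub>R (case x of (r, v) \<Rightarrow> wave_profile t k r * cnj (wave_profile t k v) * complex_of_real (\<bar>r - v\<bar> powr (2 * H - 2)))"
  have b: "norm (wave_profile t k r) \<le> t * indicator {0..t} r" for r
  proof (cases "r \<in> {0..t}")
    case True
    have "\<bar>sin ((t - r) * k)\<bar> \<le> \<bar>(t - r) * k\<bar>" by (rule abs_sin_x_le_abs_x)
    also have "\<dots> \<le> t * k" unfolding abs_mult using True k by (intro mult_mono) auto
    finally have "\<bar>sin ((t - r) * k)\<bar> / k \<le> t" using k by (simp add: field_simps)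
    then show ?thesis using True k by (simp add: wave_profile_def norm_mult norm_divide)
  qed (simp add: wave_profile_def)
  have le: "norm (?h x) \<le> t\<^sup>2 * fbm_rectangle H t t x" for x
  proof -
    obtain r v where x: "x = (r, v)" by (cases x)
    have "norm (?h x) \<le> norm (wave_profile t k r) * norm (wave_profile t k v) * \<bar>r - v\<bar> powr (2 * H - 2)"
      by (auto simp: x norm_mult indicator_def)
    also have "\<dots> \<le> (t * indicator {0..t} r) * (t * indicator {0..t} v) * \<bar>r - v\<bar> powr (2 * H - 2)"
      using t by (intro mult_right_mono mult_mono b) auto
    also have "\<dots> = t\<^sup>2 * fbm_rectangle H t t x"
      by (auto simp: x fbm_rectangle_def power2_eq_square indicator_def)
    finally show ?thesis .
  qed
  have [measurable]: "{0::real..} \<times> {0::real..} \<in> sets (lborel \<Otimes>\<^sub>M lborel)"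
    by (intro pair_measureI) auto
  have i: "integrable (lborel \<Otimes>\<^sub>M lborel) (\<lambda>x. t\<^sup>2 * fbm_rectangle H t t x)"
    by (intro integrable_mult_right fbm_rectangle_integral(1)[OF H t t])
  have ih: "integrable (lborel \<Otimes>\<^sub>M lborel) ?h"
  proof (rule Bochner_Integration.integrable_bound[OF i])
    show "?h \<in> borel_measurable (lborel \<Otimes>\<^sub>M lborel)" unfolding split_beta by measurable
    show "AE x in lborel \<Otimes>\<^sub>M lborel. norm (?h x) \<le> norm (t\<^sup>2 * fbm_rectangle H t t x)"
    proof (rule AE_I2)
      fix x
      have "t\<^sup>2 * fbm_rectangle H t t x \<le> norm (t\<^sup>2 * fbm_rectangle H t t x)" by simp
      then show "norm (?h x) \<le> norm (t\<^sup>2 * fbm_rectangle H t t x)" by (rule order_trans[OF le])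
    qed
  qed
  show adm: "time_admissible H (wave_profile t k)"
    unfolding time_admissible_def set_integrable_def using ih by simp
  have "Re (time_energy H (wave_profile t k)) \<le> norm (time_energy H (wave_profile t k))"
    by (rule complex_Re_le_cmod)
  also have "\<dots> \<le> (LINT x|(lborel \<Otimes>\<^sub>M lborel). t\<^sup>2 * fbm_rectangle H t t x)"
    unfolding time_energy_eq_product_integral[OF adm]
    by (rule order_trans[OF integral_norm_bound]) (intro integral_mono integrable_norm ih i le)
  also have "\<dots> = t\<^sup>2 * (fbm_cov H t t / (H * (2 * H - 1)))"
    by (simp add: fbm_rectangle_integral(2)[OF H t t])
  finally show "Re (time_energy H (wave_profile t k)) \<le> t\<^sup>2 * (fbm_cov H t t / (H * (2 * H - 1)))" .
qed

lemma ennreal_wave_energy: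
  assumes H: "1/2 < H" "H < 1" and t: "0 \<le> t" and k: "0 < k"
  shows "ennreal (Re (time_energy H (wave_profile t k))) = ennreal (2 / Gamma (2 - 2 * H)) *
    (\<integral>\<^sup>+l. \<integral>\<^sup>+w. ennreal (if 0 < l \<and> w < t then l powr (2 - 2 * H) / k\<^sup>2 * (wave_response t k l w)\<^sup>2 else 0) \<partial>lborel \<partial>lborel)"
proof -
  note adm = wave_profile_admissible(1)[OF H(1) t k]
  have G: "0 < Gamma (2 - 2 * H)" using Gamma_real_pos[of "2 - 2 * H"] H by auto
  define g where "g p = (if 0 < fst p \<and> snd p < t then fst p powr (2 - 2 * H) / k\<^sup>2 * (wave_response t k (fst p) (snd p))\<^sup>2 else 0)"
    for p :: "real \<times> real"
  have gm: "g \<in> borel_measurable borel" unfolding g_def borel_prod[symmetric] by measurable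
  have eq: "(norm (time_transform H (wave_profile t k) p))\<^sup>2 = g p" for p
  proof -
    obtain l w where p: "p = (l, w)" by (cases p)
    have "(l powr (1 - H))\<^sup>2 = l powr (2 - 2 * H)"
      by (simp add: power2_eq_square powr_add[symmetric])
    then show ?thesis
      by (simp add: p time_transform_wave[OF t k] g_def norm_mult norm_divide power_mult_distrib power_divide)
  qed
  have "integrable lborel g" using time_energy_representation(1)[OF H adm] by (simp add: eq)
  moreover have "0 \<le> g p" for p by (simp add: g_def)
  ultimately have "ennreal (LINT p|lborel. g p) = (\<integral>\<^sup>+p. ennreal (g p) \<partial>lborel)"
    by (intro nn_integral_eq_integral[symmetric]) auto
  also have "\<dots> = (\<integral>\<^sup>+l. \<integral>\<^sup>+w. ennreal (g (l, w)) \<partial>lborel \<partial>lborel)"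
    unfolding lborel_prod[symmetric]
    by (rule lborel.nn_integral_fst[symmetric]) (use gm in \<open>simp add: lborel_prod\<close>)
  finally have "ennreal (LINT p|lborel. g p) = (\<integral>\<^sup>+l. \<integral>\<^sup>+w. ennreal (g (l, w)) \<partial>lborel \<partial>lborel)" .
  then have int: "ennreal (LINT p|lborel. g p) = (\<integral>\<^sup>+l. \<integral>\<^sup>+w.
      ennreal (if 0 < l \<and> w < t then l powr (2 - 2 * H) / k\<^sup>2 * (wave_response t k l w)\<^sup>2 else 0) \<partial>lborel \<partial>lborel)"
    by (simp only: g_def fst_conv snd_conv)
  have "Re (time_energy H (wave_profile t k)) = 2 / Gamma (2 - 2 * H) * (LINT p|lborel. g p)"
    unfolding time_energy_representation(2)[OF H adm] eq Re_complex_of_real ..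
  then have "ennreal (Re (time_energy H (wave_profile t k))) = ennreal (2 / Gamma (2 - 2 * H)) * ennreal (LINT p|lborel. g p)"
    using G by (simp only:) (intro ennreal_mult', simp)
  then show ?thesis unfolding int .
qed

text \<open>Below \<open>k\<close> the denominator is at least \<open>k\<^sup>2\<close>, above \<open>k\<close> at least \<open>l\<^sup>2\<close>.\<close>

lemma nn_integral_powr_over_quadratic:
  assumes a: "- 1 < a" "a < 1" and k: "0 < (k::real)"
  shows "(\<integral>\<^sup>+l. ennreal (if 0 < l then l powr a / (l\<^sup>2 + k\<^sup>2) else 0) \<partial>lborel) \<le> ennreal ((2 / (1 + a) + 2 / (1 - a)) * k powr (a - 1))"
proof -
  have "(\<integral>\<^sup>+l. ennreal (if 0 < l then l powr a / (l\<^sup>2 + k\<^sup>2) else 0) \<partial>lborel) \<le>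
    (\<integral>\<^sup>+l. ennreal (1 / k\<^sup>2) * (ennreal (norm l powr a) * indicator (cball 0 k) l) +
           ennreal (norm l powr (a - 2)) * indicator {l. k \<le> norm l} l \<partial>(lborel :: real measure))"
  proof (rule nn_integral_mono)
    fix l :: real
    show "ennreal (if 0 < l then l powr a / (l\<^sup>2 + k\<^sup>2) else 0) \<le>
      ennreal (1 / k\<^sup>2) * (ennreal (norm l powr a) * indicator (cball 0 k) l) +
           ennreal (norm l powr (a - 2)) * indicator {l. k \<le> norm l} l"
    proof (cases "0 < l")
      case l: True
      show ?thesis
      proof (cases "l \<le> k")
        case True
        have "l powr a / (l\<^sup>2 + k\<^sup>2) \<le> l powr a / k\<^sup>2" using k by (intro divide_left_mono) (auto intro!: mult_pos_pos add_nonneg_pos)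
        then have "ennreal (l powr a / (l\<^sup>2 + k\<^sup>2)) \<le> ennreal (1 / k\<^sup>2) * ennreal (norm l powr a)"
          using l by (simp add: ennreal_mult[symmetric])
        then show ?thesis using True l by (simp add: add_increasing2)
      next
        case False
        have "l powr a / (l\<^sup>2 + k\<^sup>2) \<le> l powr a / l\<^sup>2" using l by (intro divide_left_mono) (auto intro!: mult_pos_pos add_pos_nonneg)
        also have "\<dots> = l powr (a - 2)" using l by (simp add: powr_diff)
        finally show ?thesis using False l by (simp add: add_increasing ennreal_leI)
      qed
    qed simp
  qed
  also have "\<dots> = ennreal (1 / k\<^sup>2) * (\<integral>\<^sup>+l. ennreal (norm l powr a) * indicator (cball 0 k) l \<partial>(lborel :: real measure)) +
       (\<integral>\<^sup>+l. ennreal (norm l powr (a - 2)) * indicator {l. k \<le> norm l} l \<partial>(lborel :: real measure))"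
  proof -
    have [measurable]: "cball (0 :: real) k \<in> sets borel" "{l :: real. k \<le> norm l} \<in> sets borel" by auto
    show ?thesis by (subst nn_integral_add) (auto simp: nn_integral_cmult)
  qed
  also have "\<dots> = ennreal (1 / k\<^sup>2) * ennreal (2 / (1 + a) * k powr (1 + a)) + ennreal (2 / (1 - a) * k powr (a - 1))"
  proof -
    have 1: "- real DIM(real) < a" "a - 2 < - real DIM(real)" "0 \<le> k" using a k by auto
    show ?thesis
      unfolding nn_integral_norm_powr_cball[OF 1(1,3)] nn_integral_norm_powr_outside[OF 1(2) k]
      by simp
  qed
  also have "\<dots> = ennreal (1 / k\<^sup>2 * (2 / (1 + a) * k powr (1 + a)) + 2 / (1 - a) * k powr (a - 1))"
    using a by (simp add: ennreal_mult[symmetric] ennreal_plus[symmetric] del: ennreal_plus)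
  also have "1 / k\<^sup>2 * (2 / (1 + a) * k powr (1 + a)) = 2 / (1 + a) * k powr (a - 1)"
  proof -
    have "k powr (1 + a) = k powr (a - 1) * k\<^sup>2" using k powr_add[of k "a - 1" 2] by simp
    then show ?thesis using k by simp
  qed
  finally show ?thesis by (simp add: algebra_simps)
qed

lemma nn_integral_exp_min:
  assumes l: "0 < l" and t: "0 \<le> t"
  shows "(\<integral>\<^sup>+w. ennreal (if w < t then exp (2 * l * min w 0) else 0) \<partial>lborel) \<le> ennreal (t + 1 / (2 * l))"
proof -
  have "(\<integral>\<^sup>+w. ennreal (if w < t then exp (2 * l * min w 0) else 0) \<partial>lborel) \<le>
    (\<integral>\<^sup>+w. indicator {0..t} w + ennreal (exp (2 * l * w)) * indicator {..0} w \<partial>lborel)"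
    by (intro nn_integral_mono) (auto simp: indicator_def min_def)
  also have "\<dots> = ennreal t + (\<integral>\<^sup>+w. ennreal (exp (2 * l * w)) * indicator {..0} w \<partial>lborel)"
    using t by (subst nn_integral_add) auto
  also have "(\<integral>\<^sup>+w. ennreal (exp (2 * l * w)) * indicator {..0} w \<partial>lborel) =
     (\<integral>\<^sup>+w. ennreal (exp (2 * l * (0 + (- 1) * w))) * indicator {..0} (0 + (- 1) * w) \<partial>lborel)"
    by (subst nn_integral_real_affine[where c="- 1" and t=0]) auto
  also have "\<dots> = (\<integral>\<^sup>+w. ennreal (exp (- (2 * l * w))) * indicator {0..} w \<partial>lborel)"
    by (intro nn_integral_cong) (auto simp: indicator_def)
  also have "\<dots> = ennreal (0 - (- (exp (- (2 * l * 0)) / (2 * l))))"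
  proof (rule nn_integral_FTC_atLeast)
    show "((\<lambda>w. - (exp (- (2 * l * w)) / (2 * l))) has_real_derivative exp (- (2 * l * w))) (at w)" for w
      using l by (auto intro!: derivative_eq_intros)
    show "((\<lambda>w. - (exp (- (2 * l * w)) / (2 * l))) \<longlongrightarrow> 0) at_top"
      using l by real_asymp
  qed auto
  also have "ennreal t + \<dots> = ennreal (t + 1 / (2 * l))" using t l by simp
  finally show ?thesis .
qed

text \<open>For \<open>k \<ge> 1\<close> the bound \<open>5/(l\<^sup>2+k\<^sup>2)\<close> on the squared response is integrated: starting times in
  \<open>[0,t]\<close> contribute \<open>k\<^bsup>-1-2H\<^esup>\<close>, negative ones \<open>k\<^bsup>-2-2H\<^esup>\<close>. For \<open>k \<le> 1\<close> the energy is bounded, whereas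
  \<open>k\<^bsup>-1-2H\<^esup> \<ge> 1\<close>.\<close>

lemma wave_energy_upper:
  assumes H: "1/2 < H" "H < 1" and t: "0 < t"
  obtains C where "0 < C" "\<And>k. 0 < k \<Longrightarrow> Re (time_energy H (wave_profile t k)) \<le> C * k powr (- 1 - 2 * H)"
proof -
  define c where "c = 2 / Gamma (2 - 2 * H)"
  have c: "0 < c" using Gamma_real_pos[of "2 - 2 * H"] H by (auto simp: c_def)
  define I1 where "I1 = 2 / (1 + (2 - 2 * H)) + 2 / (1 - (2 - 2 * H))"
  define I2 where "I2 = 2 / (1 + (1 - 2 * H)) + 2 / (1 - (1 - 2 * H))"
  have I: "0 < I1" "0 < I2" unfolding I1_def I2_def using H by (auto intro!: add_pos_pos)
  define C1 where "C1 = c * 5 * (t * I1 + I2 / 2)"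
  define C2 where "C2 = t\<^sup>2 * (fbm_cov H t t / (H * (2 * H - 1)))"
  have C1: "0 < C1" using c I t by (simp add: C1_def add_pos_pos)
  have big: "Re (time_energy H (wave_profile t k)) \<le> C1 * k powr (- 1 - 2 * H)" if k1: "1 \<le> k" for k
  proof -
    have k: "0 < k" using k1 by simp
    have "(\<integral>\<^sup>+l. \<integral>\<^sup>+w. ennreal (if 0 < l \<and> w < t then l powr (2 - 2 * H) / k\<^sup>2 * (wave_response t k l w)\<^sup>2 else 0) \<partial>lborel \<partial>lborel) \<le>
      (\<integral>\<^sup>+l. ennreal (5 * t / k\<^sup>2) * ennreal (if 0 < l then l powr (2 - 2 * H) / (l\<^sup>2 + k\<^sup>2) else 0) +
            ennreal (5 / (2 * k\<^sup>2)) * ennreal (if 0 < l then l powr (1 - 2 * H) / (l\<^sup>2 + k\<^sup>2) else 0) \<partial>lborel)"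
    proof (rule nn_integral_mono)
      fix l :: real
      show "(\<integral>\<^sup>+w. ennreal (if 0 < l \<and> w < t then l powr (2 - 2 * H) / k\<^sup>2 * (wave_response t k l w)\<^sup>2 else 0) \<partial>lborel) \<le>
        ennreal (5 * t / k\<^sup>2) * ennreal (if 0 < l then l powr (2 - 2 * H) / (l\<^sup>2 + k\<^sup>2) else 0) +
            ennreal (5 / (2 * k\<^sup>2)) * ennreal (if 0 < l then l powr (1 - 2 * H) / (l\<^sup>2 + k\<^sup>2) else 0)"
      proof (cases "0 < l")
        case l: True
        define A where "A = l powr (2 - 2 * H) / k\<^sup>2 * (5 / (l\<^sup>2 + k\<^sup>2))"
        have A: "0 \<le> A" by (simp add: A_def)
        have "(\<integral>\<^sup>+w. ennreal (if 0 < l \<and> w < t then l powr (2 - 2 * H) / k\<^sup>2 * (wave_response t k l w)\<^sup>2 else 0) \<partial>lborel) \<le>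
          (\<integral>\<^sup>+w. ennreal A * ennreal (if w < t then exp (2 * l * min w 0) else 0) \<partial>lborel)"
        proof (rule nn_integral_mono)
          fix w :: real
          have "w < t \<Longrightarrow> l powr (2 - 2 * H) / k\<^sup>2 * (wave_response t k l w)\<^sup>2 \<le> A * exp (2 * l * min w 0)"
            using mult_left_mono[OF wave_response_le[OF l k _ less_imp_le[OF t], of w], of "l powr (2 - 2 * H) / k\<^sup>2"]
            by (simp add: A_def mult_ac)
          then show "ennreal (if 0 < l \<and> w < t then l powr (2 - 2 * H) / k\<^sup>2 * (wave_response t k l w)\<^sup>2 else 0) \<le>
            ennreal A * ennreal (if w < t then exp (2 * l * min w 0) else 0)"
            using A l by (auto simp: ennreal_mult[symmetric] intro!: ennreal_leI)
        qed
        also have "\<dots> = ennreal A * (\<integral>\<^sup>+w. ennreal (if w < t then exp (2 * l * min w 0) else 0) \<partial>lborel)"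
          by (rule nn_integral_cmult) measurable
        also have "\<dots> \<le> ennreal A * ennreal (t + 1 / (2 * l))"
          by (intro mult_left_mono nn_integral_exp_min l less_imp_le[OF t]) auto
        also have "\<dots> = ennreal (A * (t + 1 / (2 * l)))" using A l t by (simp add: ennreal_mult)
        also have "A * (t + 1 / (2 * l)) = 5 * t / k\<^sup>2 * (l powr (2 - 2 * H) / (l\<^sup>2 + k\<^sup>2)) +
            5 / (2 * k\<^sup>2) * (l powr (1 - 2 * H) / (l\<^sup>2 + k\<^sup>2))"
        proof -
          have "l powr (2 - 2 * H) = l powr (1 - 2 * H) * l" using l powr_add[of l "1 - 2 * H" 1] by simp
          moreover have "q * l / k\<^sup>2 * (5 / D) * (t + 1 / (2 * l)) = 5 * t / k\<^sup>2 * (q * l / D) + 5 / (2 * k\<^sup>2) * (q / D)"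
            if "D \<noteq> 0" for q D using that l k by (simp add: field_simps)
          moreover have "l\<^sup>2 + k\<^sup>2 \<noteq> 0" using l by (simp add: sum_power2_eq_zero_iff)
          ultimately show ?thesis by (simp only: A_def)
        qed
        also have "ennreal \<dots> = ennreal (5 * t / k\<^sup>2) * ennreal (l powr (2 - 2 * H) / (l\<^sup>2 + k\<^sup>2)) +
            ennreal (5 / (2 * k\<^sup>2)) * ennreal (l powr (1 - 2 * H) / (l\<^sup>2 + k\<^sup>2))"
          using t by (simp add: ennreal_mult[symmetric] ennreal_plus[symmetric] del: ennreal_plus)
        finally show ?thesis using l by simp
      qed simp
    qed
    also have "\<dots> = ennreal (5 * t / k\<^sup>2) * (\<integral>\<^sup>+l. ennreal (if 0 < l then l powr (2 - 2 * H) / (l\<^sup>2 + k\<^sup>2) else 0) \<partial>lborel) +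
            ennreal (5 / (2 * k\<^sup>2)) * (\<integral>\<^sup>+l. ennreal (if 0 < l then l powr (1 - 2 * H) / (l\<^sup>2 + k\<^sup>2) else 0) \<partial>lborel)"
      by (subst nn_integral_add) (auto simp: nn_integral_cmult)
    also have "\<dots> \<le> ennreal (5 * t / k\<^sup>2) * ennreal (I1 * k powr (2 - 2 * H - 1)) + ennreal (5 / (2 * k\<^sup>2)) * ennreal (I2 * k powr (1 - 2 * H - 1))"
      unfolding I1_def I2_def using H k by (intro add_mono mult_left_mono nn_integral_powr_over_quadratic) auto
    also have "\<dots> = ennreal (5 * t / k\<^sup>2 * (I1 * k powr (2 - 2 * H - 1)) + 5 / (2 * k\<^sup>2) * (I2 * k powr (1 - 2 * H - 1)))"
      using t I by (simp add: ennreal_mult[symmetric] ennreal_plus[symmetric] del: ennreal_plus)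
    also have "\<dots> \<le> ennreal (5 * (t * I1 + I2 / 2) * k powr (- 1 - 2 * H))"
    proof (rule ennreal_leI)
      have e1: "k powr (2 - 2 * H - 1) = k powr (- 1 - 2 * H) * k\<^sup>2" using k powr_add[of k "- 1 - 2 * H" 2] by simp
      have "k powr (1 - 2 * H - 1) \<le> k powr (2 - 2 * H - 1)" using k1 by (intro powr_mono) auto
      then have "5 / (2 * k\<^sup>2) * (I2 * k powr (1 - 2 * H - 1)) \<le> 5 / (2 * k\<^sup>2) * (I2 * k powr (2 - 2 * H - 1))"
        using I by (intro mult_left_mono) auto
      then show "5 * t / k\<^sup>2 * (I1 * k powr (2 - 2 * H - 1)) + 5 / (2 * k\<^sup>2) * (I2 * k powr (1 - 2 * H - 1)) \<le>
        5 * (t * I1 + I2 / 2) * k powr (- 1 - 2 * H)"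
        unfolding e1 using k by (simp add: field_simps)
    qed
    finally have "ennreal (Re (time_energy H (wave_profile t k))) \<le> ennreal c * ennreal (5 * (t * I1 + I2 / 2) * k powr (- 1 - 2 * H))"
      unfolding ennreal_wave_energy[OF H less_imp_le[OF t] k] c_def[symmetric] by (rule mult_left_mono) simp
    also have "\<dots> = ennreal (C1 * k powr (- 1 - 2 * H))"
      using c I t by (simp add: C1_def ennreal_mult[symmetric] mult.assoc)
    finally show ?thesis using C1 by (subst (asm) ennreal_le_iff) auto
  qed
  have small: "Re (time_energy H (wave_profile t k)) \<le> \<bar>C2\<bar> * k powr (- 1 - 2 * H)" if k: "0 < k" "k \<le> 1" for k
  proof -
    have "1 = 1 powr (- 1 - 2 * H)" by simp
    also have "\<dots> \<le> k powr (- 1 - 2 * H)" using k H by (intro powr_mono2') auto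
    finally have "\<bar>C2\<bar> * 1 \<le> \<bar>C2\<bar> * k powr (- 1 - 2 * H)" by (intro mult_left_mono) auto
    moreover have "Re (time_energy H (wave_profile t k)) \<le> C2"
      unfolding C2_def by (rule wave_profile_admissible(2)[OF H(1) less_imp_le[OF t] k(1)])
    ultimately show ?thesis by linarith
  qed
  show ?thesis
  proof (rule that[of "C1 + \<bar>C2\<bar>"])
    show "0 < C1 + \<bar>C2\<bar>" using C1 by simp
    fix k :: real assume k: "0 < k"
    have "0 \<le> C1 * k powr (- 1 - 2 * H)" "0 \<le> \<bar>C2\<bar> * k powr (- 1 - 2 * H)" using C1 by auto
    then show "Re (time_energy H (wave_profile t k)) \<le> (C1 + \<bar>C2\<bar>) * k powr (- 1 - 2 * H)"
      using big[of k] small[OF k] unfolding distrib_right by linarith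
  qed
qed

text \<open>Up to the factor \<open>1/(l\<^sup>2+k\<^sup>2)\<close> the response is an oscillation of squared amplitude \<open>l\<^sup>2+k\<^sup>2\<close> plus a
  decaying exponential. Over \<open>[0,t]\<close> the square of the oscillation averages to half of its squared
  amplitude, which dominates the other terms, all of the order \<open>k\<close>, as soon as \<open>k t \<ge> 8\<close>.\<close>

lemma wave_response_square_integral_ge:
  assumes t: "0 < t" and k: "8 / t \<le> k" and l: "k \<le> l" "l \<le> 2 * k"
  shows "t / (100 * k\<^sup>2) \<le> integral {0..t} (\<lambda>w. (wave_response t k l w)\<^sup>2)"
    and "(\<lambda>w. (wave_response t k l w)\<^sup>2) integrable_on {0..t}"
proof -
  have "0 < 8 / t" using t by simp
  then have k0: "0 < k" using k by linarith
  have l0: "0 < l" using k0 l by simp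
  define D where "D = l\<^sup>2 + k\<^sup>2"
  have D0: "0 < D" using k0 l0 by (simp add: D_def add_pos_pos)
  have "l\<^sup>2 \<le> (2 * k)\<^sup>2" using l l0 by (intro power_mono) auto
  then have D5: "D \<le> 5 * k\<^sup>2" by (simp add: D_def)
  define S where "S w = (k * exp (- (l * (t - w))) + l * sin ((t - w) * k) - k * cos ((t - w) * k))" for w
  have resp: "(wave_response t k l w)\<^sup>2 = (S w)\<^sup>2 / D\<^sup>2" if "w \<in> {0..t}" for w
    using that by (simp add: wave_response_def S_def D_def power_divide)
  have contS: "continuous_on {0..t} (\<lambda>w. (S w)\<^sup>2 / D\<^sup>2)"
    unfolding S_def using D0 by (intro continuous_intros) auto
  have intS: "(\<lambda>w. (S w)\<^sup>2 / D\<^sup>2) integrable_on {0..t}"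
    by (rule integrable_continuous_real[OF contS])
  then show "(\<lambda>w. (wave_response t k l w)\<^sup>2) integrable_on {0..t}"
    by (rule integrable_eq) (simp add: resp)
  \<comment> \<open>\<open>L\<close> is the lower bound \<open>(g\<^sup>2/2 - e\<^sup>2)/D\<^sup>2\<close> for the squared sum of an oscillation \<open>g\<close> and an
    exponential \<open>e\<close>, with \<open>g\<^sup>2\<close> expressed by double angles; \<open>M\<close> is its antiderivative.\<close>
  define L where "L w = (D / 4 + (k\<^sup>2 - l\<^sup>2) / 4 * cos (2 * k * (t - w)) - l * k / 2 * sin (2 * k * (t - w))
      - k\<^sup>2 * exp (- (2 * l * (t - w)))) / D\<^sup>2" for w
  define M where "M w = (D / 4 * w - (k\<^sup>2 - l\<^sup>2) / (8 * k) * sin (2 * k * (t - w)) - l / 4 * cos (2 * k * (t - w))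
      - k\<^sup>2 / (2 * l) * exp (- (2 * l * (t - w)))) / D\<^sup>2" for w
  have LS: "L w \<le> (S w)\<^sup>2 / D\<^sup>2" for w
  proof -
    define g where "g = l * sin ((t - w) * k) - k * cos ((t - w) * k)"
    define e where "e = k * exp (- (l * (t - w)))"
    have sc: "sin ((t - w) * k) * sin ((t - w) * k) = (1 - cos (2 * ((t - w) * k))) / 2"
      "cos ((t - w) * k) * cos ((t - w) * k) = (1 + cos (2 * ((t - w) * k))) / 2"
      "2 * (sin ((t - w) * k) * cos ((t - w) * k)) = sin (2 * ((t - w) * k))"
      using cos_double_sin[of "(t - w) * k"] cos_double_cos[of "(t - w) * k"] sin_double[of "(t - w) * k"]
      by (simp_all add: power2_eq_square)
    have "g\<^sup>2 = l\<^sup>2 * (sin ((t - w) * k) * sin ((t - w) * k)) + k\<^sup>2 * (cos ((t - w) * k) * cos ((t - w) * k)) -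
        l * k * (2 * (sin ((t - w) * k) * cos ((t - w) * k)))"
      by (simp add: g_def power2_eq_square algebra_simps)
    then have g2: "g\<^sup>2 / 2 = D / 4 + (k\<^sup>2 - l\<^sup>2) / 4 * cos (2 * k * (t - w)) - l * k / 2 * sin (2 * k * (t - w))"
      unfolding sc by (simp add: D_def field_simps)
    have e2: "e\<^sup>2 = k\<^sup>2 * exp (- (2 * l * (t - w)))"
      by (simp add: e_def power_mult_distrib exp_double[symmetric])
    have "0 \<le> (g + 2 * e)\<^sup>2" by (rule zero_le_power2)
    then have "g\<^sup>2 / 2 - e\<^sup>2 \<le> (e + g)\<^sup>2" by (simp add: power2_eq_square algebra_simps)
    moreover have "S w = e + g" by (simp add: S_def e_def g_def)
    ultimately show ?thesis unfolding L_def g2[symmetric] e2[symmetric] by (intro divide_right_mono) auto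
  qed
  have "(M has_real_derivative L w) (at w)" for w
  proof -
    have 1: "((\<lambda>w. D / 4 * w) has_real_derivative D / 4) (at w)"
      by (auto intro!: derivative_eq_intros)
    have 2: "((\<lambda>w. (k\<^sup>2 - l\<^sup>2) / (8 * k) * sin (2 * k * (t - w))) has_real_derivative
        - ((k\<^sup>2 - l\<^sup>2) / 4 * cos (2 * k * (t - w)))) (at w)"
      using k0 by (auto intro!: derivative_eq_intros)
    have 3: "((\<lambda>w. l / 4 * cos (2 * k * (t - w))) has_real_derivative l * k / 2 * sin (2 * k * (t - w))) (at w)"
      by (auto intro!: derivative_eq_intros)
    have 4: "((\<lambda>w. k\<^sup>2 / (2 * l) * exp (- (2 * l * (t - w)))) has_real_derivative k\<^sup>2 * exp (- (2 * l * (t - w)))) (at w)"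
      using l0 by (auto intro!: derivative_eq_intros)
    have "(M has_real_derivative (D / 4 - - ((k\<^sup>2 - l\<^sup>2) / 4 * cos (2 * k * (t - w))) - l * k / 2 * sin (2 * k * (t - w))
        - k\<^sup>2 * exp (- (2 * l * (t - w)))) / D\<^sup>2) (at w)"
      unfolding M_def by (intro DERIV_cdivide DERIV_diff 1 2 3 4)
    then show ?thesis by (simp add: L_def)
  qed
  then have "(L has_integral M t - M 0) {0..t}"
    using t by (intro fundamental_theorem_of_calculus)
      (auto simp: has_real_derivative_iff_has_vector_derivative[symmetric] intro: has_field_derivative_at_within)
  then have ge: "M t - M 0 \<le> integral {0..t} (\<lambda>w. (S w)\<^sup>2 / D\<^sup>2)"
    by (rule has_integral_le[OF _ integrable_integral[OF intS]]) (use LS in auto)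
  have low: "k\<^sup>2 * t / 4 / D\<^sup>2 \<le> M t - M 0"
  proof -
    define s co ex where "s = sin (2 * k * t)" and "co = cos (2 * k * t)" and "ex = exp (- (2 * l * t))"
    have "- ((l\<^sup>2 - k\<^sup>2) / (8 * k)) \<le> (k\<^sup>2 - l\<^sup>2) / (8 * k) * s"
    proof -
      have "0 \<le> (l\<^sup>2 - k\<^sup>2) / (8 * k)" using l k0 by (simp add: power_mono)
      then have "(l\<^sup>2 - k\<^sup>2) / (8 * k) * s \<le> (l\<^sup>2 - k\<^sup>2) / (8 * k) * 1" unfolding s_def by (intro mult_left_mono) auto
      moreover have "(k\<^sup>2 - l\<^sup>2) / (8 * k) * s = - ((l\<^sup>2 - k\<^sup>2) / (8 * k) * s)"
        by (simp add: algebra_simps diff_divide_distrib)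
      ultimately show ?thesis by linarith
    qed
    moreover have "(l\<^sup>2 - k\<^sup>2) / (8 * k) \<le> k / 2"
    proof -
      have "l\<^sup>2 \<le> 5 * k\<^sup>2"
      proof -
        have "l\<^sup>2 \<le> 4 * k\<^sup>2" using \<open>l\<^sup>2 \<le> (2 * k)\<^sup>2\<close> by (simp add: power_mult_distrib)
        then show ?thesis using zero_le_power2[of k] by linarith
      qed
      then show ?thesis using k0 by (simp add: field_simps power2_eq_square)
    qed
    moreover have "- (l / 4) \<le> l / 4 * co"
    proof -
      have "l / 4 * (- 1) \<le> l / 4 * co" unfolding co_def using l0 by (intro mult_left_mono) auto
      then show ?thesis by simp
    qed
    moreover have "k\<^sup>2 / (2 * l) \<le> k / 2"
      using l l0 k0 by (simp add: field_simps power2_eq_square)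
    moreover have "0 \<le> k\<^sup>2 / (2 * l) * ex" using l0 by (simp add: ex_def)
    moreover have "k\<^sup>2 * t / 2 \<le> D / 4 * t"
    proof -
      have "k\<^sup>2 \<le> l\<^sup>2" using l k0 by (intro power_mono) auto
      then have "2 * k\<^sup>2 * t \<le> D * t" using t by (intro mult_right_mono) (auto simp: D_def)
      then show ?thesis by (simp add: mult_ac)
    qed
    moreover have "2 * k \<le> k\<^sup>2 * t / 4"
    proof -
      have "8 \<le> k * t" using k t by (simp add: field_simps)
      then have "8 * k \<le> k * t * k" using k0 by (intro mult_right_mono) auto
      then show ?thesis by (simp add: power2_eq_square mult_ac)
    qed
    ultimately have "k\<^sup>2 * t / 4 \<le> D / 4 * t - l / 4 - k\<^sup>2 / (2 * l) + (k\<^sup>2 - l\<^sup>2) / (8 * k) * s + l / 4 * co + k\<^sup>2 / (2 * l) * ex"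
      using l by linarith
    then have "k\<^sup>2 * t / 4 / D\<^sup>2 \<le> (D / 4 * t - l / 4 - k\<^sup>2 / (2 * l) + (k\<^sup>2 - l\<^sup>2) / (8 * k) * s + l / 4 * co + k\<^sup>2 / (2 * l) * ex) / D\<^sup>2"
      by (intro divide_right_mono) auto
    also have "\<dots> = M t - M 0"
      by (simp add: M_def s_def co_def ex_def diff_divide_distrib add_divide_distrib)
    finally show ?thesis .
  qed
  have "t / (100 * k\<^sup>2) = k\<^sup>2 * t / 4 / (5 * k\<^sup>2)\<^sup>2"
    using k0 by (simp add: field_simps power2_eq_square)
  also have "\<dots> \<le> k\<^sup>2 * t / 4 / D\<^sup>2"
    using D0 D5 t k0 by (intro divide_left_mono power_mono) auto
  also note low
  also note ge
  also have "integral {0..t} (\<lambda>w. (S w)\<^sup>2 / D\<^sup>2) = integral {0..t} (\<lambda>w. (wave_response t k l w)\<^sup>2)"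
    by (intro integral_cong) (simp add: resp)
  finally show "t / (100 * k\<^sup>2) \<le> integral {0..t} (\<lambda>w. (wave_response t k l w)\<^sup>2)" .
qed

text \<open>It suffices to keep the exponentials with rates in \<open>[k,2k]\<close> and starting times in \<open>[0,t]\<close>.\<close>

lemma wave_energy_lower:
  assumes H: "1/2 < H" "H < 1" and t: "0 < t"
  obtains C where "0 < C" "\<And>k. 8 / t \<le> k \<Longrightarrow> C * k powr (- 1 - 2 * H) \<le> Re (time_energy H (wave_profile t k))"
proof -
  define c where "c = 2 / Gamma (2 - 2 * H)"
  have c: "0 < c" using Gamma_real_pos[of "2 - 2 * H"] H by (auto simp: c_def)
  define C where "C = c * t / 100"
  have C: "0 < C" using c t by (simp add: C_def)
  have "C * k powr (- 1 - 2 * H) \<le> Re (time_energy H (wave_profile t k))" if k: "8 / t \<le> k" for k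
  proof -
    have "0 < 8 / t" using t by simp
  then have k0: "0 < k" using k by linarith
    define B where "B = k powr (2 - 2 * H) / k\<^sup>2 * (t / (100 * k\<^sup>2))"
    have B: "0 \<le> B" using t by (simp add: B_def)
    have "ennreal (B * k) = (\<integral>\<^sup>+l. ennreal B * indicator {k..2 * k} l \<partial>lborel)"
      using B k0 by (simp add: nn_integral_cmult_indicator ennreal_mult)
    also have "\<dots> \<le> (\<integral>\<^sup>+l. \<integral>\<^sup>+w. ennreal (if 0 < l \<and> w < t then l powr (2 - 2 * H) / k\<^sup>2 * (wave_response t k l w)\<^sup>2 else 0) \<partial>lborel \<partial>lborel)"
    proof (rule nn_integral_mono)
      fix l :: real
      show "ennreal B * indicator {k..2 * k} l \<le> (\<integral>\<^sup>+w. ennreal (if 0 < l \<and> w < t then l powr (2 - 2 * H) / k\<^sup>2 * (wave_response t k l w)\<^sup>2 else 0) \<partial>lborel)"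
      proof (cases "l \<in> {k..2 * k}")
        case True
        then have l: "k \<le> l" "l \<le> 2 * k" "0 < l" using k0 by auto
        note R = wave_response_square_integral_ge[OF t k l(1,2)]
        have "ennreal (t / (100 * k\<^sup>2)) \<le> ennreal (integral {0..t} (\<lambda>w. (wave_response t k l w)\<^sup>2))"
          by (rule ennreal_leI[OF R(1)])
        also have "\<dots> = (\<integral>\<^sup>+w. ennreal ((wave_response t k l w)\<^sup>2) * indicator {0..t} w \<partial>lborel)"
          by (rule nn_integral_has_integral_lebesgue'[symmetric]) (auto intro: integrable_integral R(2))
        finally have 1: "ennreal (t / (100 * k\<^sup>2)) \<le> \<dots>" .
        have "ennreal B \<le> ennreal (l powr (2 - 2 * H) / k\<^sup>2) * ennreal (t / (100 * k\<^sup>2))"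
          unfolding B_def using l k0 t H
          by (subst ennreal_mult[symmetric]) (auto intro!: ennreal_leI mult_right_mono divide_right_mono powr_mono2)
        also have "\<dots> \<le> ennreal (l powr (2 - 2 * H) / k\<^sup>2) * (\<integral>\<^sup>+w. ennreal ((wave_response t k l w)\<^sup>2) * indicator {0..t} w \<partial>lborel)"
          by (rule mult_left_mono[OF 1]) simp
        also have "\<dots> = (\<integral>\<^sup>+w. ennreal (l powr (2 - 2 * H) / k\<^sup>2) * (ennreal ((wave_response t k l w)\<^sup>2) * indicator {0..t} w) \<partial>lborel)"
          by (rule nn_integral_cmult[symmetric]) measurable
        also have "\<dots> \<le> (\<integral>\<^sup>+w. ennreal (if 0 < l \<and> w < t then l powr (2 - 2 * H) / k\<^sup>2 * (wave_response t k l w)\<^sup>2 else 0) \<partial>lborel)"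
        proof (rule nn_integral_mono_AE)
          show "AE w in lborel. ennreal (l powr (2 - 2 * H) / k\<^sup>2) * (ennreal ((wave_response t k l w)\<^sup>2) * indicator {0..t} w) \<le>
            ennreal (if 0 < l \<and> w < t then l powr (2 - 2 * H) / k\<^sup>2 * (wave_response t k l w)\<^sup>2 else 0)"
            using AE_lborel_singleton[of t]
            by eventually_elim (use l in \<open>auto simp: indicator_def simp flip: ennreal_mult\<close>)
        qed
        finally show ?thesis using True by simp
      qed simp
    qed
    finally have "ennreal c * ennreal (B * k) \<le> ennreal (Re (time_energy H (wave_profile t k)))"
      unfolding ennreal_wave_energy[OF H less_imp_le[OF t] k0] c_def[symmetric] by (rule mult_left_mono) simp
    then have "ennreal (c * (B * k)) \<le> ennreal (Re (time_energy H (wave_profile t k)))"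
      using c B k0 by (simp add: ennreal_mult)
    then have "c * (B * k) \<le> Re (time_energy H (wave_profile t k))"
      using time_energy_nonneg[OF H wave_profile_admissible(1)[OF H(1) less_imp_le[OF t] k0]] by simp
    moreover have "c * (B * k) = C * k powr (- 1 - 2 * H)"
    proof -
      have "k powr (2 - 2 * H) = k powr (- 1 - 2 * H) * k ^ 3" using k0 powr_add[of k "- 1 - 2 * H" 3] by simp
      then show ?thesis using k0 by (simp add: B_def C_def power2_eq_square power3_eq_cube)
    qed
    ultimately show ?thesis by simp
  qed
  then show ?thesis using that C by blast
qed

section \<open>The spatial increments\<close>

definition phase_diff :: "'a::euclidean_space \<Rightarrow> 'a \<Rightarrow> 'a \<Rightarrow> complex" where
  "phase_diff x y \<xi> = exp (- \<i> * complex_of_real (\<xi> \<bullet> x)) - exp (- \<i> * complex_of_real (\<xi> \<bullet> y))"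

lemma norm_phase_diff: "(norm (phase_diff x y \<xi>))\<^sup>2 = 2 - 2 * cos (\<xi> \<bullet> (x - y))"
proof -
  let ?a = "\<xi> \<bullet> x" and ?b = "\<xi> \<bullet> y"
  have "phase_diff x y \<xi> = cis (- ?a) - cis (- ?b)" by (simp add: phase_diff_def cis_conv_exp)
  then have "(norm (phase_diff x y \<xi>))\<^sup>2 = (cos ?a - cos ?b)\<^sup>2 + (sin ?b - sin ?a)\<^sup>2"
    by (simp add: cmod_power2)
  also have "\<dots> = ((sin ?a)\<^sup>2 + (cos ?a)\<^sup>2) + ((sin ?b)\<^sup>2 + (cos ?b)\<^sup>2) - 2 * (cos ?a * cos ?b + sin ?a * sin ?b)"
    by (simp add: power2_eq_square algebra_simps)
  also have "\<dots> = 2 - 2 * cos (?a - ?b)" by (simp only: sin_cos_squared_add cos_diff)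
  finally show ?thesis by (simp add: inner_diff_right)
qed

lemma norm_phase_diff_le:
  "(norm (phase_diff x y \<xi>))\<^sup>2 \<le> 4"
  "(norm (phase_diff x y \<xi>))\<^sup>2 \<le> (norm \<xi>)\<^sup>2 * (norm (x - y))\<^sup>2"
proof -
  show "(norm (phase_diff x y \<xi>))\<^sup>2 \<le> 4"
    unfolding norm_phase_diff using cos_ge_minus_one[of "\<xi> \<bullet> (x - y)"] by linarith
  let ?s = "\<xi> \<bullet> (x - y)"
  have "cos ?s = 1 - 2 * (sin (?s / 2))\<^sup>2" using cos_double_sin[of "?s / 2"] by simp
  then have "2 - 2 * cos ?s = 4 * (sin (?s / 2))\<^sup>2" by simp
  also have "(sin (?s / 2))\<^sup>2 \<le> (?s / 2)\<^sup>2"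
    using abs_sin_x_le_abs_x[of "?s / 2"] by (simp only: abs_le_square_iff)
  then have "4 * (sin (?s / 2))\<^sup>2 \<le> ?s\<^sup>2" by (simp add: power_divide)
  also have "?s\<^sup>2 \<le> (norm \<xi> * norm (x - y))\<^sup>2"
    using Cauchy_Schwarz_ineq2[of \<xi> "x - y"] by (intro power2_le_iff_abs_le[THEN iffD2]) auto
  finally show "(norm (phase_diff x y \<xi>))\<^sup>2 \<le> (norm \<xi>)\<^sup>2 * (norm (x - y))\<^sup>2"
    by (simp add: norm_phase_diff power_mult_distrib)
qed

lemma time_energy_cmult: "time_energy H (\<lambda>r. a * \<phi> r) = complex_of_real ((norm a)\<^sup>2) * time_energy H \<phi>"
proof -
  have "time_energy H (\<lambda>r. a * \<phi> r) = (LINT r:{0..}|lborel. LINT v:{0..}|lborel.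
     (a * cnj a) * (\<phi> r * cnj (\<phi> v) * complex_of_real (\<bar>r - v\<bar> powr (2 * H - 2))))"
    unfolding time_energy_def by (simp add: mult_ac)
  also have "\<dots> = (a * cnj a) * time_energy H \<phi>"
    unfolding time_energy_def by (simp only: set_integral_mult_right)
  finally show ?thesis by (simp only: complex_norm_square)
qed

lemma wave_integrand_diff:
  "wave_integrand_fourier t x r \<xi> - wave_integrand_fourier t y r \<xi> = phase_diff x y \<xi> * wave_profile t (norm \<xi>) r"
  by (cases "r \<in> {0..t}")
    (simp_all add: wave_integrand_fourier_def phase_diff_def wave_profile_def wave_fourier_def algebra_simps diff_divide_distrib)

text \<open>The frequency integral of the mean square increment, without the factor \<open>H(2H-1)\<close>.\<close>

definition increment_integral :: "real \<Rightarrow> real \<Rightarrow> real \<Rightarrow> 'a::euclidean_space \<Rightarrow> 'a \<Rightarrow> ennreal" where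
  "increment_integral H \<beta> t x y = (\<integral>\<^sup>+\<xi>. ennreal (norm \<xi> powr (- real DIM('a) + \<beta>)) *
       ennreal ((norm (phase_diff x y \<xi>))\<^sup>2 * Re (time_energy H (wave_profile t (norm \<xi>)))) \<partial>lborel)"

lemma increment_energy:
  assumes H: "1/2 < H" "H < 1"
    and adm: "hp_admissible H \<beta> (\<lambda>r \<xi>. wave_integrand_fourier t x r \<xi> - wave_integrand_fourier t y r (\<xi> :: 'a::euclidean_space))"
  shows "ennreal ((hp_norm H \<beta> (\<lambda>r \<xi>. wave_integrand_fourier t x r \<xi> - wave_integrand_fourier t y r (\<xi> :: 'a)))\<^sup>2) =
    ennreal (H * (2 * H - 1)) * increment_integral H \<beta> t x y"
proof -
  let ?D = "\<lambda>r \<xi>. wave_integrand_fourier t x r \<xi> - wave_integrand_fourier t y r (\<xi> :: 'a)"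
  let ?E = "\<lambda>\<xi>::'a. Re (time_energy H (\<lambda>r. ?D r \<xi>))"
  have E: "?E \<xi> = (norm (phase_diff x y \<xi>))\<^sup>2 * Re (time_energy H (wave_profile t (norm \<xi>)))" for \<xi>
    unfolding wave_integrand_diff time_energy_cmult by simp
  have int: "integrable (riesz_measure \<beta>) ?E" using adm by (simp add: hp_admissible_iff)
  have pos: "AE \<xi> in riesz_measure \<beta>. 0 \<le> ?E \<xi>"
    using adm time_energy_nonneg[OF H] unfolding hp_admissible_iff by (auto elim!: eventually_mono)
  have "case_prod ?D \<in> borel_measurable (borel \<Otimes>\<^sub>M borel)" using adm by (simp add: hp_admissible_iff)
  from borel_measurable_time_energy[OF this, of H]
  have [measurable]: "?E \<in> borel_measurable borel" by measurable
  have "ennreal ((hp_norm H \<beta> ?D)\<^sup>2) = ennreal (H * (2 * H - 1)) * ennreal (LINT \<xi>|riesz_measure \<beta>. ?E \<xi>)"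
    unfolding hp_norm_sq[OF H adm] using H by (intro ennreal_mult') simp
  also have "ennreal (LINT \<xi>|riesz_measure \<beta>. ?E \<xi>) = (\<integral>\<^sup>+\<xi>. ennreal (?E \<xi>) \<partial>riesz_measure \<beta>)"
    by (rule nn_integral_eq_integral[OF int pos, symmetric])
  also have "\<dots> = (\<integral>\<^sup>+\<xi>. ennreal (norm \<xi> powr (- real DIM('a) + \<beta>)) * ennreal (?E \<xi>) \<partial>lborel)"
    by (rule nn_integral_riesz_measure) measurable
  finally show ?thesis unfolding E increment_integral_def .
qed

text \<open>The phase factor is bounded by \<open>|\<xi>|\<^sup>2|x-y|\<^sup>2\<close> for \<open>|\<xi>| \<le> 1/|x-y|\<close> and by \<open>4\<close> beyond; both regions
  contribute the same power of \<open>|x-y|\<close>.\<close>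

lemma increment_integral_upper:
  fixes x y :: "'a::euclidean_space"
  assumes H: "1/2 < H" "H < 1" and t: "0 < t" and \<beta>: "2 * H - 1 < \<beta>" "\<beta> < 2 * H + 1"
  obtains C where "0 < C" "\<And>x y :: 'a. x \<noteq> y \<Longrightarrow>
     increment_integral H \<beta> t x y
     \<le> ennreal (C * norm (x - y) powr (2 * H + 1 - \<beta>))"
proof -
  obtain C0 where C0: "0 < C0" "\<And>k. 0 < k \<Longrightarrow> Re (time_energy H (wave_profile t k)) \<le> C0 * k powr (- 1 - 2 * H)"
    using wave_energy_upper[OF H t] by blast
  let ?d = "DIM('a)"
  define v where "v = real ?d * unit_ball_vol (real ?d)"
  have v: "0 < v" by (simp add: v_def)
  define e where "e = - real ?d + \<beta> - 1 - 2 * H"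
  have e: "- real ?d < e + 2" "e < - real ?d" using \<beta> by (auto simp: e_def)
  define C where "C = C0 * (v / (\<beta> + 1 - 2 * H)) + 4 * C0 * (v / (2 * H + 1 - \<beta>))"
  have C: "0 < C" unfolding C_def using C0 v \<beta> by (intro add_pos_pos mult_pos_pos divide_pos_pos) auto
  have "increment_integral H \<beta> t x y
     \<le> ennreal (C * norm (x - y) powr (2 * H + 1 - \<beta>))" if xy: "x \<noteq> y" for x y :: 'a
  proof -
    define z where "z = norm (x - y)"
    have z: "0 < z" using xy by (simp add: z_def)
    have "increment_integral H \<beta> t x y \<le>
      (\<integral>\<^sup>+\<xi>. ennreal (C0 * z\<^sup>2) * (ennreal (norm \<xi> powr (e + 2)) * indicator (cball 0 (1 / z)) \<xi>) +
          ennreal (4 * C0) * (ennreal (norm \<xi> powr e) * indicator {\<xi>. 1 / z \<le> norm \<xi>} \<xi>) \<partial>(lborel :: 'a measure))"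
      unfolding increment_integral_def
    proof (rule nn_integral_mono_AE, rule AE_mp[OF AE_lborel_singleton[of 0]], rule AE_I2, rule impI)
      fix \<xi> :: 'a assume "\<xi> \<noteq> 0"
      then have n: "0 < norm \<xi>" by simp
      let ?h = "(norm (phase_diff x y \<xi>))\<^sup>2"
      have "norm \<xi> powr (- real ?d + \<beta>) * (?h * Re (time_energy H (wave_profile t (norm \<xi>)))) \<le>
        norm \<xi> powr (- real ?d + \<beta>) * (?h * (C0 * norm \<xi> powr (- 1 - 2 * H)))"
        by (intro mult_left_mono C0(2) n) auto
      also have "\<dots> = ?h * (C0 * norm \<xi> powr e)"
      proof -
        have "norm \<xi> powr (- real ?d + \<beta>) * norm \<xi> powr (- 1 - 2 * H) = norm \<xi> powr e"
          unfolding powr_add[symmetric] by (rule arg_cong[where f="(powr) (norm \<xi>)"]) (simp add: e_def)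
        then show ?thesis by (metis mult.assoc mult.left_commute)
      qed
      finally have le: "norm \<xi> powr (- real ?d + \<beta>) * (?h * Re (time_energy H (wave_profile t (norm \<xi>)))) \<le> ?h * (C0 * norm \<xi> powr e)" .
      have lowfreq: "?h * (C0 * norm \<xi> powr e) \<le> C0 * z\<^sup>2 * norm \<xi> powr (e + 2)"
      proof -
        have "?h * (C0 * norm \<xi> powr e) \<le> ((norm \<xi>)\<^sup>2 * z\<^sup>2) * (C0 * norm \<xi> powr e)"
          unfolding z_def using C0 by (intro mult_right_mono norm_phase_diff_le) auto
        also have "\<dots> = C0 * z\<^sup>2 * norm \<xi> powr (e + 2)" using n powr_add[of "norm \<xi>" e 2] by simp
        finally show ?thesis .
      qed
      have highfreq: "?h * (C0 * norm \<xi> powr e) \<le> 4 * C0 * norm \<xi> powr e"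
        using mult_right_mono[OF norm_phase_diff_le(1), of "C0 * norm \<xi> powr e" x y \<xi>] C0 by simp
      have prod: "ennreal (norm \<xi> powr (- real ?d + \<beta>)) * ennreal (?h * Re (time_energy H (wave_profile t (norm \<xi>)))) =
        ennreal (norm \<xi> powr (- real ?d + \<beta>) * (?h * Re (time_energy H (wave_profile t (norm \<xi>)))))"
        by (rule ennreal_mult'[symmetric]) simp
      show "ennreal (norm \<xi> powr (- real ?d + \<beta>)) * ennreal (?h * Re (time_energy H (wave_profile t (norm \<xi>)))) \<le>
        ennreal (C0 * z\<^sup>2) * (ennreal (norm \<xi> powr (e + 2)) * indicator (cball 0 (1 / z)) \<xi>) +
          ennreal (4 * C0) * (ennreal (norm \<xi> powr e) * indicator {\<xi>. 1 / z \<le> norm \<xi>} \<xi>)"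
      proof (cases "norm \<xi> \<le> 1 / z")
        case True
        have "ennreal (norm \<xi> powr (- real ?d + \<beta>) * (?h * Re (time_energy H (wave_profile t (norm \<xi>))))) \<le>
          ennreal (C0 * z\<^sup>2 * norm \<xi> powr (e + 2))" by (rule ennreal_leI[OF order_trans[OF le lowfreq]])
        also have "\<dots> = ennreal (C0 * z\<^sup>2) * (ennreal (norm \<xi> powr (e + 2)) * indicator (cball 0 (1 / z)) \<xi>)"
          using True C0(1) by (simp add: ennreal_mult)
        finally show ?thesis unfolding prod by (rule add_increasing2[rotated]) simp
      next
        case False
        have "ennreal (norm \<xi> powr (- real ?d + \<beta>) * (?h * Re (time_energy H (wave_profile t (norm \<xi>))))) \<le>
          ennreal (4 * C0 * norm \<xi> powr e)" by (rule ennreal_leI[OF order_trans[OF le highfreq]])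
        also have "\<dots> = ennreal (4 * C0) * (ennreal (norm \<xi> powr e) * indicator {\<xi>. 1 / z \<le> norm \<xi>} \<xi>)"
          using False C0(1) by (simp add: ennreal_mult)
        finally show ?thesis unfolding prod by (rule add_increasing[rotated]) simp
      qed
    qed
    also have "\<dots> = ennreal (C0 * z\<^sup>2) * (\<integral>\<^sup>+\<xi>. ennreal (norm \<xi> powr (e + 2)) * indicator (cball 0 (1 / z)) \<xi> \<partial>(lborel :: 'a measure)) +
          ennreal (4 * C0) * (\<integral>\<^sup>+\<xi>. ennreal (norm \<xi> powr e) * indicator {\<xi>. 1 / z \<le> norm \<xi>} \<xi> \<partial>(lborel :: 'a measure))"
    proof -
      have [measurable]: "cball (0 :: 'a) (1 / z) \<in> sets borel" "{\<xi> :: 'a. 1 / z \<le> norm \<xi>} \<in> sets borel" by auto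
      show ?thesis by (subst nn_integral_add) (auto simp: nn_integral_cmult)
    qed
    also have "\<dots> = ennreal (C0 * z\<^sup>2) * ennreal (v / (real ?d + (e + 2)) * (1 / z) powr (real ?d + (e + 2))) +
       ennreal (4 * C0) * ennreal (v / (- (real ?d + e)) * (1 / z) powr (real ?d + e))"
    proof -
      have "0 \<le> 1 / z" "0 < 1 / z" using z by auto
      then show ?thesis unfolding v_def
        by (simp only: nn_integral_norm_powr_cball[OF e(1)] nn_integral_norm_powr_outside[OF e(2)])
    qed
    also have "\<dots> = ennreal (C0 * z\<^sup>2 * (v / (\<beta> + 1 - 2 * H) * (1 / z) powr (\<beta> + 1 - 2 * H)) +
         4 * C0 * (v / (2 * H + 1 - \<beta>) * (1 / z) powr (\<beta> - 1 - 2 * H)))"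
    proof -
      have "real ?d + (e + 2) = \<beta> + 1 - 2 * H" "real ?d + e = \<beta> - 1 - 2 * H" "- (\<beta> - 1 - 2 * H) = 2 * H + 1 - \<beta>"
        by (auto simp: e_def)
      then show ?thesis using C0 v \<beta> by (simp only:) (simp add: ennreal_mult[symmetric] flip: ennreal_plus)
    qed
    also have "C0 * z\<^sup>2 * (v / (\<beta> + 1 - 2 * H) * (1 / z) powr (\<beta> + 1 - 2 * H)) +
         4 * C0 * (v / (2 * H + 1 - \<beta>) * (1 / z) powr (\<beta> - 1 - 2 * H)) = C * z powr (2 * H + 1 - \<beta>)"
    proof -
      have i: "(1 / z) powr a = z powr (- a)" for a using z by (simp add: powr_minus_divide powr_divide)
      have "z powr (2 * H + 1 - \<beta>) = z powr (- (\<beta> + 1 - 2 * H)) * z\<^sup>2"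
      proof -
        have "2 * H + 1 - \<beta> = - (\<beta> + 1 - 2 * H) + 2" by simp
        then show ?thesis using z by (simp only: powr_add) simp
      qed
      moreover have "(1 / z) powr (\<beta> - 1 - 2 * H) = z powr (2 * H + 1 - \<beta>)"
        unfolding i by (rule arg_cong[where f="(powr) z"]) simp
      moreover have "(1 / z) powr (\<beta> + 1 - 2 * H) = z powr (- (\<beta> + 1 - 2 * H))" by (rule i)
      ultimately show ?thesis by (simp add: C_def algebra_simps)
    qed
    finally show ?thesis by (simp add: z_def)
  qed
  then show ?thesis using that C by blast
qed

text \<open>On the ball around \<open>R (x-y)/|x-y|\<^sup>2\<close> with radius \<open>1/(2|x-y|)\<close> the phase \<open>\<xi>\<bullet>(x-y)\<close> differs from \<open>R\<close> by
  at most \<open>1/2\<close>. For an odd multiple \<open>R\<close> of \<open>\<pi>\<close> the phase factor is at least \<open>2\<close> there, \<open>|\<xi>|\<close> is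
  of the order \<open>1/|x-y|\<close>, and the volume of the ball supplies the missing power of \<open>|x-y|\<close>.\<close>

lemma increment_integral_lower:
  assumes H: "1/2 < H" "H < 1" and t: "0 < t" and \<beta>: "\<beta> < real DIM('a)"
  obtains C where "0 < C" "\<And>x y :: 'a::euclidean_space. x \<noteq> y \<Longrightarrow> norm (x - y) \<le> Z \<Longrightarrow>
     ennreal (C * norm (x - y) powr (2 * H + 1 - \<beta>)) \<le>
     increment_integral H \<beta> t x y"
proof -
  obtain C0 where C0: "0 < C0" "\<And>k. 8 / t \<le> k \<Longrightarrow> C0 * k powr (- 1 - 2 * H) \<le> Re (time_energy H (wave_profile t k))"
    using wave_energy_lower[OF H t] by blast
  let ?d = "DIM('a)"
  \<comment> \<open>\<open>n\<close> is large enough for all \<open>\<xi>\<close> in the ball to satisfy \<open>|\<xi>| \<ge> (R - 1/2)/|x-y| \<ge> 8/t\<close>\<close>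
  obtain n :: nat where n: "8 / t * Z + 1 \<le> real n" using real_arch_simple by blast
  define R where "R = (2 * real n + 1) * pi"
  have R1: "real n + 1 \<le> R"
  proof -
    have "(real n + 1) * 1 \<le> (2 * real n + 1) * pi"
      using pi_gt3 by (intro mult_mono) auto
    then show ?thesis by (simp add: R_def)
  qed
  have R: "1 \<le> R" "8 / t * Z \<le> R - 1/2" using R1 n by auto
  define e where "e = - real ?d + \<beta> - 1 - 2 * H"
  have e: "e < 0" using \<beta> H by (simp add: e_def)
  define C where "C = 2 * C0 * (R + 1/2) powr e * (unit_ball_vol (real ?d) * (1 / 2) ^ ?d)"
  have C: "0 < C" unfolding C_def using C0 R by (intro mult_pos_pos) auto
  have "ennreal (C * norm (x - y) powr (2 * H + 1 - \<beta>)) \<le>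
     increment_integral H \<beta> t x y"
    if xy: "x \<noteq> y" and Z: "norm (x - y) \<le> Z" for x y :: 'a
  proof -
    define z where "z = norm (x - y)"
    have z: "0 < z" using xy by (simp add: z_def)
    define c where "c = (R / z\<^sup>2) *\<^sub>R (x - y)"
    have nc: "norm c = R / z" using z R by (simp add: c_def z_def[symmetric] power2_eq_square)
    have cz: "c \<bullet> (x - y) = R" using z by (simp add: c_def z_def power2_norm_eq_inner)
    define m where "m = 2 * C0 * ((R + 1/2) / z) powr e"
    have m: "0 < m" unfolding m_def using C0 R z by (intro mult_pos_pos) auto
    have pt: "m \<le> norm \<xi> powr (- real ?d + \<beta>) * ((norm (phase_diff x y \<xi>))\<^sup>2 * Re (time_energy H (wave_profile t (norm \<xi>))))"
      if xi: "\<xi> \<in> cball c (1 / (2 * z))" for \<xi>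
    proof -
      have d: "norm (\<xi> - c) \<le> 1 / (2 * z)" using xi by (simp add: dist_norm norm_minus_commute)
      have up: "norm \<xi> \<le> (R + 1/2) / z"
      proof -
        have "norm \<xi> \<le> norm c + norm (\<xi> - c)" using norm_triangle_ineq[of c "\<xi> - c"] by simp
        also have "\<dots> \<le> R / z + 1 / (2 * z)" using d nc by simp
        finally show ?thesis using z by (simp add: field_simps)
      qed
      have lo: "(R - 1/2) / z \<le> norm \<xi>"
      proof -
        have "norm c \<le> norm \<xi> + norm (\<xi> - c)" using norm_triangle_ineq4[of \<xi> "\<xi> - c"] by simp
        then have "R / z - 1 / (2 * z) \<le> norm \<xi>" using d nc by simp
        then show ?thesis using z by (simp add: field_simps)
      qed
      have k: "8 / t \<le> norm \<xi>"
      proof -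
        have "8 / t * z \<le> 8 / t * Z" using Z t by (intro mult_left_mono) (auto simp: z_def)
        also have "\<dots> \<le> R - 1/2" by (rule R(2))
        finally have "8 / t \<le> (R - 1/2) / z" using z by (simp add: pos_le_divide_eq)
        then show ?thesis using lo by linarith
      qed
      have "0 < 8 / t" using t by simp
      then have n0: "0 < norm \<xi>" using k by linarith
      have "\<bar>(\<xi> - c) \<bullet> (x - y)\<bar> \<le> norm (\<xi> - c) * z"
        unfolding z_def by (rule Cauchy_Schwarz_ineq2)
      also have "\<dots> \<le> 1 / (2 * z) * z" using d z by (intro mult_right_mono) auto
      finally have small: "\<bar>(\<xi> - c) \<bullet> (x - y)\<bar> \<le> 1 / 2" using z by simp
      have "\<xi> \<bullet> (x - y) = (\<xi> - c) \<bullet> (x - y) + R" using cz by (simp add: inner_diff_left)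
      also have "R = pi + 2 * pi * real n" by (simp add: R_def algebra_simps)
      finally have arg: "\<xi> \<bullet> (x - y) = ((\<xi> - c) \<bullet> (x - y) + pi) + 2 * real n * pi" by (simp add: mult_ac)
      have "cos (\<xi> \<bullet> (x - y)) = - cos ((\<xi> - c) \<bullet> (x - y))"
        unfolding arg cos_add[of _ "2 * real n * pi"] by simp
      moreover have "0 \<le> cos ((\<xi> - c) \<bullet> (x - y))"
        using small pi_gt3 by (intro cos_ge_zero) (auto simp: abs_le_iff)
      ultimately have h: "2 \<le> (norm (phase_diff x y \<xi>))\<^sup>2" unfolding norm_phase_diff by linarith
      have "m \<le> 2 * C0 * norm \<xi> powr e"
        unfolding m_def using C0 e up n0 by (intro mult_left_mono powr_mono2') auto
      also have "\<dots> = norm \<xi> powr (- real ?d + \<beta>) * (2 * (C0 * norm \<xi> powr (- 1 - 2 * H)))"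
      proof -
        have "norm \<xi> powr (- real ?d + \<beta>) * norm \<xi> powr (- 1 - 2 * H) = norm \<xi> powr e"
          unfolding powr_add[symmetric] by (rule arg_cong[where f="(powr) (norm \<xi>)"]) (simp add: e_def)
        then show ?thesis by (metis mult.assoc mult.left_commute)
      qed
      also have "\<dots> \<le> norm \<xi> powr (- real ?d + \<beta>) * ((norm (phase_diff x y \<xi>))\<^sup>2 * Re (time_energy H (wave_profile t (norm \<xi>))))"
        using h C0 k by (intro mult_left_mono mult_mono) auto
      finally show ?thesis .
    qed
    have "ennreal (C * z powr (2 * H + 1 - \<beta>)) = ennreal (m * (unit_ball_vol (real ?d) * (1 / (2 * z)) ^ ?d))"
    proof -
      have "z powr (2 * H + 1 - \<beta>) = z powr (- e) * z powr (- real ?d)"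
        unfolding powr_add[symmetric] by (rule arg_cong[where f="(powr) z"]) (simp add: e_def)
      also have "\<dots> = 1 / z powr e * (1 / z ^ ?d)" using z by (simp add: powr_minus_divide powr_realpow)
      finally have "C * z powr (2 * H + 1 - \<beta>) = m * (unit_ball_vol (real ?d) * (1 / (2 * z)) ^ ?d)"
        using z R by (simp add: C_def m_def powr_divide power_divide power_mult_distrib)
      then show ?thesis by simp
    qed
    also have "\<dots> = (\<integral>\<^sup>+\<xi>. ennreal m * indicator (cball c (1 / (2 * z))) \<xi> \<partial>lborel)"
      using m z by (simp add: nn_integral_cmult_indicator emeasure_cball ennreal_mult)
    also have "\<dots> \<le> increment_integral H \<beta> t x y"
      unfolding increment_integral_def
    proof (rule nn_integral_mono)
      fix \<xi> :: 'a
      show "ennreal m * indicator (cball c (1 / (2 * z))) \<xi> \<le> ennreal (norm \<xi> powr (- real ?d + \<beta>)) *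
       ennreal ((norm (phase_diff x y \<xi>))\<^sup>2 * Re (time_energy H (wave_profile t (norm \<xi>))))"
        using ennreal_leI[OF pt[of \<xi>]] by (cases "\<xi> \<in> cball c (1 / (2 * z))") (simp_all add: ennreal_mult')
    qed
    finally show ?thesis by (simp add: z_def)
  qed
  then show ?thesis using that C by blast
qed

theorem proposition2:
  fixes P :: "'w measure"
    and f :: "'a::euclidean_space \<Rightarrow> real"
    and W :: "real \<Rightarrow> 'a set \<Rightarrow> 'w \<Rightarrow> real"
    and u :: "real \<Rightarrow> 'a \<Rightarrow> 'w \<Rightarrow> real"
    and H \<beta> t0 T M t :: real
  assumes "prob_space P"
    and "1/2 < H" and "H < 1"
    and "0 < t0" and "t0 < T"
    and "2 * H - 1 < \<beta>" and "\<beta> < min (real DIM('a)) (2 * H + 1)"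
    and "riesz_kernel \<beta> f"
    and "fractional_colored_noise P H f W"
    and "mild_wave_solution P H \<beta> W u"
    and "0 < M" and "t \<in> {t0..T}"
  shows "\<exists>c\<^sub>3>0. \<exists>c\<^sub>4>0. \<forall>x y.
           (\<forall>b\<in>Basis. x \<bullet> b \<in> {-M..M}) \<longrightarrow> (\<forall>b\<in>Basis. y \<bullet> b \<in> {-M..M}) \<longrightarrow>
             c\<^sub>3 * norm (x - y) powr (2 * H + 1 - \<beta>) \<le> (LINT \<omega>|P. \<bar>u t x \<omega> - u t y \<omega>\<bar>\<^sup>2) \<and>
             (LINT \<omega>|P. \<bar>u t x \<omega> - u t y \<omega>\<bar>\<^sup>2) \<le> c\<^sub>4 * norm (x - y) powr (2 * H + 1 - \<beta>)"
proof -
  note H = \<open>1/2 < H\<close> \<open>H < 1\<close>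
  have t: "0 < t" using \<open>0 < t0\<close> \<open>t \<in> {t0..T}\<close> by auto
  have \<beta>: "0 < \<beta>" "\<beta> < real DIM('a)" "\<beta> < 2 * H + 1"
    using H \<open>2 * H - 1 < \<beta>\<close> \<open>\<beta> < min (real DIM('a)) (2 * H + 1)\<close> by auto
  note iso = step_isometry[OF H \<beta>(1,2) \<open>riesz_kernel \<beta> f\<close> \<open>fractional_colored_noise P H f W\<close>]
  have sol: "wiener_integral P H \<beta> W (wave_integrand_fourier t x) (u t x)" for x
    using \<open>mild_wave_solution P H \<beta> W u\<close> t by (simp add: mild_wave_solution_def)
  note diff = wiener_integral_diff_isometry[OF H iso sol sol]
  define \<alpha> where "\<alpha> = H * (2 * H - 1)"
  have \<alpha>: "0 < \<alpha>" using H by (simp add: \<alpha>_def)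
  define V where "V x y = (LINT \<omega>|P. \<bar>u t x \<omega> - u t y \<omega>\<bar>\<^sup>2)" for x y
  have V: "ennreal (V x y) = ennreal \<alpha> * increment_integral H \<beta> t x y" for x y
  proof -
    have "V x y = (hp_norm H \<beta> (\<lambda>r \<xi>. wave_integrand_fourier t x r \<xi> - wave_integrand_fourier t y r \<xi>))\<^sup>2"
      unfolding V_def power2_abs by (rule diff(2))
    then show ?thesis by (simp only: increment_energy[OF H diff(1)] \<alpha>_def)
  qed
  have V0: "0 \<le> V x y" for x y unfolding V_def by (rule integral_nonneg_AE) simp
  define Z where "Z = 2 * M * real DIM('a)"
  obtain C1 where C1: "0 < C1" "\<And>x y :: 'a. x \<noteq> y \<Longrightarrow> norm (x - y) \<le> Z \<Longrightarrow>
     ennreal (C1 * norm (x - y) powr (2 * H + 1 - \<beta>)) \<le>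
     increment_integral H \<beta> t x y"
    using increment_integral_lower[where 'a='a and Z=Z, OF H t \<beta>(2)] by blast
  obtain C2 where C2: "0 < C2" "\<And>x y :: 'a. x \<noteq> y \<Longrightarrow>
     increment_integral H \<beta> t x y
     \<le> ennreal (C2 * norm (x - y) powr (2 * H + 1 - \<beta>))"
    using increment_integral_upper[where 'a='a, OF H t \<open>2 * H - 1 < \<beta>\<close> \<beta>(3)] by blast
  have main: "\<alpha> * C1 * norm (x - y) powr (2 * H + 1 - \<beta>) \<le> V x y \<and> V x y \<le> \<alpha> * C2 * norm (x - y) powr (2 * H + 1 - \<beta>)"
    if x: "\<forall>b\<in>Basis. x \<bullet> b \<in> {-M..M}" and y: "\<forall>b\<in>Basis. y \<bullet> b \<in> {-M..M}" for x y
  proof (cases "x = y")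
    case True
    then show ?thesis by (simp add: V_def)
  next
    case False
    have "norm (x - y) \<le> (\<Sum>b\<in>Basis. \<bar>(x - y) \<bullet> b\<bar>)" by (rule norm_le_l1)
    also have "\<dots> \<le> (\<Sum>b\<in>(Basis :: 'a set). 2 * M)"
    proof (rule sum_mono)
      fix b :: 'a assume "b \<in> Basis"
      then show "\<bar>(x - y) \<bullet> b\<bar> \<le> 2 * M"
        using bspec[OF x \<open>b \<in> Basis\<close>] bspec[OF y \<open>b \<in> Basis\<close>] by (simp add: inner_diff_left abs_le_iff)
    qed
    finally have Z: "norm (x - y) \<le> Z" by (simp add: Z_def mult_ac)
    have "ennreal (\<alpha> * C1 * norm (x - y) powr (2 * H + 1 - \<beta>)) = ennreal \<alpha> * ennreal (C1 * norm (x - y) powr (2 * H + 1 - \<beta>))"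
      using \<alpha> C1 by (simp add: ennreal_mult mult.assoc)
    also have "\<dots> \<le> ennreal (V x y)" unfolding V by (intro mult_left_mono C1(2) False Z) simp
    finally have 1: "\<alpha> * C1 * norm (x - y) powr (2 * H + 1 - \<beta>) \<le> V x y" using V0 by simp
    have "ennreal (V x y) \<le> ennreal \<alpha> * ennreal (C2 * norm (x - y) powr (2 * H + 1 - \<beta>))"
      unfolding V by (intro mult_left_mono C2(2) False) simp
    also have "\<dots> = ennreal (\<alpha> * C2 * norm (x - y) powr (2 * H + 1 - \<beta>))"
      using \<alpha> C2 by (simp add: ennreal_mult mult.assoc)
    finally have "V x y \<le> \<alpha> * C2 * norm (x - y) powr (2 * H + 1 - \<beta>)"
      using \<alpha> C2 by (subst (asm) ennreal_le_iff) auto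
    with 1 show ?thesis by simp
  qed
  show ?thesis
    using main \<alpha> C1(1) C2(1) unfolding V_def by (intro exI[of _ "\<alpha> * C1"] exI[of _ "\<alpha> * C2"] conjI) auto
qed

end
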